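(* Let $\mathbb{F}$ be an arbitrary field and let $E$ be the natural $2$-dimensional representation of $\mathrm{SL}_2(\mathbb{F})$. Let $M, d \in \mathbb{N}_0$ and let $N \in \mathbb{N}$ (so $N \geq 1$) be such that $N \le d+1$. Then there is an isomorphism of $\mathrm{SL}_2(\mathbb{F})$-representations $$\mathrm{Sym}_{M}\mathrm{Sym}^{N-1}E\otimes\mathrm{Sym}_{M+N}\mathrm{Sym}^{d-N+1}E \;\cong\; \Delta^{(M+1,1^{N-1})}\mathrm{Sym}^{d}E.$$
   Context: $\mathbb{N}_0 = \{0,1,2,\ldots\}$ and $\mathbb{N}=\{1,2,\ldots\}$. Upper symmetric powers: fixing a basis $X,Y$ of $E$, $\mathrm{Sym}^d E$ is the space of homogeneous polynomials of degree $d$ in $X,Y$ over $\mathbb{F}$, with basis $X^d, X^{d-1}Y,\ldots,Y^d$ and action $\begin{pmatrix}\alpha&\beta\\ \gamma&\delta\end{pmatrix}\cdot P(X,Y) = P(\alpha X+\gamma Y,\beta X+\delta Y)$. Lower symmetric powers: for a finite-dimensional vector space $V$ and $R\in\mathbb{N}_0$, $\mathrm{Sym}_R V = \{w\in V^{\otimes R} : \sigma\cdot w = w \text{ for all } \sigma\in\mathfrak{S}_R\}$, where the symmetric group $\mathfrak{S}_R$ acts by permuting tensor positions. Exterior powers: $\bigwedge^R V\subseteq V^{\otimes R}$ is the span of the elements $v_{1}\wedge\cdots\wedge v_{R} = \sum_{\sigma\in\mathfrak{S}_R}\mathrm{sgn}(\sigma)\,\sigma\cdot(v_1\otimes\cdots\otimes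 v_R)$. For $R=0$ both are $\mathbb{F}$. A group acting linearly on $V$ acts diagonally on $V^{\otimes R}$, and these are subrepresentations. Weyl functor for hook partitions: let $V$ have basis $v_0,\ldots,v_d$. For a tableau $t$ of hook shape $(M+1,1^{N-1})$ with entries in $\{0,\ldots,d\}$, with top row $a_0,a_1,\ldots,a_M$ and first column $a_0,b_1,\ldots,b_{N-1}$, define $$F_\Delta(t) = \sum (v_{c_0}\wedge v_{b_1}\wedge\cdots\wedge v_{b_{N-1}})\otimes v_{c_1}\otimes\cdots\otimes v_{c_M},$$ where the sum is over all distinct tuples $(c_0,c_1,\ldots,c_M)$ obtained by permuting $(a_0,a_1,\ldots,a_M)$. The Weyl module $\Delta^{(M+1,1^{N-1})}(V)$ is the $\mathrm{GL}(V)$-subrepresentation of $\bigwedge^N V\otimes V^{\otimes M}$ with basis all $F_\Delta(t)$ for $t$ a semistandard tableau (row weakly increasing, column strictly increasing) of shape $(M+1,1^{N-1})$ with entries in $\{0,\ldots,d\}$. $\Delta^{(M+1,1^{N-1})}\mathrm{Sym}^dE$ means this functor applied to $V=\mathrm{Sym}^dE$ (with basis $v_i = X^{d-i}Y^i$), with $\mathrm{SL}_2(\mathbb{F})$ acting through $\mathrm{Sym}^dE$. *)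

theory Defs
  imports
    "HOL-Analysis.Determinants"
    "HOL-Computational_Algebra.Polynomial"
    "HOL-Combinatorics.Permutations"
    "HOL-Combinatorics.List_Permutation"
    "HOL-Library.Function_Algebras"
begin

section \<open>Vectors in coordinates\<close>

text \<open>
  A vector space with a basis indexed by a finite set \<open>I\<close> is modelled as the space of functions
  \<open>f :: 'i \<Rightarrow> 'a\<close> that vanish off \<open>I\<close>; the basis vectors are \<open>unit_vec i\<close> for \<open>i \<in> I\<close>. In this
  model the tensor product of the spaces indexed by \<open>I\<close> and \<open>J\<close> is the space indexed by
  \<open>I \<times> J\<close>, and the \<open>R\<close>-th tensor power is the space indexed by the lists over \<open>I\<close> of length \<open>R\<close>.
\<close>

definition fscale :: "'a::field \<Rightarrow> ('i \<Rightarrow> 'a) \<Rightarrow> ('i \<Rightarrow> 'a)" where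
  "fscale c f = (\<lambda>i. c * f i)"

global_interpretation fvs: vector_space fscale
  by unfold_locales (auto simp: fscale_def fun_eq_iff algebra_simps)

definition unit_vec :: "'i \<Rightarrow> 'i \<Rightarrow> 'a::field" where
  "unit_vec i = (\<lambda>j. if j = i then 1 else 0)"

definition tensor :: "('i \<Rightarrow> 'a::field) \<Rightarrow> ('j \<Rightarrow> 'a) \<Rightarrow> ('i \<times> 'j \<Rightarrow> 'a)" where
  "tensor u w = (\<lambda>(i, j). u i * w j)"

text \<open>The elementary tensor \<open>v\<^sub>1 \<otimes> \<dots> \<otimes> v\<^sub>R\<close>.\<close>

definition pure_tensor :: "('i \<Rightarrow> 'a::field) list \<Rightarrow> ('i list \<Rightarrow> 'a)" where
  "pure_tensor vs =
     (\<lambda>is. if length is = length vs then \<Prod>k<length vs. (vs ! k) (is ! k) else 0)"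

text \<open>
  The place permutation action: \<open>perm_tensor \<sigma>\<close> moves the factor in position \<open>k\<close> to
  position \<open>\<sigma> k\<close> (see \<open>perm_tensor_pure_tensor\<close> below).
\<close>

definition perm_tensor :: "(nat \<Rightarrow> nat) \<Rightarrow> ('i list \<Rightarrow> 'a) \<Rightarrow> ('i list \<Rightarrow> 'a)" where
  "perm_tensor \<sigma> w = (\<lambda>is. w (permute_list \<sigma> is))"

definition wedge :: "('i \<Rightarrow> 'a::field) list \<Rightarrow> ('i list \<Rightarrow> 'a)" where
  "wedge vs = (\<Sum>\<sigma> | \<sigma> permutes {..<length vs}.
                 fscale (of_int (sign \<sigma>)) (perm_tensor \<sigma> (pure_tensor vs)))"

lemma perm_tensor_pure_tensor:
  assumes "\<sigma> permutes {..<length vs}"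
  shows "perm_tensor \<sigma> (pure_tensor vs) = pure_tensor (permute_list (inv \<sigma>) vs)"
proof
  fix "is"
  have *: "inv \<sigma> permutes {..<length vs}"
    using assms by (rule permutes_inv)
  have "(\<Prod>k<length vs. (vs ! k) (is ! \<sigma> k)) = (\<Prod>k<length vs. (vs ! inv \<sigma> k) (is ! k))"
    using prod.permute[OF assms, of "\<lambda>k. (vs ! inv \<sigma> k) (is ! k)"]
    by (simp add: permutes_inverses[OF assms] o_def)
  then show "perm_tensor \<sigma> (pure_tensor vs) is = pure_tensor (permute_list (inv \<sigma>) vs) is"
    using assms *
    by (auto simp: perm_tensor_def pure_tensor_def permute_list_nth)
qed


section \<open>Representations of the special linear group\<close>

definition SL2 :: "('a::field ^ 2 ^ 2) set" where
  "SL2 = {g. det g = 1}"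

text \<open>
  A representation is given as a subspace \<open>rep_space\<close> of the coordinate space indexed by the
  finite set \<open>rep_index\<close>. The action \<open>rep_act\<close> is defined on the whole coordinate space.
\<close>

record ('i, 'a) rep =
  rep_index :: "'i set"
  rep_space :: "('i \<Rightarrow> 'a) set"
  rep_act :: "'a ^ 2 ^ 2 \<Rightarrow> ('i \<Rightarrow> 'a) \<Rightarrow> ('i \<Rightarrow> 'a)"

definition is_rep :: "('i, 'a::field) rep \<Rightarrow> bool" where
  "is_rep A \<longleftrightarrow>
     fvs.subspace (rep_space A) \<and>
     (\<forall>g\<in>SL2. \<forall>u\<in>rep_space A. rep_act A g u \<in> rep_space A) \<and>
     (\<forall>g\<in>SL2. \<forall>u\<in>rep_space A. \<forall>v\<in>rep_space A.
        rep_act A g (u + v) = rep_act A g u + rep_act A g v) \<and>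
     (\<forall>g\<in>SL2. \<forall>c. \<forall>u\<in>rep_space A. rep_act A g (fscale c u) = fscale c (rep_act A g u)) \<and>
     (\<forall>u\<in>rep_space A. rep_act A (mat 1) u = u) \<and>
     (\<forall>g\<in>SL2. \<forall>h\<in>SL2. \<forall>u\<in>rep_space A.
        rep_act A (g ** h) u = rep_act A g (rep_act A h u))"

definition rep_iso :: "('i, 'a::field) rep \<Rightarrow> ('j, 'a) rep \<Rightarrow> bool"  (infix "\<cong>\<^sub>r" 50) where
  "A \<cong>\<^sub>r B \<longleftrightarrow> is_rep A \<and> is_rep B \<and>
     (\<exists>\<phi>. bij_betw \<phi> (rep_space A) (rep_space B) \<and>
        (\<forall>u\<in>rep_space A. \<forall>v\<in>rep_space A. \<phi> (u + v) = \<phi> u + \<phi> v) \<and>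
        (\<forall>c. \<forall>u\<in>rep_space A. \<phi> (fscale c u) = fscale c (\<phi> u)) \<and>
        (\<forall>g\<in>SL2. \<forall>u\<in>rep_space A. \<phi> (rep_act A g u) = rep_act B g (\<phi> u)))"


section \<open>Tensor products and tensor powers\<close>

text \<open>
  In both cases the action is the linear extension of the diagonal action on the elementary
  tensors of basis vectors.
\<close>

definition tensor_rep :: "('i, 'a::field) rep \<Rightarrow> ('j, 'a) rep \<Rightarrow> ('i \<times> 'j, 'a) rep"
    (infixr "\<otimes>\<^sub>r" 70) where
  "A \<otimes>\<^sub>r B = \<lparr>
     rep_index = rep_index A \<times> rep_index B,
     rep_space = fvs.span {tensor u w | u w. u \<in> rep_space A \<and> w \<in> rep_space B},
     rep_act = (\<lambda>g z. \<Sum>(i, j)\<in>rep_index A \<times> rep_index B.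
       fscale (z (i, j)) (tensor (rep_act A g (unit_vec i)) (rep_act B g (unit_vec j))))\<rparr>"

definition tensor_power :: "nat \<Rightarrow> ('i, 'a::field) rep \<Rightarrow> ('i list, 'a) rep" where
  "tensor_power R A = \<lparr>
     rep_index = {is. length is = R \<and> set is \<subseteq> rep_index A},
     rep_space = fvs.span {pure_tensor vs | vs. length vs = R \<and> set vs \<subseteq> rep_space A},
     rep_act = (\<lambda>g w. \<Sum>is | length is = R \<and> set is \<subseteq> rep_index A.
       fscale (w is) (pure_tensor (map (\<lambda>i. rep_act A g (unit_vec i)) is)))\<rparr>"

definition lower_sym :: "nat \<Rightarrow> ('i, 'a::field) rep \<Rightarrow> ('i list, 'a) rep" where
  "lower_sym R A = (tensor_power R A)\<lparr>
     rep_space := {w \<in> rep_space (tensor_power R A).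
                     \<forall>\<sigma>. \<sigma> permutes {..<R} \<longrightarrow> perm_tensor \<sigma> w = w}\<rparr>"

definition ext_power :: "nat \<Rightarrow> ('i, 'a::field) rep \<Rightarrow> ('i list, 'a) rep" where
  "ext_power R A = (tensor_power R A)\<lparr>
     rep_space := fvs.span {wedge vs | vs. length vs = R \<and> set vs \<subseteq> rep_space A}\<rparr>"


section \<open>The Weyl functor for hook partitions\<close>

text \<open>
  A tableau of shape \<open>(M + 1, 1\<^bsup>N-1\<^esup>)\<close> is a pair \<open>(as, bs)\<close>: \<open>as = [a\<^sub>0, \<dots>, a\<^sub>M]\<close> is its top row and
  \<open>bs = [b\<^sub>1, \<dots>, b\<^bsub>N-1\<^esub>]\<close> is its first column without the corner entry \<open>a\<^sub>0\<close>.
\<close>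

definition semistandard_hooks :: "nat \<Rightarrow> nat \<Rightarrow> 'i::linorder set \<Rightarrow> ('i list \<times> 'i list) set" where
  "semistandard_hooks M N I =
     {(as, bs). length as = M + 1 \<and> length bs = N - 1 \<and> set as \<subseteq> I \<and> set bs \<subseteq> I \<and>
        sorted as \<and> sorted_wrt (<) (hd as # bs)}"

definition F_Delta :: "'i list \<times> 'i list \<Rightarrow> ('i list \<times> 'i list \<Rightarrow> 'a::field)" where
  "F_Delta = (\<lambda>(as, bs). \<Sum>cs | mset cs = mset as.
     tensor (wedge (map unit_vec (hd cs # bs))) (pure_tensor (map unit_vec (tl cs))))"

text \<open>
  \<open>weyl_hook M N A\<close> is \<open>\<Delta>\<^bsup>(M+1,1^(N-1))\<^esup>\<close> for \<open>N \<ge> 1\<close>. It is meant for representations \<open>A\<close>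
  whose space is the full coordinate space, so that the \<open>unit_vec i\<close> with \<open>i \<in> rep_index A\<close>
  form a basis of it.
\<close>

definition weyl_hook ::
    "nat \<Rightarrow> nat \<Rightarrow> ('i::linorder, 'a::field) rep \<Rightarrow> ('i list \<times> 'i list, 'a) rep" where
  "weyl_hook M N A = (ext_power N A \<otimes>\<^sub>r tensor_power M A)\<lparr>
     rep_space := fvs.span (F_Delta ` semistandard_hooks M N (rep_index A))\<rparr>"


section \<open>Upper symmetric powers of the natural representation\<close>

text \<open>
  Polynomials in \<open>X\<close> and \<open>Y\<close> are elements of \<open>'a poly poly\<close>, where \<open>Y\<close> is the outer variable.
\<close>

definition bconst :: "'a::field \<Rightarrow> 'a poly poly" where
  "bconst c = [:[:c:]:]"

definition X_poly :: "'a::field poly poly" where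
  "X_poly = [:[:0, 1:]:]"

definition Y_poly :: "'a::field poly poly" where
  "Y_poly = [:0, 1:]"

definition bcoeff :: "'a::field poly poly \<Rightarrow> nat \<Rightarrow> nat \<Rightarrow> 'a" where
  "bcoeff P i j = coeff (coeff P j) i"

definition bsubst :: "'a::field poly poly \<Rightarrow> 'a poly poly \<Rightarrow> 'a poly poly \<Rightarrow> 'a poly poly" where
  "bsubst P A B =
     (\<Sum>j\<le>degree P. \<Sum>i\<le>degree (coeff P j). bconst (bcoeff P i j) * A ^ i * B ^ j)"

definition homogeneous_polys :: "nat \<Rightarrow> 'a::field poly poly set" where
  "homogeneous_polys d = {P. \<forall>i j. bcoeff P i j \<noteq> 0 \<longrightarrow> i + j = d}"

definition poly_act :: "'a::field ^ 2 ^ 2 \<Rightarrow> 'a poly poly \<Rightarrow> 'a poly poly" where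
  "poly_act g P = bsubst P
     (bconst (g $ 1 $ 1) * X_poly + bconst (g $ 2 $ 1) * Y_poly)
     (bconst (g $ 1 $ 2) * X_poly + bconst (g $ 2 $ 2) * Y_poly)"

text \<open>
  \<open>Sym\<^sup>d E\<close> is the space of homogeneous polynomials of degree \<open>d\<close>, written in coordinates with
  respect to its basis \<open>v\<^sub>i = X\<^bsup>d-i\<^esup>Y\<^sup>i\<close>, \<open>0 \<le> i \<le> d\<close>.
\<close>

definition sym_poly :: "nat \<Rightarrow> (nat \<Rightarrow> 'a::field) \<Rightarrow> 'a poly poly" where
  "sym_poly d c = (\<Sum>i\<le>d. bconst (c i) * X_poly ^ (d - i) * Y_poly ^ i)"

definition sym_coords :: "nat \<Rightarrow> 'a::field poly poly \<Rightarrow> (nat \<Rightarrow> 'a)" where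
  "sym_coords d P = (\<lambda>i. if i \<le> d then bcoeff P (d - i) i else 0)"

definition upper_sym :: "nat \<Rightarrow> (nat, 'a::field) rep" where
  "upper_sym d = \<lparr>
     rep_index = {0..d},
     rep_space = {c. \<forall>i. i \<notin> {0..d} \<longrightarrow> c i = 0},
     rep_act = (\<lambda>g c. sym_coords d (poly_act g (sym_poly d c)))\<rparr>"

subsection \<open>Passing between coordinates and polynomials\<close>

lemma monomial_eq: "bconst c * X_poly ^ a * Y_poly ^ b = monom (monom c a) b"
proof -
  have x: "X_poly ^ a = [:monom (1::'a) a:]"
    by (induction a) (simp_all add: X_poly_def one_pCons monom_0 monom_Suc mult.commute)
  have y: "Y_poly ^ b = monom (1::'a poly) b"
    by (simp add: Y_poly_def monom_altdef)
  show ?thesis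
    by (simp add: x y bconst_def smult_monom)
qed

lemma bcoeff_monomial:
  "bcoeff (bconst c * X_poly ^ a * Y_poly ^ b) i j = (if i = a \<and> j = b then c else 0)"
  unfolding monomial_eq bcoeff_def by auto

lemma bcoeff_sum: "bcoeff (sum f S) i j = (\<Sum>s\<in>S. bcoeff (f s) i j)"
  by (simp add: bcoeff_def coeff_sum)

lemma bcoeff_sym_poly:
  "bcoeff (sym_poly d c) i j = (if i + j = d then c j else 0)"
proof -
  have "bcoeff (sym_poly d c) i j = (\<Sum>k\<le>d. if i = d - k \<and> j = k then c k else 0)"
    by (simp add: sym_poly_def bcoeff_sum bcoeff_monomial)
  also have "\<dots> = (\<Sum>k\<le>d. if k = j then (if i + j = d then c j else 0) else 0)"
    by (intro sum.cong) auto
  finally show ?thesis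
    by auto
qed

lemma bipoly_eqI: "(\<And>i j. bcoeff P i j = bcoeff Q i j) \<Longrightarrow> P = Q"
  by (simp add: bcoeff_def poly_eq_iff)

lemma sym_poly_sym_coords:
  assumes "P \<in> homogeneous_polys d"
  shows "sym_poly d (sym_coords d P) = P"
  using assms
  by (intro bipoly_eqI) (auto simp: bcoeff_sym_poly sym_coords_def homogeneous_polys_def)

lemma sym_coords_sym_poly:
  assumes "c \<in> rep_space (upper_sym d)"
  shows "sym_coords d (sym_poly d c) = c"
  using assms by (auto simp: bcoeff_sym_poly sym_coords_def upper_sym_def fun_eq_iff)

lemma bij_betw_sym_poly: "bij_betw (sym_poly d) (rep_space (upper_sym d)) (homogeneous_polys d)"
proof (rule bij_betw_byWitness[where f' = "sym_coords d"])
  show "sym_poly d ` rep_space (upper_sym d) \<subseteq> homogeneous_polys d"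
    by (auto simp: homogeneous_polys_def bcoeff_sym_poly split: if_splits)
  show "sym_coords d ` homogeneous_polys d \<subseteq> rep_space (upper_sym d)"
    by (auto simp: upper_sym_def sym_coords_def)
qed (auto simp: sym_coords_sym_poly sym_poly_sym_coords)

lemma bsubst_bound:
  assumes "\<And>i j. bcoeff P i j \<noteq> 0 \<Longrightarrow> i \<le> m \<and> j \<le> n"
  shows "bsubst P A B = (\<Sum>j\<le>n. \<Sum>i\<le>m. bconst (bcoeff P i j) * A ^ i * B ^ j)"
proof -
  let ?t = "\<lambda>i j. bconst (bcoeff P i j) * A ^ i * B ^ j"
  have z: "?t i j = 0" if "bcoeff P i j = 0" for i j
    using that by (simp add: bconst_def)
  have inner: "(\<Sum>i\<le>degree (coeff P j). ?t i j) = (\<Sum>i\<le>m. ?t i j)" for j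
  proof (rule sum.mono_neutral_cong)
    show "?t i j = 0" if "i \<in> {..m} - {..degree (coeff P j)}" for i
      using that by (intro z) (simp add: bcoeff_def coeff_eq_0)
    show "?t i j = 0" if "i \<in> {..degree (coeff P j)} - {..m}" for i
      using that assms by (intro z) force
  qed auto
  have "(\<Sum>j\<le>degree P. \<Sum>i\<le>m. ?t i j) = (\<Sum>j\<le>n. \<Sum>i\<le>m. ?t i j)"
  proof (rule sum.mono_neutral_cong)
    show "(\<Sum>i\<le>m. ?t i j) = 0" if "j \<in> {..n} - {..degree P}" for j
      using that by (intro sum.neutral ballI z) (simp add: bcoeff_def coeff_eq_0)
    show "(\<Sum>i\<le>m. ?t i j) = 0" if "j \<in> {..degree P} - {..n}" for j
      using that assms by (intro sum.neutral ballI z) force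
  qed auto
  then show ?thesis
    by (simp add: bsubst_def inner)
qed

lemma bcoeff_bounded: "\<exists>k. \<forall>i j. bcoeff P i j \<noteq> 0 \<longrightarrow> i \<le> k \<and> j \<le> k"
proof (intro exI allI impI)
  fix i j assume ne: "bcoeff P i j \<noteq> 0"
  then have j: "j \<le> degree P"
    by (intro le_degree) (auto simp: bcoeff_def)
  have "i \<le> degree (coeff P j)"
    using ne by (intro le_degree) (auto simp: bcoeff_def)
  also have "\<dots> \<le> (\<Sum>l\<le>degree P. degree (coeff P l))"
    using j by (intro member_le_sum) auto
  finally show "i \<le> degree P + (\<Sum>l\<le>degree P. degree (coeff P l)) \<and>
      j \<le> degree P + (\<Sum>l\<le>degree P. degree (coeff P l))"
    using j by simp
qed

lemma bconst_add: "bconst (a + b) = bconst a + bconst b"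
  and bconst_mult: "bconst (a * b) = bconst a * bconst b"
  and bconst_0: "bconst 0 = 0"
  and bconst_1: "bconst 1 = 1"
  by (simp_all add: bconst_def one_pCons)

lemma bsubst_add: "bsubst (P + Q) A B = bsubst P A B + bsubst Q A B"
proof -
  obtain k l where k: "\<forall>i j. bcoeff P i j \<noteq> 0 \<longrightarrow> i \<le> k \<and> j \<le> k"
    and l: "\<forall>i j. bcoeff Q i j \<noteq> 0 \<longrightarrow> i \<le> l \<and> j \<le> l"
    using bcoeff_bounded by metis
  have PQ [simp]: "bcoeff (P + Q) i j = bcoeff P i j + bcoeff Q i j" for i j
    by (simp add: bcoeff_def)
  have b: "i \<le> max k l \<and> j \<le> max k l"
    if "bcoeff P i j \<noteq> 0 \<or> bcoeff Q i j \<noteq> 0" for i j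
    using that k l by (auto simp: le_max_iff_disj)
  have P: "bsubst P A B = (\<Sum>j\<le>max k l. \<Sum>i\<le>max k l. bconst (bcoeff P i j) * A ^ i * B ^ j)"
    and Q: "bsubst Q A B = (\<Sum>j\<le>max k l. \<Sum>i\<le>max k l. bconst (bcoeff Q i j) * A ^ i * B ^ j)"
    by (rule bsubst_bound, rule b, simp)+
  have "bsubst (P + Q) A B =
      (\<Sum>j\<le>max k l. \<Sum>i\<le>max k l. bconst (bcoeff (P + Q) i j) * A ^ i * B ^ j)"
    by (rule bsubst_bound, rule b) (metis PQ add_0)
  then show ?thesis
    unfolding P Q by (simp add: bconst_add distrib_right sum.distrib)
qed

lemma bsubst_0: "bsubst 0 A B = 0"
  by (simp add: bsubst_def bcoeff_def bconst_def)

lemma bsubst_sum: "bsubst (\<Sum>s\<in>S. f s) A B = (\<Sum>s\<in>S. bsubst (f s) A B)"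
  by (induction S rule: infinite_finite_induct) (simp_all add: bsubst_0 bsubst_add)

lemma bsubst_monomial:
  "bsubst (bconst c * X_poly ^ a * Y_poly ^ b) A B = bconst c * A ^ a * B ^ b"
proof -
  have "bsubst (bconst c * X_poly ^ a * Y_poly ^ b) A B =
      (\<Sum>j\<le>b. \<Sum>i\<le>a. if j = b then if i = a then bconst c * A ^ i * B ^ j else 0 else 0)"
    by (subst bsubst_bound[where m = a and n = b])
       (auto simp: bcoeff_monomial bconst_0 split: if_splits intro!: sum.cong)
  also have "\<dots> = (\<Sum>j\<le>b. if j = b then bconst c * A ^ a * B ^ j else 0)"
    by (intro sum.cong) auto
  finally show ?thesis
    by simp
qed

lemma bsubst_X_Y: "bsubst P X_poly Y_poly = P"
proof -
  obtain k where k: "\<forall>i j. bcoeff P i j \<noteq> 0 \<longrightarrow> i \<le> k \<and> j \<le> k"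
    using bcoeff_bounded by metis
  have "bcoeff (bsubst P X_poly Y_poly) i j = bcoeff P i j" for i j
  proof -
    have "bcoeff (bsubst P X_poly Y_poly) i j =
        (\<Sum>j'\<le>k. \<Sum>i'\<le>k. if i = i' \<and> j = j' then bcoeff P i' j' else 0)"
      using k by (subst bsubst_bound[where m = k and n = k]) (simp_all add: bcoeff_sum bcoeff_monomial)
    also have "\<dots> = (\<Sum>j'\<le>k. if j = j' then (\<Sum>i'\<le>k. if i = i' then bcoeff P i' j' else 0) else 0)"
      by (intro sum.cong) auto
    also have "\<dots> = bcoeff P i j"
      using k by auto
    finally show ?thesis .
  qed
  then show ?thesis
    by (rule bipoly_eqI)
qed

lemma bsubst_mult: "bsubst (P * Q) A B = bsubst P A B * bsubst Q A B"
proof -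
  have mono: "bsubst ((bconst c * X_poly ^ a * Y_poly ^ b) * (bconst c' * X_poly ^ a' * Y_poly ^ b')) A B
      = bsubst (bconst c * X_poly ^ a * Y_poly ^ b) A B *
        bsubst (bconst c' * X_poly ^ a' * Y_poly ^ b') A B" for c c' :: 'a and a a' b b'
  proof -
    have "(bconst c * X_poly ^ a * Y_poly ^ b) * (bconst c' * X_poly ^ a' * Y_poly ^ b') =
        bconst (c * c') * X_poly ^ (a + a') * Y_poly ^ (b + b')"
      by (simp add: bconst_mult power_add algebra_simps)
    then show ?thesis
      by (simp only: bsubst_monomial) (simp add: bconst_mult power_add algebra_simps)
  qed
  have expand: "\<exists>S :: (nat \<times> nat) set. \<exists>f. R = (\<Sum>s\<in>S. bconst (f s) * X_poly ^ fst s * Y_poly ^ snd s)"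
    for R :: "'a poly poly"
  proof -
    obtain k where k: "\<forall>i j. bcoeff R i j \<noteq> 0 \<longrightarrow> i \<le> k \<and> j \<le> k"
      using bcoeff_bounded by metis
    have "R = (\<Sum>j\<le>k. \<Sum>i\<le>k. bconst (bcoeff R i j) * X_poly ^ i * Y_poly ^ j)"
      by (subst bsubst_X_Y[symmetric], rule bsubst_bound) (use k in auto)
    also have "\<dots> = (\<Sum>(j, i)\<in>{..k} \<times> {..k}. bconst (bcoeff R i j) * X_poly ^ i * Y_poly ^ j)"
      by (simp add: sum.cartesian_product)
    also have "\<dots> = (\<Sum>s\<in>{..k} \<times> {..k}.
        bconst (bcoeff R (fst s) (snd s)) * X_poly ^ fst s * Y_poly ^ snd s)"
      by (rule sum.reindex_bij_witness[of _ prod.swap prod.swap]) auto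
    finally show ?thesis
      by (intro exI)
  qed
  obtain S f where P: "P = (\<Sum>s\<in>S. bconst (f s) * X_poly ^ fst s * Y_poly ^ snd s)"
    using expand by metis
  obtain T h where Q: "Q = (\<Sum>s\<in>T. bconst (h s) * X_poly ^ fst s * Y_poly ^ snd s)"
    using expand by metis
  show ?thesis
    unfolding P Q sum_product bsubst_sum mono ..
qed

lemma bsubst_1: "bsubst 1 A B = 1"
  using bsubst_monomial[of 1 0 0 A B] by (simp add: bconst_1)

lemma bsubst_power: "bsubst (P ^ n) A B = bsubst P A B ^ n"
  by (induction n) (simp_all add: bsubst_1 bsubst_mult)

lemma bsubst_bconst: "bsubst (bconst c) A B = bconst c"
  and bsubst_X: "bsubst X_poly A B = A"
  and bsubst_Y: "bsubst Y_poly A B = B"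
  using bsubst_monomial[of c 0 0 A B] bsubst_monomial[of 1 1 0 A B] bsubst_monomial[of 1 0 1 A B]
  by (simp_all add: bconst_1)

lemma poly_act_sym_poly:
  "poly_act g (sym_poly d c) =
     (\<Sum>i\<le>d. bconst (c i) * (bconst (g $ 1 $ 1) * X_poly + bconst (g $ 2 $ 1) * Y_poly) ^ (d - i)
                        * (bconst (g $ 1 $ 2) * X_poly + bconst (g $ 2 $ 2) * Y_poly) ^ i)"
  by (simp add: poly_act_def sym_poly_def bsubst_sum bsubst_monomial)

lemma homogeneous_mult:
  assumes "P \<in> homogeneous_polys d" "Q \<in> homogeneous_polys e"
  shows "P * Q \<in> homogeneous_polys (d + e)"
proof -
  have "i + j = d + e" if "bcoeff (P * Q) i j \<noteq> 0" for i j
  proof -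
    from that have "(\<Sum>l\<le>j. \<Sum>k\<le>i. bcoeff P k l * bcoeff Q (i - k) (j - l)) \<noteq> 0"
      by (simp add: bcoeff_def coeff_mult coeff_sum)
    then obtain k l where kl: "l \<le> j" "k \<le> i" "bcoeff P k l * bcoeff Q (i - k) (j - l) \<noteq> 0"
      by (meson atMost_iff sum.not_neutral_contains_not_neutral)
    then have "k + l = d" "(i - k) + (j - l) = e"
      using assms by (auto simp: homogeneous_polys_def)
    with kl show ?thesis
      by simp
  qed
  then show ?thesis
    by (simp add: homogeneous_polys_def)
qed

lemma homogeneous_power:
  fixes P :: "'a::field poly poly"
  assumes "P \<in> homogeneous_polys d"
  shows "P ^ n \<in> homogeneous_polys (n * d)"
proof (induction n)
  case 0
  have "bcoeff (1 :: 'a poly poly) i j = (if i = 0 \<and> j = 0 then 1 else 0)" for i j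
    using bcoeff_monomial[of "1 :: 'a" 0 0 i j] by (simp add: bconst_1)
  then show ?case
    by (auto simp: homogeneous_polys_def)
qed (use homogeneous_mult[OF assms] in simp)

lemma homogeneous_linear: "bconst a * X_poly + bconst b * Y_poly \<in> homogeneous_polys 1"
  using bcoeff_sym_poly[of 1 "\<lambda>i. if i = 0 then a else b"]
  by (simp add: homogeneous_polys_def sym_poly_def)

lemma homogeneous_bconst: "bconst a \<in> homogeneous_polys 0"
  using bcoeff_monomial[of a 0 0] by (simp add: homogeneous_polys_def)

lemma homogeneous_sum:
  assumes "\<And>s. s \<in> S \<Longrightarrow> f s \<in> homogeneous_polys d"
  shows "sum f S \<in> homogeneous_polys d"
  using assms unfolding homogeneous_polys_def mem_Collect_eq bcoeff_sum
  by (meson sum.not_neutral_contains_not_neutral)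

lemma poly_act_homogeneous:
  assumes "P \<in> homogeneous_polys d"
  shows "poly_act g P \<in> homogeneous_polys d"
proof -
  have "poly_act g (sym_poly d (sym_coords d P)) \<in> homogeneous_polys d"
    unfolding poly_act_sym_poly
  proof (rule homogeneous_sum)
    fix i assume "i \<in> {..d}"
    then show "bconst (sym_coords d P i)
          * (bconst (g $ 1 $ 1) * X_poly + bconst (g $ 2 $ 1) * Y_poly) ^ (d - i)
          * (bconst (g $ 1 $ 2) * X_poly + bconst (g $ 2 $ 2) * Y_poly) ^ i \<in> homogeneous_polys d"
      using homogeneous_mult[OF homogeneous_mult[OF homogeneous_bconst
        homogeneous_power[OF homogeneous_linear]] homogeneous_power[OF homogeneous_linear],
        of _ _ _ "d - i" _ _ i]
      by simp
  qed
  then show ?thesis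
    using assms by (simp add: sym_poly_sym_coords)
qed

lemma poly_act_mult: "poly_act (g ** h) P = poly_act g (poly_act h P)"
proof -
  obtain k where k: "\<forall>i j. bcoeff P i j \<noteq> 0 \<longrightarrow> i \<le> k \<and> j \<le> k"
    using bcoeff_bounded by metis
  have P: "bsubst P A B = (\<Sum>j\<le>k. \<Sum>i\<le>k. bconst (bcoeff P i j) * A ^ i * B ^ j)" for A B
    using k by (intro bsubst_bound) auto
  have "(g ** h) $ i $ j = g $ i $ 1 * h $ 1 $ j + g $ i $ 2 * h $ 2 $ j" for i j
    by (simp add: matrix_matrix_mult_def sum_2)
  then show ?thesis
    unfolding poly_act_def P
    by (simp add: bsubst_sum bsubst_mult bsubst_add bsubst_power bsubst_bconst bsubst_X bsubst_Y
        bconst_add bconst_mult algebra_simps)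
qed

lemma poly_act_one: "poly_act (mat 1) P = P"
  by (simp add: poly_act_def mat_def bconst_0 bconst_1 bsubst_X_Y)

text \<open>
  Under the bijection \<open>sym_poly d\<close>, the action on coordinates is the action on polynomials.
\<close>

lemma sym_poly_act:
  assumes "c \<in> rep_space (upper_sym d)"
  shows "sym_poly d (rep_act (upper_sym d) g c) = poly_act g (sym_poly d c)"
proof -
  have "sym_poly d c \<in> homogeneous_polys d"
    using bij_betw_sym_poly assms by (auto simp: bij_betw_def)
  then show ?thesis
    by (simp add: upper_sym_def sym_poly_sym_coords poly_act_homogeneous)
qed

lemma is_rep_upper_sym: "is_rep (upper_sym d)"
proof -
  have space: "rep_act (upper_sym d) g c \<in> rep_space (upper_sym d)" for g and c :: "nat \<Rightarrow> 'a"
    by (simp add: upper_sym_def sym_coords_def)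
  have coords: "sym_coords d (P + Q) = sym_coords d P + sym_coords d Q"
    "sym_coords d (bconst c * P) = fscale c (sym_coords d P)" for c :: 'a and P Q
    by (auto simp: sym_coords_def bcoeff_def bconst_def fscale_def fun_eq_iff)
  have polys: "sym_poly d (u + v) = sym_poly d u + sym_poly d v"
    "sym_poly d (fscale c u) = bconst c * sym_poly d u" for c :: 'a and u v
    by (simp_all add: sym_poly_def fscale_def bconst_add bconst_mult sum.distrib sum_distrib_left
        algebra_simps)
  have "rep_act (upper_sym d) (g ** h) c = rep_act (upper_sym d) g (rep_act (upper_sym d) h c)"
    if "c \<in> rep_space (upper_sym d)" for g h and c :: "nat \<Rightarrow> 'a"
    by (rule inj_onD[OF bij_betw_imp_inj_on[OF bij_betw_sym_poly[of d]]])
       (simp_all add: that space sym_poly_act poly_act_mult)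
  moreover have "fvs.subspace (rep_space (upper_sym d :: (nat, 'a) rep))"
    by (auto simp: fvs.subspace_def upper_sym_def fscale_def)
  moreover have "rep_act (upper_sym d) (mat 1) c = c"
    if "c \<in> rep_space (upper_sym d)" for c :: "nat \<Rightarrow> 'a"
    using that sym_coords_sym_poly[OF that] by (simp add: upper_sym_def poly_act_one)
  ultimately show ?thesis
    unfolding is_rep_def
    using space
    by (auto simp: upper_sym_def poly_act_def bsubst_add bsubst_mult bsubst_bconst coords polys)
qed

end

theory Submission
  imports Defs
begin

text \<open>
  A tensor in a tensor power of \<open>Sym\<^sup>d E\<close> is a polynomial, homogeneous of degree \<open>d\<close> in each of
      several
  pairs of variables. The isomorphism multiplies \<open>f(y) \<otimes> g(x, y)\<close>, where \<open>f\<close> is symmetric in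
  \<open>y\<^sub>1, \<dots>, y\<^sub>M\<close> and \<open>g\<close> is symmetric in \<open>x\<^sub>1, \<dots>, x\<^sub>N, y\<^sub>1, \<dots>, y\<^sub>M\<close>, with the Vandermonde determinant
  \<open>V(x)\<close>, which is \<open>SL\<^sub>2\<close>-invariant.

  The Weyl module consists of the tensors that are alternating in \<open>x\<close>, symmetric in \<open>y\<close> and satisfy
  the Koszul relation \<open>P(x; y) = \<Sum>\<^sub>k P(x with x\<^sub>k and y\<^sub>1 exchanged)\<close>: such a tensor is
      determined by its
  coefficients at semistandard positions, where the \<open>F_Delta t\<close> are a dual basis. The product
  \<open>V(x) f(y) g(x, y)\<close> satisfies the relation by Lagrange interpolation, as \<open>f\<close> has degree less than
  \<open>N\<close> in \<open>y\<^sub>1\<close>.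

  The multiplication is injective by a leading term argument: a term of maximal square norm is one
  in which the exponents of \<open>V(x) f(y)\<close> and of \<open>g\<close> are ordered alike,
      and these can be recovered from
  their sums. The same recovery, applied to semistandard tableaux, gives as many independent
  elements in the domain as there are tableaux, whence surjectivity.
\<close>

section \<open>Tuples and signed sums\<close>

text \<open>Over an arbitrary field nothing may be averaged over a symmetric group, and in
  characteristic 2 a sign rule does not force vanishing. Symmetric tensors are therefore handled as
  coefficient functions that are constant on rearrangements, and vanishing on repeated indices is
  proved separately from the sign rule. Why interpolation gives the Koszul relation: exchanging x_k
  with y_1 leaves g alone, because g is symmetric in all M + N variables, and the quotient of V(x
  with x_k replaced by y_1) by V(x) is the Lagrange basis polynomial of the node x_k. The relation
  thus says that f, as a polynomial in y_1, is interpolated at N nodes; this is where the exponent N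
  - 1 of the first factor comes from. The square norm can replace a monomial order because it
  depends only on the exponents of the product, while for given exponents of the two factors the
  rearrangement inequality makes it largest when they are ordered alike. Dimensions are only
  compared, never computed: the tableaux index a spanning set of the target and an independent set
  in the domain.\<close>

definition tuples :: "nat \<Rightarrow> 'i set \<Rightarrow> 'i list set" where
  "tuples R I = {xs. length xs = R \<and> set xs \<subseteq> I}"

lemma finite_tuples [simp]: "finite I \<Longrightarrow> finite (tuples R I)"
  using finite_lists_length_eq[of I R] by (simp add: tuples_def conj_commute)

lemma tuples_0 [simp]: "tuples 0 I = {[]}"
  by (auto simp: tuples_def)

lemma length_tuples: "xs \<in> tuples R I \<Longrightarrow> length xs = R"
  by (simp add: tuples_def)

lemma sum_tuples_Suc:
  "(\<Sum>xs\<in>tuples (Suc R) I. f xs) = (\<Sum>x\<in>I. \<Sum>xs\<in>tuples R I. f (x # xs))"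
proof -
  have "tuples (Suc R) I = (\<lambda>(x, xs). x # xs) ` (I \<times> tuples R I)"
    by (fastforce simp: tuples_def length_Suc_conv image_iff)
  moreover have "inj_on (\<lambda>(x, xs). x # xs) (I \<times> tuples R I)"
    by (auto simp: inj_on_def)
  ultimately show ?thesis
    by (simp add: sum.reindex sum.cartesian_product case_prod_beta' o_def)
qed

lemma prod_sum_tuples:
  fixes f :: "nat \<Rightarrow> 'i \<Rightarrow> 'a::comm_semiring_1"
  shows "(\<Prod>k<R. \<Sum>i\<in>I. f k i) = (\<Sum>xs\<in>tuples R I. \<Prod>k<R. f k (xs ! k))"
proof (induction R arbitrary: f)
  case (Suc R)
  have "(\<Prod>k<Suc R. \<Sum>i\<in>I. f k i) = (\<Sum>i\<in>I. f 0 i) * (\<Prod>k<R. \<Sum>i\<in>I. f (Suc k) i)"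
    by (simp add: prod.lessThan_Suc_shift del: prod.lessThan_Suc)
  then show ?case
    by (simp add: Suc.IH sum_tuples_Suc prod.lessThan_Suc_shift sum_product del: prod.lessThan_Suc)
qed simp

lemma permute_list_tuples [simp]:
  "\<sigma> permutes {..<R} \<Longrightarrow> permute_list \<sigma> xs \<in> tuples R I \<longleftrightarrow> xs \<in> tuples R I"
  by (cases "length xs = R") (auto simp: tuples_def)

lemma sum_tuples_permute:
  assumes "\<sigma> permutes {..<R}"
  shows "(\<Sum>xs\<in>tuples R I. f (permute_list \<sigma> xs)) = (\<Sum>xs\<in>tuples R I. f xs)"
proof -
  have inv: "inv \<sigma> permutes {..<R}"
    using assms by (rule permutes_inv)
  have "permute_list (inv \<sigma>) (permute_list \<sigma> xs) = xs"
    "permute_list \<sigma> (permute_list (inv \<sigma>) xs) = xs" if "length xs = R" for xs :: "'b list"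
    using that assms inv by (simp_all add: permutes_inv_o flip: permute_list_compose)
  then show ?thesis
    using assms inv
    by (intro sum.reindex_bij_witness[of _ "permute_list (inv \<sigma>)" "permute_list \<sigma>"])
       (auto simp: length_tuples)
qed

text \<open>Orbits of size two cancel. Fixed points need a hypothesis of their own: there the sign
  rule only says that twice the term is 0, which is void in characteristic 2.\<close>

lemma sum_involution_eq_0:
  fixes f :: "'i \<Rightarrow> 'a::ab_group_add"
  assumes "finite S"
    and "\<And>x. x \<in> S \<Longrightarrow> \<iota> x \<in> S"
    and "\<And>x. x \<in> S \<Longrightarrow> \<iota> (\<iota> x) = x"
    and "\<And>x. x \<in> S \<Longrightarrow> f (\<iota> x) = - f x"
    and "\<And>x. x \<in> S \<Longrightarrow> \<iota> x = x \<Longrightarrow> f x = 0"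
  shows "sum f S = 0"
  using assms
proof (induction "card S" arbitrary: S rule: less_induct)
  case less
  show ?case
  proof (cases "S = {}")
    case False
    then obtain x where x: "x \<in> S" by auto
    let ?T = "S - {x, \<iota> x}"
    have "sum f ?T = 0"
    proof (rule less.hyps)
      show "card ?T < card S"
        using x less.prems(1) by (intro psubset_card_mono) auto
      show "\<iota> y \<in> ?T" if "y \<in> ?T" for y
        using that x less.prems(2,3) by (metis Diff_iff insert_iff singletonD)
    qed (use less.prems in auto)
    moreover have "sum f S = sum f ?T + sum f {x, \<iota> x}"
      using x less.prems(1,2) by (metis empty_subsetI insert_subset sum.subset_diff)
    moreover have "sum f {x, \<iota> x} = 0"
      using x less.prems(4,5) by (cases "\<iota> x = x") auto
    ultimately show ?thesis by simp
  qed simp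
qed

lemma sum_antisym_eq_0:
  fixes f :: "'i \<Rightarrow> 'i \<Rightarrow> 'a::ab_group_add"
  assumes "finite A" "\<And>a b. f a b = - f b a" "\<And>a. f a a = 0"
  shows "(\<Sum>a\<in>A. \<Sum>b\<in>A. f a b) = 0"
proof -
  have "(\<Sum>x\<in>A \<times> A. case x of (a, b) \<Rightarrow> f a b) = 0"
  proof (rule sum_involution_eq_0[where \<iota> = prod.swap])
    show "(case prod.swap x of (a, b) \<Rightarrow> f a b) = - (case x of (a, b) \<Rightarrow> f a b)" for x
      by (cases x) (simp, rule assms(2))
    show "finite (A \<times> A)"
      using assms(1) by simp
    show "(case x of (a, b) \<Rightarrow> f a b) = 0" if "prod.swap x = x" for x
      using that assms(3) by (metis case_prod_beta' prod.swap_def fst_conv)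
  qed (auto simp: prod.swap_def)
  then show ?thesis
    by (subst sum.cartesian_product)
qed

lemma sum_fun_apply: "(\<Sum>s\<in>S. f s) x = (\<Sum>s\<in>S. f s x)"
  by (induction S rule: infinite_finite_induct) auto

section \<open>The alternating tensors\<close>

text \<open>The coefficient at \<open>xs\<close> of the wedge of the basis vectors listed in
  \<open>cs\<close>, or of the monomial with exponents \<open>xs\<close> in the determinant whose
  columns are the powers with exponents in \<open>cs\<close>. The sum over all permutations also
  covers lists \<open>cs\<close> with repetitions, which give 0.\<close>

definition alt :: "'i list \<Rightarrow> 'i list \<Rightarrow> 'a::field" where
  "alt cs xs = (\<Sum>\<sigma> | \<sigma> permutes {..<length cs}.
     if permute_list \<sigma> xs = cs then of_int (sign \<sigma>) else 0)"

lemma pure_tensor_unit_vec: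
  "pure_tensor (map unit_vec cs) xs = (if xs = cs then 1 else 0)"
proof (cases "length xs = length cs \<and> xs \<noteq> cs")
  case True
  then obtain k where "k < length cs" "xs ! k \<noteq> cs ! k"
    by (metis nth_equalityI)
  then show ?thesis
    using True by (auto simp: pure_tensor_def unit_vec_def intro!: prod_zero)
qed (auto simp: pure_tensor_def unit_vec_def)

lemma wedge_unit_vec: "wedge (map unit_vec cs) = alt cs"
  by (auto simp: wedge_def alt_def sum_fun_apply fscale_def perm_tensor_def pure_tensor_unit_vec
      fun_eq_iff intro!: sum.cong)

lemma permutation_on_nat: "\<sigma> permutes {..<n::nat} \<Longrightarrow> permutation \<sigma>"
  using permutation_permutes by blast

lemma length_neq_alt: "length xs \<noteq> length cs \<Longrightarrow> alt cs xs = 0"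
  unfolding alt_def by (intro sum.neutral) (metis length_permute_list)

lemma alt_permute:
  assumes "\<tau> permutes {..<length cs}" "length xs = length cs"
  shows "alt cs (permute_list \<tau> xs) = of_int (sign \<tau>) * alt cs xs"
proof -
  note \<tau>' = permutes_inv[OF assms(1)]
  have "alt cs (permute_list \<tau> xs) = (\<Sum>\<sigma> | \<sigma> permutes {..<length cs}.
      of_int (sign \<tau>) * (if permute_list \<sigma> xs = cs then of_int (sign \<sigma>) else 0))"
    unfolding alt_def
  proof (rule sum.reindex_bij_witness[of _ "\<lambda>\<sigma>. inv \<tau> \<circ> \<sigma>" "\<lambda>\<sigma>. \<tau> \<circ> \<sigma>"], goal_cases)
    case (5 \<sigma>)
    then show ?case
      using assms
      by (auto simp: permute_list_compose sign_compose permutation_on_nat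
          simp flip: of_int_mult)
  qed (use assms \<tau>' in \<open>auto simp: permutes_compose permutes_inv_o o_assoc\<close>)
  then show ?thesis
    by (simp add: alt_def sum_distrib_left)
qed

lemma alt_permute_left:
  assumes "\<tau> permutes {..<length cs}"
  shows "alt (permute_list \<tau> cs) xs = of_int (sign \<tau>) * alt cs xs"
proof -
  note \<tau>' = permutes_inv[OF assms(1)]
  have *: "permute_list \<sigma> xs = cs \<longleftrightarrow> permute_list (\<sigma> \<circ> \<tau>) xs = permute_list \<tau> cs"
    if "length xs = length cs" for \<sigma>
  proof
    assume "permute_list (\<sigma> \<circ> \<tau>) xs = permute_list \<tau> cs"
    then have "permute_list \<tau> (permute_list \<sigma> xs) = permute_list \<tau> cs"
      using that assms by (simp add: permute_list_compose)
    then have "permute_list (\<tau> \<circ> inv \<tau>) (permute_list \<sigma> xs) = permute_list (\<tau> \<circ> inv \<tau>) cs"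
      using that \<tau>' by (simp add: permute_list_compose)
    then show "permute_list \<sigma> xs = cs"
      using permutes_inv_o[OF assms] by simp
  qed (use that assms in \<open>auto simp: permute_list_compose\<close>)
  show ?thesis
  proof (cases "length xs = length cs")
    case True
    have "(\<Sum>\<sigma> | \<sigma> permutes {..<length cs}.
        of_int (sign \<tau>) * (if permute_list \<sigma> xs = cs then of_int (sign \<sigma>) else 0)) =
      (alt (permute_list \<tau> cs) xs :: 'b)"
      unfolding alt_def length_permute_list
    proof (rule sum.reindex_bij_witness[of _ "\<lambda>\<sigma>. \<sigma> \<circ> inv \<tau>" "\<lambda>\<sigma>. \<sigma> \<circ> \<tau>"], goal_cases)
      case (5 \<sigma>)
      then show ?case
        using assms *[OF True, of \<sigma>] by (auto simp: sign_compose permutation_on_nat mult.commute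
            simp flip: of_int_mult)
    qed (use assms \<tau>' in \<open>auto simp: permutes_compose permutes_inv_o comp_assoc\<close>)
    then show ?thesis
      by (simp add: alt_def sum_distrib_left)
  qed (simp add: length_neq_alt)
qed

lemma exists_transpose_if_not_distinct:
  assumes "\<not> distinct xs"
  obtains a b where "a < length xs" "b < length xs" "a \<noteq> b"
    "permute_list (Transposition.transpose a b) xs = xs"
proof -
  obtain a b where ab: "a < length xs" "b < length xs" "a \<noteq> b" "xs ! a = xs ! b"
    using assms by (auto simp: distinct_conv_nth)
  then have "permute_list (Transposition.transpose a b) xs = xs"
    by (intro nth_equalityI) (auto simp: permute_list_nth permutes_swap_id
        Transposition.transpose_def)
  then show thesis
    using ab that by blast
qed

lemma alt_not_distinct_right: "\<not> distinct xs \<Longrightarrow> distinct cs \<Longrightarrow> alt cs xs = 0"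
  unfolding alt_def
  by (intro sum.neutral ballI) (metis (no_types, lifting) length_permute_list
      distinct_permute_list mem_Collect_eq)

text \<open>Exchanging two equal entries of \<open>cs\<close> pairs each \<sigma> with a permutation
  of opposite sign that yields the same list. The pairing has no fixed points, so the cancellation
  is valid in characteristic 2 too.\<close>

lemma alt_not_distinct_left:
  assumes "\<not> distinct cs"
  shows "alt cs xs = 0"
proof (cases "length xs = length cs")
  case True
  obtain a b where ab: "a < length cs" "b < length cs" "a \<noteq> b"
    and cs: "permute_list (Transposition.transpose a b) cs = cs"
    using exists_transpose_if_not_distinct[OF assms] .
  have t: "Transposition.transpose a b permutes {..<length cs}"
    using ab by (simp add: permutes_swap_id)
  have eq: "permute_list (\<sigma> \<circ> Transposition.transpose a b) xs = cs \<longleftrightarrow> permute_list \<sigma> xs = cs" for \<sigma>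
  proof -
    have "permute_list \<sigma> xs = permute_list (Transposition.transpose a b) (permute_list
        (Transposition.transpose a b) (permute_list \<sigma> xs))"
      using t True by (simp add: comp_assoc flip: permute_list_compose)
    then show ?thesis
      using t True cs by (metis length_permute_list permute_list_compose)
  qed
  show ?thesis
    unfolding alt_def
  proof (rule sum_involution_eq_0[where \<iota> = "\<lambda>\<sigma>. \<sigma> \<circ> Transposition.transpose a b"], goal_cases)
    case (4 \<sigma>)
    then have "sign (\<sigma> \<circ> Transposition.transpose a b) = - sign \<sigma>"
      using ab by (simp add: sign_compose permutation_on_nat[OF t] permutation_on_nat sign_swap_id)
    then show ?case
      by (simp add: eq)
  next
    case (5 \<sigma>)
    then have "\<sigma> (Transposition.transpose a b a) = \<sigma> a"
      by (metis o_apply)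
    with 5 have "Transposition.transpose a b a = a"
      by (metis injD mem_Collect_eq permutes_inj)
    with ab show ?case
      by simp
  qed (use t in \<open>auto simp: finite_permutations permutes_compose comp_assoc\<close>)
qed (simp add: length_neq_alt)

lemma alt_eq_0: "mset xs \<noteq> mset cs \<Longrightarrow> alt cs xs = 0"
proof (cases "length xs = length cs")
  case True
  then show "alt cs xs = 0" if "mset xs \<noteq> mset cs"
    using that unfolding alt_def by (intro sum.neutral) (auto simp flip: True)
qed (simp add: length_neq_alt)

lemma permute_list_inj_distinct:
  assumes "distinct xs" "\<sigma> permutes {..<length xs}" "permute_list \<sigma> xs = xs"
  shows "\<sigma> = id"
proof
  fix k
  show "\<sigma> k = id k"
  proof (cases "k < length xs")
    case True
    then have "xs ! \<sigma> k = xs ! k"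
      using assms(2,3) by (metis permute_list_nth)
    moreover have "\<sigma> k < length xs"
      using assms(2) True by (metis lessThan_iff permutes_in_image)
    ultimately show ?thesis
      using assms(1) True by (simp add: nth_eq_iff_index_eq)
  qed (use assms(2) in \<open>simp add: permutes_not_in\<close>)
qed

lemma alt_self:
  assumes "distinct cs"
  shows "alt cs cs = (1::'b::field)"
proof -
  have "(alt cs cs :: 'b) = (\<Sum>\<sigma> | \<sigma> permutes {..<length cs}. if \<sigma> = id then 1 else 0)"
    unfolding alt_def using permute_list_inj_distinct[OF assms]
    by (intro sum.cong) auto
  then show ?thesis
    by (simp add: finite_permutations permutes_id)
qed

text \<open>The Laplace expansion along the column of \<open>p\<close>.\<close>

lemma alt_snoc:
  assumes "length xs = length cs"
  shows "alt (cs @ [p]) (xs @ [x]) =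
    (if x = p then alt cs xs else 0) -
    (\<Sum>b<length cs. if xs ! b = p then alt cs (xs[b := x]) else 0)"
proof -
  let ?n = "length cs"
  let ?f = "\<lambda>\<sigma>. if permute_list \<sigma> (xs @ [x]) = cs @ [p] then of_int (sign \<sigma>) else (0::'b)"
  have snoc: "permute_list \<sigma> (ys @ [y]) = permute_list \<sigma> ys @ [y]"
    if "\<sigma> permutes {..<length ys}" for \<sigma> and y :: 'a and ys
  proof (rule nth_equalityI)
    fix k assume k: "k < length (permute_list \<sigma> (ys @ [y]))"
    have "\<sigma> k < length ys" if "k < length ys"
      using that \<open>\<sigma> permutes _\<close> by (metis lessThan_iff permutes_in_image)
    moreover have "\<sigma> (length ys) = length ys"
      using that by (simp add: permutes_not_in)
    ultimately show "permute_list \<sigma> (ys @ [y]) ! k = (permute_list \<sigma> ys @ [y]) ! k"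
      using k by (auto simp: permute_list_def nth_append less_Suc_eq simp del: upt_Suc)
  qed simp
  \<comment> \<open>A permutation of the enlarged index set is one of the old set composed with an
    exchange of the last position and some \<open>b\<close>. That exchange costs a sign, puts
    \<open>x\<close> in place of \<open>xs ! b\<close>, and leaves the displaced entry to be matched
    with \<open>p\<close>.\<close>
  have inner: "(\<Sum>\<sigma> | \<sigma> permutes {..<?n}. ?f (Transposition.transpose ?n b \<circ> \<sigma>)) =
      - (if xs ! b = p then alt cs (xs[b := x]) else 0)" if b: "b < ?n" for b
  proof -
    have t: "permute_list (Transposition.transpose ?n b) (xs @ [x]) = xs[b := x] @ [xs ! b]"
      using b assms
      by (intro nth_equalityI)
         (auto simp: permute_list_def nth_append Transposition.transpose_def nth_list_update
            simp del: upt_Suc)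
    have "permute_list (Transposition.transpose ?n b \<circ> \<sigma>) (xs @ [x]) =
        permute_list \<sigma> (xs[b := x]) @ [xs ! b]" if \<sigma>: "\<sigma> permutes {..<?n}" for \<sigma>
    proof -
      have "\<sigma> permutes {..<Suc ?n}"
        using \<sigma> by (rule permutes_subset) auto
      then show ?thesis
        using \<sigma> assms by (simp add: permute_list_compose t snoc)
    qed
    moreover have "sign (Transposition.transpose ?n b \<circ> \<sigma>) = - sign \<sigma>" if "\<sigma> permutes {..<?n}" for \<sigma>
      using that b by (simp add: sign_compose permutation_on_nat permutation_swap_id sign_swap_id)
    ultimately show ?thesis
      by (auto simp: alt_def sum_negf[symmetric] intro!: sum.cong sum.neutral)
  qed
  have "alt (cs @ [p]) (xs @ [x]) = (\<Sum>\<sigma> | \<sigma> permutes insert ?n {..<?n}. ?f \<sigma>)"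
    by (simp add: alt_def lessThan_Suc)
  also have "\<dots> = (\<Sum>b\<in>insert ?n {..<?n}. \<Sum>\<sigma> | \<sigma> permutes {..<?n}.
      ?f (Transposition.transpose ?n b \<circ> \<sigma>))"
    by (rule sum_over_permutations_insert) auto
  also have "\<dots> = (\<Sum>\<sigma> | \<sigma> permutes {..<?n}. ?f \<sigma>) +
      (\<Sum>b<?n. \<Sum>\<sigma> | \<sigma> permutes {..<?n}. ?f (Transposition.transpose ?n b \<circ> \<sigma>))"
    by (simp cong: if_cong)
  also have "(\<Sum>\<sigma> | \<sigma> permutes {..<?n}. ?f \<sigma>) = (if x = p then alt cs xs else 0)"
    using assms by (auto simp: alt_def snoc intro!: sum.cong sum.neutral)
  also have "(\<Sum>b<?n. \<Sum>\<sigma> | \<sigma> permutes {..<?n}. ?f (Transposition.transpose ?n b \<circ> \<sigma>)) =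
      (\<Sum>b<?n. - (if xs ! b = p then alt cs (xs[b := x]) else 0))"
    by (intro sum.cong refl inner) simp
  finally show ?thesis
    by (simp add: sum_negf)
qed

section \<open>The hook Weyl module as a kernel\<close>

text \<open>
  The last condition is the vanishing of the Koszul map \<open>\<And>\<^sup>N V \<otimes> Sym\<^sub>M V \<rightarrow> \<And>\<^bsup>N+1\<^esup> V \<otimes> Sym\<^bsub>M-1\<^esub> V\<close>.
  In characteristic 2 the sign rule does not imply vanishing on repeated entries.
\<close>

definition hook_tensors :: "nat \<Rightarrow> nat \<Rightarrow> 'i set \<Rightarrow> ('i list \<times> 'i list \<Rightarrow> 'a::field) set" where
  "hook_tensors M N I = {P.
     (\<forall>xs ys. \<not> (xs \<in> tuples N I \<and> ys \<in> tuples M I) \<longrightarrow> P (xs, ys) = 0) \<and>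
     (\<forall>xs ys \<sigma>. xs \<in> tuples N I \<and> ys \<in> tuples M I \<and> \<sigma> permutes {..<N} \<longrightarrow>
        P (permute_list \<sigma> xs, ys) = of_int (sign \<sigma>) * P (xs, ys)) \<and>
     (\<forall>xs ys. xs \<in> tuples N I \<and> ys \<in> tuples M I \<and> \<not> distinct xs \<longrightarrow> P (xs, ys) = 0) \<and>
     (\<forall>xs ys \<sigma>. xs \<in> tuples N I \<and> ys \<in> tuples M I \<and> \<sigma> permutes {..<M} \<longrightarrow>
        P (xs, permute_list \<sigma> ys) = P (xs, ys)) \<and>
     (\<forall>xs y ys. xs \<in> tuples N I \<and> y # ys \<in> tuples M I \<longrightarrow>
        P (xs, y # ys) = (\<Sum>k<N. P (xs[k := y], xs ! k # ys)))}"

lemma subspace_hook_tensors: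
  "fvs.subspace (hook_tensors M N I :: ('i list \<times> 'i list \<Rightarrow> 'a::field) set)"
proof -
  have "0 \<in> (hook_tensors M N I :: ('i list \<times> 'i list \<Rightarrow> 'a) set)"
    by (simp add: hook_tensors_def)
  moreover have "P + Q \<in> hook_tensors M N I" if "P \<in> hook_tensors M N I" "Q \<in> hook_tensors M N I"
    for P Q :: "'i list \<times> 'i list \<Rightarrow> 'a"
    using that by (simp add: hook_tensors_def distrib_left sum.distrib)
  moreover have "fscale c P \<in> hook_tensors M N I" if "P \<in> hook_tensors M N I"
    for c and P :: "'i list \<times> 'i list \<Rightarrow> 'a"
    using that by (simp add: hook_tensors_def fscale_def sum_distrib_left)
  ultimately show ?thesis
    by (simp add: fvs.subspace_def)
qed

text \<open>A rearrangement of the row contributes only if its tail is \<open>ys\<close>, so only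
  its head \<open>c\<close> is free. At most one \<open>c\<close> qualifies; keeping a sum over
  \<open>c\<close> lets the Koszul relation be proved by rearranging double sums.\<close>

lemma F_Delta_apply:
  assumes "as \<noteq> []"
  shows "F_Delta (as, bs) (xs, ys) =
    (\<Sum>c\<in>set as. if mset as = add_mset c (mset ys) then alt (c # bs) xs else 0)"
proof -
  have fin: "finite {cs. mset cs = mset as}"
    by (rule perm_finite)
  have "F_Delta (as, bs) (xs, ys) = (\<Sum>cs | mset cs = mset as.
      tensor (wedge (map unit_vec (hd cs # bs))) (pure_tensor (map unit_vec (tl cs))) (xs, ys))"
    by (simp only: F_Delta_def sum_fun_apply prod.case)
  also have "\<dots> = (\<Sum>cs | mset cs = mset as. if ys = tl cs then alt (hd cs # bs) xs else (0::'b))"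
    unfolding wedge_unit_vec tensor_def pure_tensor_unit_vec by (intro sum.cong refl) simp
  also have "\<dots> = (\<Sum>cs\<in>{cs\<in>{cs. mset cs = mset as}. ys = tl cs}. alt (hd cs # bs) xs)"
    by (rule sum.inter_filter[OF fin, symmetric])
  also have "\<dots> = (\<Sum>c\<in>{c\<in>set as. mset as = add_mset c (mset ys)}. alt (c # bs) xs)"
  proof (rule sum.reindex_bij_witness[of _ "\<lambda>c. c # ys" hd])
    fix cs assume "cs \<in> {cs\<in>{cs. mset cs = mset as}. ys = tl cs}"
    then have cs: "mset cs = mset as" "ys = tl cs"
      by auto
    then have ne: "cs \<noteq> []"
      using assms by auto
    with cs show "hd cs # ys = cs" "alt (hd cs # bs) xs = alt (hd cs # bs) xs"
      by auto
    with cs have "mset as = add_mset (hd cs) (mset ys)"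
      by (metis mset.simps(2))
    then show "hd cs \<in> {c\<in>set as. mset as = add_mset c (mset ys)}"
      by (metis (mono_tags, lifting) mem_Collect_eq set_mset_mset union_single_eq_member)
  qed auto
  also have "\<dots> = (\<Sum>c\<in>set as. if mset as = add_mset c (mset ys) then alt (c # bs) xs else 0)"
    by (rule sum.inter_filter) simp
  finally show ?thesis .
qed

lemma alt_Cons_snoc:
  assumes "length xs = Suc (length bs)"
  shows "alt (c # bs @ [p]) (xs @ [x]) =
    (if x = p then alt (c # bs) xs else 0) -
    (\<Sum>b<length xs. if xs ! b = p then alt (c # bs) (xs[b := x]) else 0)"
  using alt_snoc[of xs "c # bs" p x] assms by simp

lemma alt_swap_ends: "alt (p # bs @ [c]) zs = - alt (c # bs @ [p]) zs"
proof (cases "p = c")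
  case False
  let ?\<tau> = "Transposition.transpose 0 (Suc (length bs))"
  have \<tau>: "?\<tau> permutes {..<length (c # bs @ [p])}"
    by (simp add: permutes_swap_id)
  have "permute_list ?\<tau> (c # bs @ [p]) = p # bs @ [c]"
    by (intro nth_equalityI)
       (auto simp: permute_list_nth[OF \<tau>] Transposition.transpose_def nth_Cons' nth_append)
  then show ?thesis
    using alt_permute_left[OF \<tau>, of zs] by (simp add: sign_swap_id)
qed (simp add: alt_not_distinct_left)

lemma tuples_Cons [simp]: "y # ys \<in> tuples (Suc M) I \<longleftrightarrow> y \<in> I \<and> ys \<in> tuples M I"
  by (auto simp: tuples_def)

text \<open>For the Koszul relation, Laplace expansion turns the difference of the two sides into a
  sum of \<open>alt (c # bs @ [p])\<close> over the ordered pairs \<open>c\<close>, \<open>p\<close>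
  whose removal from the row leaves \<open>ys\<close>. It is antisymmetric in \<open>c\<close> and
  \<open>p\<close> and vanishes for \<open>c = p\<close>, hence it is 0.\<close>

lemma F_Delta_hook_tensors:
  fixes I :: "'i::linorder set"
  assumes "length as = M + 1" "length bs = N - 1" "set as \<subseteq> I" "set bs \<subseteq> I" "N \<ge> 1"
  shows "(F_Delta (as, bs) :: _ \<Rightarrow> 'a::field) \<in> hook_tensors M N I"
proof -
  have ne: "as \<noteq> []"
    using assms(1) by auto
  note F = F_Delta_apply[OF ne]
  have len: "length (c # bs) = N" for c
    using assms by simp
  have supp: "F_Delta (as, bs) (xs, ys) = (0::'a)" if nm:
      "\<not> (xs \<in> tuples N I \<and> ys \<in> tuples M I)" for xs ys
  proof -
    have "alt (c # bs) xs = (0::'a)" if c: "c \<in> set as" "mset as = add_mset c (mset ys)" for c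
    proof -
      have "set as = insert c (set ys)" "length as = Suc (length ys)"
        using c(2) by (metis set_mset_add_mset_insert set_mset_mset, metis size_add_mset size_mset)
      then have "ys \<in> tuples M I"
        using assms by (auto simp: tuples_def)
      then have "xs \<notin> tuples N I"
        using nm by simp
      moreover have "c # bs \<in> tuples N I"
        using assms c(1) len[of c] by (auto simp: tuples_def)
      ultimately have "mset xs \<noteq> mset (c # bs)"
        unfolding tuples_def mem_Collect_eq by (metis mset_eq_length mset_eq_setD)
      then show ?thesis
        by (rule alt_eq_0)
    qed
    then show ?thesis
      unfolding F by (intro sum.neutral) auto
  qed
  have koszul: "F_Delta (as, bs) (xs, y # ys) = (\<Sum>k<N. F_Delta (as, bs) (xs[k := y], xs ! k #
      ys) :: 'a)"
    if xs: "xs \<in> tuples N I" for xs y ys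
  proof -
    let ?P = "\<lambda>c p. mset as = add_mset c (add_mset p (mset ys))"
    let ?g = "\<lambda>c p. if ?P c p then alt (c # bs @ [p]) (xs @ [y]) else (0::'a)"
    have lxs: "length xs = Suc (length bs)" "length xs = N"
      using xs len by (auto simp: tuples_def)
    have mem: "p \<in> set as" if "?P c p" for c p
      using that by (metis set_mset_mset union_single_eq_member add_mset_commute)
    have 1: "F_Delta (as, bs) (xs, y # ys) =
        (\<Sum>c\<in>set as. \<Sum>p\<in>set as. if ?P c p then if y = p then alt (c # bs) xs else 0 else (0::'a))"
    proof -
      have "(\<Sum>p\<in>set as. if ?P c p then if y = p then alt (c # bs) xs else 0 else (0::'a)) =
          (\<Sum>p\<in>set as. if p = y then if ?P c y then alt (c # bs) xs else 0 else 0)" for c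
        by (intro sum.cong) auto
      then show ?thesis
        unfolding F using mem by (intro sum.cong) auto
    qed
    have 2: "F_Delta (as, bs) (xs[k := y], xs ! k # ys) =
        (\<Sum>c\<in>set as. \<Sum>p\<in>set as. if ?P c p then if xs ! k = p then alt (c # bs) (xs[k := y])
            else 0 else (0::'a))" for k
    proof -
      have "(\<Sum>p\<in>set as. if ?P c p then if xs ! k = p then alt (c # bs) (xs[k := y]) else 0
          else (0::'a)) =
          (\<Sum>p\<in>set as. if p = xs ! k then if ?P c (xs ! k) then alt (c # bs) (xs[k := y]) else 0
              else 0)" for c
        by (intro sum.cong) auto
      then show ?thesis
        unfolding F using mem by (intro sum.cong) auto
    qed
    have "(\<Sum>k<N. F_Delta (as, bs) (xs[k := y], xs ! k # ys)) =
        (\<Sum>c\<in>set as. \<Sum>k<N. \<Sum>p\<in>set as. if ?P c p then if xs ! k = p then alt (c # bs) (xs[k := y])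
            else 0 else (0::'a))"
      unfolding 2 by (rule sum.swap)
    also have "\<dots> = (\<Sum>c\<in>set as. \<Sum>p\<in>set as. \<Sum>k<N. if ?P c p then if xs ! k = p
        then alt (c # bs) (xs[k := y]) else 0 else (0::'a))"
      by (intro sum.cong refl) (rule sum.swap)
    finally have "F_Delta (as, bs) (xs, y # ys) - (\<Sum>k<N. F_Delta (as, bs) (xs[k := y], xs ! k #
        ys)) =
        (\<Sum>c\<in>set as. \<Sum>p\<in>set as. ?g c p)"
      unfolding 1 by (simp add: sum_subtractf[symmetric])
        (intro sum.cong refl, simp add: alt_Cons_snoc[OF lxs(1)] lxs(2))
    also have "\<dots> = 0"
    proof (rule sum_antisym_eq_0)
      show "?g c p = - ?g p c" for c p
        by (simp add: add_mset_commute alt_swap_ends[of c bs p])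
      show "?g c c = 0" for c
        by (simp add: alt_not_distinct_left)
    qed simp
    finally show ?thesis
      by simp
  qed
  have "F_Delta (as, bs) (permute_list \<sigma> xs, ys) = (of_int (sign \<sigma>)
      * F_Delta (as, bs) (xs, ys) :: 'a)"
    if "xs \<in> tuples N I" "\<sigma> permutes {..<N}" for xs ys \<sigma>
    using that len unfolding F sum_distrib_left
    by (intro sum.cong refl) (auto simp: alt_permute length_tuples)
  moreover have "F_Delta (as, bs) (xs, permute_list \<sigma> ys) = (F_Delta (as, bs) (xs, ys) :: 'a)"
    if "ys \<in> tuples M I" "\<sigma> permutes {..<M}" for xs ys \<sigma>
    using that unfolding F by (auto simp: length_tuples)
  moreover have "F_Delta (as, bs) (xs, ys) = (0 :: 'a)" if "\<not> distinct xs" for xs ys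
  proof -
    have "alt (c # bs) xs = (0 :: 'a)" for c
      using that alt_not_distinct_right alt_not_distinct_left by blast
    then show ?thesis
      unfolding F by (intro sum.neutral) auto
  qed
  ultimately show ?thesis
    using supp koszul unfolding hook_tensors_def by blast
qed

text \<open>Suppose the head \<open>c\<close> taken from the row \<open>as'\<close> were not the
  corner \<open>a\<close> of \<open>as\<close>. Then \<open>a\<close> occurs in \<open>bs'\<close>,
  so a' < a, and \<open>c\<close> occurs in \<open>bs\<close>, so a < c. But a' is \<open>c\<close>
  or an entry of \<open>cs\<close>, all of which are at least \<open>a\<close>. So
  \<open>c = a\<close>, and both tableaux agree up to sorting.\<close>

lemma F_Delta_semistandard:
  fixes I :: "'i::linorder set"
  assumes s: "(as, bs) \<in> semistandard_hooks M N I" and t: "(as', bs') \<in> semistandard_hooks M N I"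
  shows "F_Delta (as', bs') (hd as # bs, tl as) = (if (as, bs) = (as', bs') then 1
      else (0::'a::field))"
proof -
  obtain a cs where as: "as = a # cs"
    using s by (cases as) (auto simp: semistandard_hooks_def)
  obtain a' cs' where as': "as' = a' # cs'"
    using t by (cases as') (auto simp: semistandard_hooks_def)
  have sorted: "sorted (a # cs)" "sorted_wrt (<) (a # bs)" "sorted (a' # cs')"
      "sorted_wrt (<) (a' # bs')"
    using s t by (auto simp: semistandard_hooks_def as as')
  have eq: "(as, bs) = (as', bs') \<and> c = a"
    if c: "mset as' = add_mset c (mset cs)" and alt: "alt (c # bs') (a # bs) \<noteq> (0::'a)" for c
  proof -
    have m: "mset (a # bs) = mset (c # bs')"
      using alt alt_eq_0 by blast
    have "c = a"
    proof (rule ccontr)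
      assume "c \<noteq> a"
      then have "a \<in> set bs'" "c \<in> set bs"
        using mset_eq_setD[OF m] by auto
      then have "a' < a" "a < c"
        using sorted by auto
      moreover have "a' \<in> insert c (set cs)"
        using arg_cong[OF c, of set_mset] by (auto simp: as')
      ultimately show False
        using sorted(1) by auto
    qed
    then have "mset bs = mset bs'" "mset as = mset as'"
      using m c as by auto
    moreover have "sorted bs" "sorted bs'" "sorted as" "sorted as'"
      using sorted by (auto simp: as as' strict_sorted_imp_sorted)
    ultimately show ?thesis
      using \<open>c = a\<close> by (metis properties_for_sort)
  qed
  have "as' \<noteq> []"
    by (simp add: as')
  then have "F_Delta (as', bs') (a # bs, cs) =
      (\<Sum>c\<in>set as'. if c = a then if (as, bs) = (as', bs') then 1 else (0::'a) else 0)"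
  proof (subst F_Delta_apply, assumption, intro sum.cong refl)
    fix c assume "c \<in> set as'"
    have "alt (a # bs) (a # bs) = (1::'a)"
      using sorted(2) by (intro alt_self) (auto simp: strict_sorted_iff)
    then show "(if mset as' = add_mset c (mset cs) then alt (c # bs') (a # bs) else 0) =
        (if c = a then if (as, bs) = (as', bs') then 1 else (0::'a) else 0)"
      using eq[of c] by (auto simp: as)
  qed
  also have "\<dots> = (if (as, bs) = (as', bs') then 1 else (0::'a))"
    by (auto simp: as)
  finally show ?thesis
    by (simp add: as)
qed

lemma hook_tensorsD:
  assumes "P \<in> hook_tensors M N I"
  shows "xs \<notin> tuples N I \<or> ys \<notin> tuples M I \<Longrightarrow> P (xs, ys) = 0"
    and "xs \<in> tuples N I \<Longrightarrow> ys \<in> tuples M I \<Longrightarrow> \<sigma> permutes {..<N} \<Longrightarrow>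
      P (permute_list \<sigma> xs, ys) = of_int (sign \<sigma>) * P (xs, ys)"
    and "xs \<in> tuples N I \<Longrightarrow> ys \<in> tuples M I \<Longrightarrow> \<not> distinct xs \<Longrightarrow> P (xs, ys) = 0"
    and "xs \<in> tuples N I \<Longrightarrow> ys \<in> tuples M I \<Longrightarrow> \<tau> permutes {..<M} \<Longrightarrow>
      P (xs, permute_list \<tau> ys) = P (xs, ys)"
    and "xs \<in> tuples N I \<Longrightarrow> y # ys \<in> tuples M I \<Longrightarrow>
      P (xs, y # ys) = (\<Sum>k<N. P (xs[k := y], xs ! k # ys))"
  using assms unfolding hook_tensors_def by blast+

text \<open>
  If the least row entry is smaller than all column entries, the Koszul relation exchanges it with
  each column entry in turn, and every term on the right is semistandard after sorting.
\<close>

lemma hook_tensors_eq_0: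
  fixes I :: "'i::linorder set"
  assumes P: "(P :: _ \<Rightarrow> 'a::field) \<in> hook_tensors M N I" and "N \<ge> 1"
    and vanish: "\<And>as bs. (as, bs) \<in> semistandard_hooks M N I \<Longrightarrow> P (hd as # bs, tl as) = 0"
  shows "P = 0"
proof -
  note D = hook_tensorsD[OF P]
  have sorted_case: "P (x # xs, ys) = 0" if "x # xs \<in> tuples N I" "ys \<in> tuples M I"
    "sorted_wrt (<) (x # xs)" "sorted ys" "\<And>y. y \<in> set ys \<Longrightarrow> x \<le> y" for x xs ys
    using vanish[of "x # ys" xs] that by (auto simp: semistandard_hooks_def tuples_def)
  \<comment> \<open>Sorting \<open>xs\<close> and \<open>ys\<close> makes such a position
    semistandard, since the least column entry is then at most every row entry; it changes the value
    only by a sign.\<close>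
  have minimal: "P (xs, ys) = 0" if xs: "xs \<in> tuples N I" and ys: "ys \<in> tuples M I"
    and x: "x \<in> set xs" "\<And>y. y \<in> set ys \<Longrightarrow> x \<le> y" for x xs ys
  proof (cases "distinct xs")
    case True
    obtain \<sigma> where \<sigma>: "\<sigma> permutes {..<length xs}" "permute_list \<sigma> xs = sort xs"
      using mset_eq_permutation[of "sort xs" xs] by auto
    obtain \<tau> where \<tau>: "\<tau> permutes {..<length ys}" "permute_list \<tau> ys = sort ys"
      using mset_eq_permutation[of "sort ys" ys] by auto
    have t: "sort xs \<in> tuples N I" "sort ys \<in> tuples M I"
      using xs ys by (auto simp: tuples_def)
    obtain z zs where z: "sort xs = z # zs"
      using x(1) by (cases "sort xs") (auto dest: arg_cong[of _ _ set])
    have "z \<le> x"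
      using x(1) z sorted_sort[of xs] by (metis set_sort set_ConsD sorted_simps(2) order_refl)
    then have "P (sort xs, sort ys) = 0"
      using t x True sorted_case[of z zs "sort ys"]
      by (metis order.trans set_sort sorted_sort strict_sorted_iff distinct_sort z)
    moreover have "P (sort xs, sort ys) = of_int (sign \<sigma>) * P (xs, ys)"
      using D(2)[OF xs t(2), of \<sigma>] D(2)[OF xs ys, of \<sigma>] D(4)[OF xs ys, of \<tau>] D(4)[OF t(1) ys, of
          \<tau>] \<sigma> \<tau> xs ys
      by (simp add: length_tuples)
    ultimately show ?thesis
      by (cases rule: sign_cases[of \<sigma>]) auto
  qed (use D(3) xs ys in auto)
  have "P (xs, ys) = 0" for xs ys
  proof (cases "xs \<in> tuples N I \<and> ys \<in> tuples M I \<and> ys \<noteq> []")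
    case True
    then have xs: "xs \<in> tuples N I" and ys: "ys \<in> tuples M I"
      by auto
    obtain y zs where y: "sort ys = y # zs"
      using True by (cases "sort ys") (auto dest: arg_cong[of _ _ set])
    obtain \<tau> where \<tau>: "\<tau> permutes {..<length ys}" "permute_list \<tau> ys = sort ys"
      using mset_eq_permutation[of "sort ys" ys] by auto
    have yzs: "y # zs \<in> tuples M I"
      using ys by (simp add: tuples_def flip: y)
    have le: "y \<le> z" if "z \<in> set zs" for z
      using that sorted_sort[of ys] by (simp add: y)
    have "P (xs, ys) = P (xs, y # zs)"
      using D(4)[OF xs ys, of \<tau>] ys \<tau> y by (simp add: length_tuples)
    also have "\<dots> = 0"
    proof (cases "\<exists>x\<in>set xs. x \<le> y")
      case True
      then show ?thesis
        using minimal[OF xs yzs] le by force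
    next
      case False
      have "P (xs[k := y], xs ! k # zs) = 0" if "k < N" for k
      proof (rule minimal)
        have k: "k < length xs" "xs ! k \<in> set xs"
          using that xs by (auto simp: length_tuples)
        show "xs[k := y] \<in> tuples N I" "xs ! k # zs \<in> tuples M I" "y \<in> set (xs[k := y])"
          using xs yzs k set_update_subset_insert[of xs k y] set_update_memI[OF k(1)]
          by (auto simp: tuples_def)
        show "y \<le> z" if "z \<in> set (xs ! k # zs)" for z
          using that False k(2) le by (metis linear set_ConsD)
      qed
      then show ?thesis
        using D(5)[OF xs yzs] by simp
    qed
    finally show ?thesis .
  next
    case False
    show ?thesis
    proof (cases "xs \<in> tuples N I \<and> ys \<in> tuples M I")
      case True
      \<comment> \<open>Here \<open>ys\<close> is empty, so the minimality condition is vacuous and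
        any entry of \<open>xs\<close> will do; \<open>N \<ge> 1\<close> provides one.\<close>
      moreover have "hd xs \<in> set xs"
        using True \<open>N \<ge> 1\<close> by (intro list.set_sel) (auto simp: tuples_def)
      ultimately show ?thesis
        using False minimal[of xs ys "hd xs"] by auto
    qed (use D(1) in blast)
  qed
  then show ?thesis
    by (auto simp: fun_eq_iff)
qed

lemma finite_semistandard_hooks [simp]: "finite I \<Longrightarrow> finite (semistandard_hooks M N I)"
proof (rule finite_subset)
  show "semistandard_hooks M N I \<subseteq> tuples (M + 1) I \<times> tuples (N - 1) I"
    by (auto simp: semistandard_hooks_def tuples_def)
qed simp

lemma hook_tensors_eq_span:
  fixes I :: "'i::linorder set"
  assumes "finite I" "N \<ge> 1"
  shows "(hook_tensors M N I :: (_ \<Rightarrow> 'a::field) set) = fvs.span (F_Delta ` semistandard_hooks M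
      N I)"
proof (rule antisym)
  have F: "(F_Delta s :: _ \<Rightarrow> 'a) \<in> hook_tensors M N I" if "s \<in> semistandard_hooks M N I" for s
    using that assms(2) F_Delta_hook_tensors[of "fst s" M "snd s" N I]
    by (auto simp: semistandard_hooks_def)
  then show "fvs.span (F_Delta ` semistandard_hooks M N I) \<subseteq> (hook_tensors M N I :: (_ \<Rightarrow> 'a) set)"
    by (intro fvs.span_minimal subspace_hook_tensors) auto
  show "(hook_tensors M N I :: (_ \<Rightarrow> 'a) set) \<subseteq> fvs.span (F_Delta ` semistandard_hooks M N I)"
  proof
    fix P :: "_ \<Rightarrow> 'a" assume P: "P \<in> hook_tensors M N I"
    \<comment> \<open>By duality these are the only possible coefficients: the value of
      \<open>P\<close> at the position of each tableau.\<close>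
    let ?c = "\<lambda>(as, bs). P (hd as # bs, tl as)"
    let ?Q = "\<Sum>s\<in>semistandard_hooks M N I. fscale (?c s) (F_Delta s)"
    have Q: "?Q \<in> fvs.span (F_Delta ` semistandard_hooks M N I)"
      by (intro fvs.span_sum fvs.span_scale fvs.span_base) auto
    have "P - ?Q \<in> hook_tensors M N I"
      using F by (intro fvs.subspace_diff fvs.subspace_sum fvs.subspace_scale
          subspace_hook_tensors P) auto
    then have "P - ?Q = 0"
    proof (rule hook_tensors_eq_0)
      fix as bs :: "'i list" assume s: "(as, bs) \<in> semistandard_hooks M N I"
      have "?Q (hd as # bs, tl as) = (\<Sum>t\<in>semistandard_hooks M N I. if (as, bs) = t then ?c t
          else 0)"
        unfolding sum_fun_apply fscale_def
        by (intro sum.cong refl) (use s in \<open>auto simp: F_Delta_semistandard split: if_splits\<close>)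
      then show "(P - ?Q) (hd as # bs, tl as) = 0"
        using s assms(1) by simp
    qed (use assms in auto)
    with Q show "P \<in> fvs.span (F_Delta ` semistandard_hooks M N I)"
      by simp
  qed
qed

section \<open>Multiplication by the Vandermonde determinant\<close>

abbreviation pair_sums :: "(nat \<times> nat) list \<Rightarrow> nat list" where
  "pair_sums \<equiv> map (\<lambda>(p, q). p + q)"

text \<open>
  In terms of polynomials, \<open>hook_map\<close> sends \<open>f(y) \<otimes> g(x, y)\<close> to \<open>V(x) f(y) g(x, y)\<close>,
      where \<open>V\<close> is the
  Vandermonde determinant, whose coefficients are \<open>alt [0..<Suc n]\<close>. Each pair in \<open>xs\<close> and \<open>ys\<close>
  records how an exponent splits between \<open>V(x) f(y)\<close> and \<open>g(x, y)\<close>.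
\<close>

definition hook_map :: "nat \<Rightarrow> nat \<Rightarrow> nat \<Rightarrow> (nat list \<times> nat list \<Rightarrow> 'a::field) \<Rightarrow> (nat list \<times> nat
    list \<Rightarrow> 'a)" where
  "hook_map M n e z = (\<lambda>(is, js).
     \<Sum>xs\<in>tuples (Suc n) ({0..n} \<times> {0..e}). \<Sum>ys\<in>tuples M ({0..n} \<times> {0..e}).
       if pair_sums xs = is \<and> pair_sums ys = js
       then alt [0..<Suc n] (map fst xs) * z (map fst ys, map snd (xs @ ys)) else 0)"

text \<open>A pointwise stand-in for the tensor product of the two lower symmetric powers, which is
  itself given only as a span. Containment of the tensor product in this space is enough:
  injectivity passes to subspaces, and surjectivity needs only particular elements of the tensor
  product.\<close>

definition sym_tensors :: "nat \<Rightarrow> nat \<Rightarrow> nat \<Rightarrow> (nat list \<times> nat list \<Rightarrow> 'a::field) set" where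
  "sym_tensors M n e = {z.
     (\<forall>ls ms. \<not> (ls \<in> tuples M {0..n} \<and> ms \<in> tuples (M + Suc n) {0..e}) \<longrightarrow> z (ls, ms) = 0) \<and>
     (\<forall>ls ls' ms ms'. mset ls = mset ls' \<and> mset ms = mset ms' \<longrightarrow> z (ls, ms) = z (ls', ms'))}"

lemma sym_tensorsD:
  assumes "z \<in> sym_tensors M n e"
  shows "z (ls, ms) \<noteq> 0 \<Longrightarrow> ls \<in> tuples M {0..n} \<and> ms \<in> tuples (M + Suc n) {0..e}"
    and "mset ls = mset ls' \<Longrightarrow> mset ms = mset ms' \<Longrightarrow> z (ls, ms) = z (ls', ms')"
  using assms unfolding sym_tensors_def by blast+

lemma permute_list_eq_iff:
  assumes "\<sigma> permutes {..<length xs}" "length xs = length ys"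
  shows "permute_list \<sigma> xs = permute_list \<sigma> ys \<longleftrightarrow> xs = ys"
proof
  assume eq: "permute_list \<sigma> xs = permute_list \<sigma> ys"
  have "permute_list (\<sigma> \<circ> inv \<sigma>) xs = permute_list (\<sigma> \<circ> inv \<sigma>) ys"
    using assms permutes_inv[OF assms(1)] eq by (simp add: permute_list_compose)
  then show "xs = ys"
    by (simp add: permutes_inv_o[OF assms(1)])
qed simp

text \<open>Lagrange interpolation at the points \<open>x\<^sub>1, \<dots>, x\<^sub>N\<close> of a polynomial of degree less than \<open>N\<close>,
  read off on coefficients.\<close>

lemma alt_interpolation:
  fixes h :: "nat \<Rightarrow> 'a::field"
  assumes "length ps = N" "set ps \<subseteq> {..<N}" "l < N"
  shows "(\<Sum>k<N. alt [0..<N] (ps[k := l]) * h (ps ! k)) = alt [0..<N] ps * h l"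
proof -
  have col: "(\<Sum>k<N. if ps ! k = p then alt [0..<N] (ps[k := l]) else 0) =
      (if l = p then alt [0..<N] ps else (0::'a))" if "p < N" for p
  proof -
    \<comment> \<open>The exponent \<open>p\<close> already occurs among 0, ..., N - 1, so this
      determinant has two equal columns. Its Laplace expansion is the interpolation formula for the
      monomial of degree \<open>p\<close>; the general \<open>h\<close> follows by
      linearity.\<close>
    have "alt ([0..<N] @ [p]) (ps @ [l]) = (0::'a)"
      by (rule alt_not_distinct_left) (use that in simp)
    then show ?thesis
      by (subst (asm) alt_snoc) (simp_all add: assms(1))
  qed
  have "(\<Sum>k<N. alt [0..<N] (ps[k := l]) * h (ps ! k)) =
      (\<Sum>k<N. \<Sum>p<N. h p * (if ps ! k = p then alt [0..<N] (ps[k := l]) else 0))"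
  proof (intro sum.cong refl)
    fix k assume "k \<in> {..<N}"
    then have "ps ! k < N"
      using assms(1,2) nth_mem by blast
    then show "alt [0..<N] (ps[k := l]) * h (ps ! k) =
        (\<Sum>p<N. h p * (if ps ! k = p then alt [0..<N] (ps[k := l]) else 0))"
      by (simp add: if_distrib[of "\<lambda>x. _ * x"] cong: if_cong)
  qed
  also have "\<dots> = (\<Sum>p<N. h p * (\<Sum>k<N. if ps ! k = p then alt [0..<N] (ps[k := l]) else 0))"
    unfolding sum_distrib_left by (rule sum.swap)
  also have "\<dots> = (\<Sum>p<N. h p * (if l = p then alt [0..<N] ps else 0))"
    by (intro sum.cong refl) (simp add: col)
  also have "\<dots> = alt [0..<N] ps * h l"
    using assms(3) by (simp add: if_distrib[of "\<lambda>x. _ * x"] mult.commute cong: if_cong)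
  finally show ?thesis .
qed

lemma pair_sums_tuples:
  "xs \<in> tuples R ({0..a} \<times> {0..b}) \<Longrightarrow> pair_sums xs \<in> tuples R {0..a + b}"
  by (fastforce simp: tuples_def)

lemma fst_tuples: "xs \<in> tuples R (I \<times> J) \<Longrightarrow> map fst xs \<in> tuples R I"
  and snd_tuples: "xs \<in> tuples R (I \<times> J) \<Longrightarrow> map snd xs \<in> tuples R J"
  by (fastforce simp: tuples_def)+

lemma sum_update_swap:
  assumes "k < R"
  shows "(\<Sum>xs\<in>tuples R I. \<Sum>y\<in>I. f (xs[k := y]) (xs ! k)) = (\<Sum>xs\<in>tuples R I. \<Sum>y\<in>I. f xs y)"
proof -
  have "(\<Sum>(xs, y)\<in>tuples R I \<times> I. f (xs[k := y]) (xs ! k)) = (\<Sum>(xs, y)\<in>tuples R I \<times> I. f xs y)"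
    by (rule sum.reindex_bij_witness[of _ "\<lambda>(xs, y). (xs[k := y], xs ! k)"
        "\<lambda>(xs, y). (xs[k := y], xs ! k)"])
       (use assms set_update_subset_insert in \<open>fastforce simp: tuples_def\<close>)+
  then show ?thesis
    by (simp add: sum.cartesian_product)
qed

text \<open>In the k-th summand exchange \<open>y\<close> with the k-th pair of \<open>xs\<close>.
  The condition on the sums becomes the one of the left side, and the exponents that belong to g are
  only permuted, which \<open>z\<close> does not notice. What remains for each fixed choice of pairs
  is \<open>alt_interpolation\<close> in the exponent of y_1 in f.\<close>

lemma hook_map_koszul:
  fixes z :: "nat list \<times> nat list \<Rightarrow> 'a::field"
  assumes z: "z \<in> sym_tensors (Suc M) n e" and len: "length is = Suc n"
  shows "hook_map (Suc M) n e z (is, j # js) =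
    (\<Sum>k<Suc n. hook_map (Suc M) n e z (is[k := j], is ! k # js))"
proof -
  let ?I = "{0..n} \<times> {0..e}"
  let ?u = "\<lambda>xs y ys. alt [0..<Suc n] (map fst xs) * z (fst y # map fst ys, map snd (xs @ y # ys))"
  let ?c = "\<lambda>xs y ys is j. pair_sums xs = is \<and> (case y of (p, q) \<Rightarrow> p + q) = j \<and> pair_sums ys = js"
  have expand: "hook_map (Suc M) n e z (is, j # js) = (\<Sum>ys\<in>tuples M ?I. \<Sum>xs\<in>tuples (Suc n) ?I.
      \<Sum>y\<in>?I. if ?c xs y ys is j then ?u xs y ys else 0)" for "is" j
  proof -
    have "hook_map (Suc M) n e z (is, j # js) = (\<Sum>xs\<in>tuples (Suc n) ?I.
        \<Sum>y\<in>?I. \<Sum>ys\<in>tuples M ?I. if ?c xs y ys is j then ?u xs y ys else 0)"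
      by (simp add: hook_map_def sum_tuples_Suc[of _ M] cong: if_cong)
    also have "\<dots> = (\<Sum>xs\<in>tuples (Suc n) ?I.
        \<Sum>ys\<in>tuples M ?I. \<Sum>y\<in>?I. if ?c xs y ys is j then ?u xs y ys else 0)"
      by (intro sum.cong refl) (rule sum.swap)
    also have "\<dots> = (\<Sum>ys\<in>tuples M ?I. \<Sum>xs\<in>tuples (Suc n) ?I.
        \<Sum>y\<in>?I. if ?c xs y ys is j then ?u xs y ys else 0)"
      by (rule sum.swap)
    finally show ?thesis .
  qed
  have swapped: "hook_map (Suc M) n e z (is[k := j], is ! k # js) = (\<Sum>ys\<in>tuples M ?I.
      \<Sum>xs\<in>tuples (Suc n) ?I.
      \<Sum>y\<in>?I. if ?c xs y ys is j then ?u (xs[k := y]) (xs ! k) ys else 0)" if k: "k < Suc n" for k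
  proof -
    have c: "?c (xs[k := y]) (xs ! k) ys (is[k := j]) (is ! k) \<longleftrightarrow> ?c xs y ys is j"
      if "length xs = Suc n" for xs y ys
    proof -
      have "map (\<lambda>(p, q). p + q) (xs[k := y]) = is[k := j] \<and> (case xs ! k of (p, q) \<Rightarrow> p + q)
          = is ! k
          \<longleftrightarrow> pair_sums xs = is \<and> (case y of (p, q) \<Rightarrow> p + q) = j"
        using that len k by (auto simp: list_eq_iff_nth_eq nth_list_update)
      then show ?thesis by blast
    qed
    have "hook_map (Suc M) n e z (is[k := j], is ! k # js) = (\<Sum>ys\<in>tuples M ?I.
        \<Sum>xs\<in>tuples (Suc n) ?I.
      \<Sum>y\<in>?I. if ?c (xs[k := y]) (xs ! k) ys (is[k := j]) (is ! k)
          then ?u (xs[k := y]) (xs ! k) ys else 0)"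
      unfolding expand
    proof (rule sum.cong[OF refl])
      fix ys
      show "(\<Sum>xs\<in>tuples (Suc n) ?I. \<Sum>y\<in>?I. if ?c xs y ys (is[k := j]) (is ! k) then ?u xs y ys
          else 0) =
          (\<Sum>xs\<in>tuples (Suc n) ?I. \<Sum>y\<in>?I. if ?c (xs[k := y]) (xs ! k) ys (is[k := j]) (is ! k)
            then ?u (xs[k := y]) (xs ! k) ys else 0)"
        by (rule sum_update_swap[OF k, symmetric])
    qed
    then show ?thesis
      by (simp add: c length_tuples cong: sum.cong)
  qed
  have u: "(\<Sum>k<Suc n. ?u (xs[k := y]) (xs ! k) ys) = ?u xs y ys"
    if xs: "xs \<in> tuples (Suc n) ?I" and y: "y \<in> ?I" for xs y ys
  proof -
    let ?h = "\<lambda>p. z (p # map fst ys, map snd (xs @ y # ys))"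
    have "?u (xs[k := y]) (xs ! k) ys = alt [0..<Suc n] ((map fst xs)[k := fst y])
        * ?h (map fst xs ! k)"
      if "k < Suc n" for k
    proof -
      have "mset (xs[k := y] @ xs ! k # ys) = mset (xs @ y # ys)"
        using that length_tuples[OF xs] by (simp add: mset_update)
      then have "mset (map snd (xs[k := y] @ xs ! k # ys)) = mset (map snd (xs @ y # ys))"
        by (metis mset_map)
      then show ?thesis
        using that length_tuples[OF xs] sym_tensorsD(2)[OF z refl] by (simp add: map_update)
    qed
    moreover have "length (map fst xs) = Suc n" "set (map fst xs) \<subseteq> {..<Suc n}" "fst y < Suc n"
      using xs y by (fastforce simp: tuples_def)+
    ultimately show ?thesis
      using alt_interpolation[of "map fst xs" "Suc n" "fst y" ?h] by simp
  qed
  have "(\<Sum>k<Suc n. hook_map (Suc M) n e z (is[k := j], is ! k # js)) =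
      (\<Sum>k<Suc n. \<Sum>ys\<in>tuples M ?I. \<Sum>xs\<in>tuples (Suc n) ?I.
        \<Sum>y\<in>?I. if ?c xs y ys is j then ?u (xs[k := y]) (xs ! k) ys else 0)"
    by (intro sum.cong refl swapped) simp
  also have "\<dots> = (\<Sum>ys\<in>tuples M ?I. \<Sum>k<Suc n. \<Sum>xs\<in>tuples (Suc n) ?I.
        \<Sum>y\<in>?I. if ?c xs y ys is j then ?u (xs[k := y]) (xs ! k) ys else 0)"
    by (rule sum.swap)
  also have "\<dots> = (\<Sum>ys\<in>tuples M ?I. \<Sum>xs\<in>tuples (Suc n) ?I. \<Sum>k<Suc n.
        \<Sum>y\<in>?I. if ?c xs y ys is j then ?u (xs[k := y]) (xs ! k) ys else 0)"
    by (intro sum.cong refl) (rule sum.swap)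
  also have "\<dots> = (\<Sum>ys\<in>tuples M ?I. \<Sum>xs\<in>tuples (Suc n) ?I. \<Sum>y\<in>?I. \<Sum>k<Suc n.
         if ?c xs y ys is j then ?u (xs[k := y]) (xs ! k) ys else 0)"
    by (intro sum.cong refl) (rule sum.swap)
  also have "\<dots> = hook_map (Suc M) n e z (is, j # js)"
    unfolding expand
  proof (intro sum.cong refl, goal_cases)
    case (1 ys xs y)
    then show ?case
      using u[of xs y ys] by (cases "?c xs y ys is j") auto
  qed
  finally show ?thesis ..
qed

lemma hook_map_hook_tensors:
  fixes z :: "nat list \<times> nat list \<Rightarrow> 'a::field"
  assumes z: "z \<in> sym_tensors M n e"
  shows "hook_map M n e z \<in> hook_tensors M (Suc n) {0..n + e}"
proof -
  let ?I = "{0..n} \<times> {0..e}"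
  let ?f = "\<lambda>is js xs ys. if pair_sums xs = is \<and> pair_sums ys = js
       then alt [0..<Suc n] (map fst xs) * z (map fst ys, map snd (xs @ ys)) else 0"
  have apply_hm: "hook_map M n e z (is, js) = (\<Sum>xs\<in>tuples (Suc n) ?I.
      \<Sum>ys\<in>tuples M ?I. ?f is js xs ys)" for "is" js
    by (simp add: hook_map_def)
  have supp: "hook_map M n e z (is, js) = 0"
    if "is \<notin> tuples (Suc n) {0..n + e} \<or> js \<notin> tuples M {0..n + e}" for "is" js
    unfolding apply_hm using that pair_sums_tuples by (intro sum.neutral ballI) auto
  have left: "?f (permute_list \<sigma> is) js (permute_list \<sigma> xs) ys = of_int (sign \<sigma>) * ?f is js xs ys"
    if "xs \<in> tuples (Suc n) ?I" "length is = Suc n" "\<sigma> permutes {..<Suc n}" for "is" js xs ys \<sigma>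
  proof -
    have "pair_sums (permute_list \<sigma> xs) = permute_list \<sigma> is \<longleftrightarrow> pair_sums xs = is"
      using that by (simp add: permute_list_map permute_list_eq_iff length_tuples flip:
          permute_list_map)
    moreover have "alt [0..<Suc n] (map fst (permute_list \<sigma> xs)) = (of_int (sign \<sigma>)
        * alt [0..<Suc n] (map fst xs) :: 'a)"
      using that by (simp add: length_tuples alt_permute flip: permute_list_map)
    moreover have "mset (map snd (permute_list \<sigma> xs @ ys)) = mset (map snd (xs @ ys))"
      using that by (simp add: length_tuples flip: permute_list_map)
    then have "z (map fst ys, map snd (permute_list \<sigma> xs @ ys)) = z (map fst ys, map snd (xs @ ys))"
      by (rule sym_tensorsD(2)[OF z refl])
    ultimately show ?thesis by simp
  qed
  have alternating: "hook_map M n e z (permute_list \<sigma> is, js) = of_int (sign \<sigma>)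
      * hook_map M n e z (is, js)"
    if "is \<in> tuples (Suc n) {0..n + e}" "\<sigma> permutes {..<Suc n}" for "is" js \<sigma>
  proof -
    have "hook_map M n e z (permute_list \<sigma> is, js) =
        (\<Sum>xs\<in>tuples (Suc n) ?I. \<Sum>ys\<in>tuples M ?I. ?f (permute_list \<sigma> is) js (permute_list \<sigma> xs) ys)"
      unfolding apply_hm by (rule sum_tuples_permute[OF that(2), symmetric])
    also have "\<dots> = (\<Sum>xs\<in>tuples (Suc n) ?I. \<Sum>ys\<in>tuples M ?I. of_int (sign \<sigma>) * ?f is js xs ys)"
      using that by (intro sum.cong refl left) (auto simp: length_tuples)
    finally show ?thesis
      unfolding apply_hm sum_distrib_left .
  qed
  \<comment> \<open>In characteristic 2 this does not follow from \<open>alternating\<close>, so the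
    terms themselves are paired by a transposition. A fixed \<open>xs\<close> repeats a pair, hence
    a first component, and its factor \<open>alt\<close> is 0.\<close>
  have zero: "hook_map M n e z (is, js) = 0"
    if nd: "is \<in> tuples (Suc n) {0..n + e}" "\<not> distinct is" for "is" js
  proof -
    obtain a b where ab: "a < length is" "b < length is" "a \<noteq> b"
      and fixed: "permute_list (Transposition.transpose a b) is = is"
      using exists_transpose_if_not_distinct[OF nd(2)] .
    let ?\<tau> = "Transposition.transpose a b"
    have \<tau>: "?\<tau> permutes {..<Suc n}" and len: "length is = Suc n"
      using ab nd(1) by (auto simp: permutes_swap_id length_tuples)
    show ?thesis
      unfolding apply_hm
    proof (rule sum_involution_eq_0[where \<iota> = "permute_list ?\<tau>"])
      fix xs assume xs: "xs \<in> tuples (Suc n) ?I"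
      show "permute_list ?\<tau> xs \<in> tuples (Suc n) ?I"
        using xs \<tau> by simp
      show "permute_list ?\<tau> (permute_list ?\<tau> xs) = xs"
        using xs \<tau> by (simp add: length_tuples flip: permute_list_compose)
      show "(\<Sum>ys\<in>tuples M ?I. ?f is js (permute_list ?\<tau> xs) ys) = -
          (\<Sum>ys\<in>tuples M ?I. ?f is js xs ys)"
        unfolding sum_negf[symmetric]
        using left[OF xs len \<tau>] ab by (intro sum.cong refl) (simp add: fixed sign_swap_id)
      show "(\<Sum>ys\<in>tuples M ?I. ?f is js xs ys) = 0" if eq: "permute_list ?\<tau> xs = xs"
      proof -
        have "xs ! a = xs ! b"
          using eq \<tau> xs ab(1) len by (metis length_tuples permute_list_nth transpose_apply_first)
        then have "\<not> distinct xs"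
          using ab xs len nth_eq_iff_index_eq[of xs a b] by (auto simp: length_tuples)
        then have "\<not> distinct (map fst xs)"
          by (simp add: distinct_map)
        then have "alt [0..<Suc n] (map fst xs) = (0::'a)"
          by (rule alt_not_distinct_right) simp
        then show ?thesis
          by (intro sum.neutral) (simp del: upt_Suc)
      qed
    qed simp
  qed
  have right: "?f is (permute_list \<sigma> js) xs (permute_list \<sigma> ys) = ?f is js xs ys"
    if "ys \<in> tuples M ?I" "length js = M" "\<sigma> permutes {..<M}" for "is" js xs ys \<sigma>
  proof -
    have "pair_sums (permute_list \<sigma> ys) = permute_list \<sigma> js \<longleftrightarrow> pair_sums ys = js"
      using that by (simp add: permute_list_map permute_list_eq_iff length_tuples flip:
          permute_list_map)
    moreover have "mset (map snd (xs @ permute_list \<sigma> ys)) = mset (map snd (xs @ ys))"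
      "mset (map fst (permute_list \<sigma> ys)) = mset (map fst ys)"
      using that by (simp_all add: length_tuples flip: permute_list_map)
    then have "z (map fst (permute_list \<sigma> ys), map snd (xs @ permute_list \<sigma> ys))
        = z (map fst ys, map snd (xs @ ys))"
      by (intro sym_tensorsD(2)[OF z])
    ultimately show ?thesis by simp
  qed
  have symmetric: "hook_map M n e z (is, permute_list \<sigma> js) = hook_map M n e z (is, js)"
    if "js \<in> tuples M {0..n + e}" "\<sigma> permutes {..<M}" for "is" js \<sigma>
    unfolding apply_hm
  proof (rule sum.cong[OF refl])
    fix xs
    have "(\<Sum>ys\<in>tuples M ?I. ?f is (permute_list \<sigma> js) xs ys) =
        (\<Sum>ys\<in>tuples M ?I. ?f is (permute_list \<sigma> js) xs (permute_list \<sigma> ys))"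
      by (rule sum_tuples_permute[OF that(2), symmetric])
    also have "\<dots> = (\<Sum>ys\<in>tuples M ?I. ?f is js xs ys)"
      using that by (intro sum.cong refl right) (auto simp: length_tuples)
    finally show "(\<Sum>ys\<in>tuples M ?I. ?f is (permute_list \<sigma> js) xs ys) =
        (\<Sum>ys\<in>tuples M ?I. ?f is js xs ys)" .
  qed
  have koszul: "hook_map M n e z (is, j # js) = (\<Sum>k<Suc n. hook_map M n e z (is[k := j], is ! k
      # js))"
    if "is \<in> tuples (Suc n) {0..n + e}" "j # js \<in> tuples M {0..n + e}" for "is" j js
  proof (cases M)
    case (Suc M')
    then show ?thesis
      using hook_map_koszul[of z M' n e "is" j js] z that by
          (simp add: length_tuples del: sum.lessThan_Suc)
  qed (use that in \<open>simp add: tuples_def\<close>)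
  show ?thesis
    unfolding hook_tensors_def mem_Collect_eq
    using supp alternating zero symmetric koszul by blast
qed

section \<open>Injectivity\<close>

text \<open>The exponents contributed by V(x) are a permutation of 0, ..., N - 1, so counting column
  positions is counting values; this is how an exponent becomes readable from an order
  relation.\<close>

lemma count_below_permutation:
  assumes "mset ps = mset [0..<N]"
  shows "card {b. b < N \<and> P (ps ! b)} = card {p. p < N \<and> P p}"
proof -
  have "length (filter P ps) = length (filter P [0..<N])"
    using assms by (metis mset_filter size_mset)
  moreover have "length ps = N"
    using mset_eq_length[OF assms] by simp
  ultimately show ?thesis
    by (simp add: length_filter_conv_card cong: conj_cong)
qed

text \<open>The offset makes ties between a row position and a column position
  resolve in favour of the column.\<close>

definition position_weight :: "nat \<Rightarrow> (nat \<times> nat) list \<Rightarrow> nat \<Rightarrow> nat" where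
  "position_weight N w k = 2 * fst (w ! k) + (if k < N then 0 else 1)"

definition comonotone :: "nat \<Rightarrow> (nat \<times> nat) list \<Rightarrow> bool" where
  "comonotone N w \<longleftrightarrow> (\<forall>a<length w. \<forall>b<length w.
     position_weight N w a < position_weight N w b \<longrightarrow> snd (w ! a) \<le> snd (w ! b))"

text \<open>Each summand is the square of twice the exponent of the product, plus 1 in the row. Up
  to a factor 4 this is the square norm of the exponent vector after its row positions are shifted
  by one half.\<close>

definition square_weight :: "nat \<Rightarrow> (nat \<times> nat) list \<Rightarrow> nat" where
  "square_weight N w = (\<Sum>k<length w. (position_weight N w k + 2 * snd (w ! k))\<^sup>2)"

lemma square_weight_pair_sums:
  assumes "pair_sums w = pair_sums w'"
  shows "square_weight N w = square_weight N w'"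
proof -
  have len: "length w = length w'"
    using assms by (metis length_map)
  have "position_weight N w k + 2 * snd (w ! k) = position_weight N w' k + 2 * snd (w' ! k)"
    if "k < length w" for k
  proof -
    have "pair_sums w ! k = pair_sums w' ! k"
      by (simp add: assms)
    then have "fst (w ! k) + snd (w ! k) = fst (w' ! k) + snd (w' ! k)"
      using that len by (simp add: case_prod_beta)
    then show ?thesis
      by (simp add: position_weight_def)
  qed
  then show ?thesis
    unfolding square_weight_def len[symmetric] by (intro sum.cong) auto
qed

text \<open>The two-term rearrangement inequality: the sides differ by 4 (\<beta> - \<alpha>) (p -
  q).\<close>

lemma sum_squares_exchange:
  fixes \<alpha> \<beta> p q :: nat
  assumes "\<alpha> < \<beta>" "q < p"
  shows "(\<alpha> + 2 * p)\<^sup>2 + (\<beta> + 2 * q)\<^sup>2 < (\<alpha> + 2 * q)\<^sup>2 + (\<beta> + 2 * p)\<^sup>2"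
proof -
  obtain s t where "\<beta> = Suc (\<alpha> + s)" "p = Suc (q + t)"
    using assms less_iff_Suc_add by metis
  then show ?thesis
    by (simp add: power2_eq_square algebra_simps)
qed

lemma square_weight_swap:
  assumes ab: "a < length w" "b < length w"
    and lt: "position_weight N w a < position_weight N w b" "snd (w ! b) < snd (w ! a)"
  shows "square_weight N w < square_weight N (w[a := (fst (w ! a), snd (w ! b)), b := (fst (w !
      b), snd (w ! a))])"
    (is "_ < square_weight N ?w")
proof -
  have "a \<noteq> b"
    using lt(1) by auto
  let ?t = "\<lambda>w k. (position_weight N w k + 2 * snd (w ! k))\<^sup>2"
  have split: "square_weight N v = (\<Sum>k\<in>{..<length w} - {a, b}. ?t v k) + (?t v a + ?t v b)"
    if "length v = length w" for v
  proof -
    have "square_weight N v = (\<Sum>k\<in>{..<length w} - {a, b}. ?t v k) + (\<Sum>k\<in>{a, b}. ?t v k)"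
      unfolding square_weight_def that using ab by (intro sum.subset_diff) auto
    then show ?thesis
      using \<open>a \<noteq> b\<close> by simp
  qed
  have "(\<Sum>k\<in>{..<length w} - {a, b}. ?t ?w k) = (\<Sum>k\<in>{..<length w} - {a, b}. ?t w k)"
    by (intro sum.cong) (auto simp: position_weight_def)
  moreover have "?t w a + ?t w b < ?t ?w a + ?t ?w b"
  proof -
    have pw: "position_weight N ?w a = position_weight N w a" "position_weight N ?w b
        = position_weight N w b"
      using ab \<open>a \<noteq> b\<close> by (auto simp: position_weight_def)
    have snd: "snd (?w ! a) = snd (w ! b)" "snd (?w ! b) = snd (w ! a)"
      using ab \<open>a \<noteq> b\<close> by auto
    show ?thesis
      unfolding pw snd using lt by (rule sum_squares_exchange)
  qed
  ultimately show ?thesis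
    by (simp add: split)
qed

text \<open>The first components can be read off from the sums alone. At a column position the first
  component is the number of column positions with a strictly smaller sum; at a row position, one
  more than it is the number of column positions with a sum at most as large. The second components
  follow by subtraction.\<close>

lemma comonotone_unique:
  assumes len: "length w = L" "length w' = L" "N \<le> L"
    and com: "comonotone N w" "comonotone N w'"
    and perm: "mset (map fst (take N w)) = mset [0..<N]" "mset (map fst (take N w')) = mset [0..<N]"
    and bound: "\<And>k. k < L \<Longrightarrow> fst (w ! k) < N" "\<And>k. k < L \<Longrightarrow> fst (w' ! k) < N"
    and sums: "pair_sums w = pair_sums w'"
  shows "w = w'"
proof -
  have count: "(if k < N then 0 else 1) + fst (w ! k) =
      card {b. b < N \<and> (if k < N then pair_sums w ! b < pair_sums w ! k
          else pair_sums w ! b \<le> pair_sums w ! k)}"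
    if len: "length w = L" and com: "comonotone N w"
      and perm: "mset (map fst (take N w)) = mset [0..<N]"
      and bound: "\<And>k. k < L \<Longrightarrow> fst (w ! k) < N" and k: "k < L" for w k
  proof -
    have com': "position_weight N w a < position_weight N w b \<Longrightarrow> snd (w ! a) \<le> snd (w ! b)"
      if "a < L" "b < L" for a b
      using com that len unfolding comonotone_def by blast
    have nth: "pair_sums w ! b = fst (w ! b) + snd (w ! b)" if "b < L" for b
      using that len by (simp add: case_prod_beta)
    have inj: "fst (w ! b) \<noteq> fst (w ! k)" if "b < N" "k < N" "b \<noteq> k" for b
    proof -
      have "distinct (map fst (take N w))"
        by (metis perm distinct_upt mset_eq_imp_distinct_iff)
      then show ?thesis
        using that len \<open>N \<le> L\<close> by (auto simp: distinct_conv_nth)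
    qed
    \<comment> \<open>Sums compare as weights do. Two column positions have different first
      components, and a column position with the same first component as a row position has the
      smaller weight because of the offset; this accounts for < in the column and \<le> in the
      row.\<close>
    have iff: "(if k < N then pair_sums w ! b < pair_sums w ! k
        else pair_sums w ! b \<le> pair_sums w ! k) \<longleftrightarrow>
        (if k < N then map fst (take N w) ! b < fst (w ! k)
            else map fst (take N w) ! b \<le> fst (w ! k))"
      if b: "b < N" for b
    proof (cases "b = k")
      case False
      have "b < L"
        using b \<open>N \<le> L\<close> by simp
      then have "position_weight N w k \<le> position_weight N w b \<or> snd (w ! b) \<le> snd (w ! k)"
        "position_weight N w b \<le> position_weight N w k \<or> snd (w ! k) \<le> snd (w ! b)"
        using com'[of b k] com'[of k b] k by linarith+
      moreover have "map fst (take N w) ! b = fst (w ! b)"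
        using b len \<open>N \<le> L\<close> by simp
      ultimately show ?thesis
        using inj[OF b _ False] b unfolding nth[OF \<open>b < L\<close>] nth[OF k] position_weight_def
        by (cases "k < N") (simp_all, linarith+)
    qed (use b len k in auto)
    have "card {b. b < N \<and> (if k < N then pair_sums w ! b < pair_sums w ! k
        else pair_sums w ! b \<le> pair_sums w ! k)} =
        card {b. b < N \<and> (if k < N then map fst (take N w) ! b < fst (w ! k)
            else map fst (take N w) ! b \<le> fst (w ! k))}"
      using iff by (intro arg_cong[of _ _ card]) blast
    also have "\<dots> = card {p. p < N \<and> (if k < N then p < fst (w ! k) else p \<le> fst (w ! k))}"
      by (rule count_below_permutation[OF perm])
    also have "{p. p < N \<and> (if k < N then p < fst (w ! k) else p \<le> fst (w ! k))} =
        {..<(if k < N then 0 else 1) + fst (w ! k)}"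
      using bound[OF k] by auto
    finally show ?thesis
      by simp
  qed
  show ?thesis
  proof (rule nth_equalityI)
    fix k assume "k < length w"
    then have k: "k < L"
      by (simp add: len)
    have "fst (w ! k) = fst (w' ! k)"
      using count[OF len(1) com(1) perm(1) bound(1) k] count[OF len(2) com(2) perm(2) bound(2) k]
      unfolding sums by simp
    moreover have "fst (w ! k) + snd (w ! k) = fst (w' ! k) + snd (w' ! k)"
      using arg_cong[OF sums, of "\<lambda>l. l ! k"] k len by (simp add: case_prod_beta)
    ultimately show "w ! k = w' ! k"
      by (simp add: prod_eq_iff)
  qed (simp add: len)
qed

text \<open>
  Among the terms of \<open>V(x) f(y) g(x, y)\<close> take one of maximal square weight. Since the weight depends
  only on the resulting exponents and a term that is not comonotone can be improved by exchanging
  two exponents of \<open>g\<close>, no other term has the same exponents, so this one does not cancel.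
\<close>

lemma hook_map_eq_0:
  fixes z :: "nat list \<times> nat list \<Rightarrow> 'a::field"
  assumes z: "z \<in> sym_tensors M n e" and zero: "hook_map M n e z = 0"
  shows "z = 0"
proof (rule ccontr)
  assume "z \<noteq> 0"
  then obtain ls ms where lm: "z (ls, ms) \<noteq> 0"
    by (auto simp: fun_eq_iff)
  let ?N = "Suc n" and ?I = "{0..n} \<times> {0..e}"
  let ?L = "M + ?N"
  \<comment> \<open>A term is indexed by the concatenation \<open>w\<close> of \<open>xs\<close> and
    \<open>ys\<close>, with the column positions first, and \<open>u w\<close> is its
    contribution.\<close>
  define u where "u = (\<lambda>w. alt [0..<?N] (map fst (take ?N w)) * z (map fst (drop ?N w), map snd w))"
  define Z where "Z = {w \<in> tuples ?L ?I. u w \<noteq> 0}"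
  have fin: "finite Z"
    by (simp add: Z_def)
  have mem: "ls \<in> tuples M {0..n}" "ms \<in> tuples ?L {0..e}"
    using sym_tensorsD(1)[OF z lm] by auto
  \<comment> \<open>The diagonal term of the Vandermonde determinant has coefficient 1. Paired with
    a nonzero coefficient of \<open>z\<close> it shows that some term is nonzero.\<close>
  let ?w = "zip ([0..<?N] @ ls) ms"
  have len: "length ([0..<?N] @ ls) = length ms"
    using mem by (simp add: tuples_def)
  have maps: "map fst ?w = [0..<?N] @ ls" "map snd ?w = ms"
    using len by (simp_all only: map_fst_zip map_snd_zip)
  have "?w \<in> Z"
  proof -
    have "set ?w \<subseteq> ?I"
      using mem set_zip_leftD set_zip_rightD by (fastforce simp: tuples_def)
    moreover have "length ?w = ?L"
      using mem by (simp add: tuples_def)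
    moreover have "map fst (take ?N ?w) = [0..<?N]" "map fst (drop ?N ?w) = ls"
      unfolding take_map[symmetric] drop_map[symmetric] maps by simp_all
    then have "u ?w = z (ls, ms)"
      by (simp only: u_def maps alt_self distinct_upt mult_1)
    ultimately show ?thesis
      using lm by (simp add: Z_def tuples_def)
  qed
  then have ne: "Z \<noteq> {}"
    by auto
  let ?Q = "square_weight ?N"
  obtain w where w: "w \<in> Z" and "?Q w = Max (?Q ` Z)"
    using Max_in[of "?Q ` Z"] fin ne by fastforce
  then have max: "?Q w' \<le> ?Q w" if "w' \<in> Z" for w'
    using fin that by simp
  have com: "comonotone ?N v" if v: "v \<in> Z" and eq: "?Q v = ?Q w" for v
  proof (rule ccontr)
    assume "\<not> comonotone ?N v"
    then obtain a b where ab: "a < length v" "b < length v"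
      and lt: "position_weight ?N v a < position_weight ?N v b" "snd (v ! b) < snd (v ! a)"
      unfolding comonotone_def by (auto simp: not_le)
    \<comment> \<open>Only exponents of g are exchanged. Even when one of them sits in the column
      and the other in the row, \<open>u\<close> is unchanged, since g is symmetric in all its
      variables together.\<close>
    let ?v = "v[a := (fst (v ! a), snd (v ! b)), b := (fst (v ! b), snd (v ! a))]"
    have "a \<noteq> b"
      using lt by auto
    have fst: "map fst ?v = map fst v"
      by (simp add: map_update list_update_id flip: nth_map)
         (use ab \<open>a \<noteq> b\<close> in \<open>simp add: list_eq_iff_nth_eq nth_list_update\<close>)
    have "map snd ?v = (map snd v)[a := map snd v ! b, b := map snd v ! a]"
      using ab by (simp add: map_update)
    then have snd: "mset (map snd ?v) = mset (map snd v)"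
      using ab by (simp only: perm_swap length_map)
    have "?v \<in> tuples ?L ?I"
    proof -
      have "set ?v \<subseteq> ?I"
      proof (intro subset_code(1)[THEN iffD2] ballI)
        fix x assume "x \<in> set ?v"
        then have "fst x \<in> set (map fst ?v)" "snd x \<in> set (map snd ?v)"
          by (simp_all del: map_update set_update_subsetI)
        then have "fst x \<in> set (map fst v)" "snd x \<in> set (map snd v)"
          unfolding fst by (simp_all only: mset_eq_setD[OF snd])
        moreover have "map fst v \<in> tuples ?L {0..n}" "map snd v \<in> tuples ?L {0..e}"
          using v fst_tuples snd_tuples unfolding Z_def by blast+
        ultimately show "x \<in> ?I"
          unfolding mem_Times_iff tuples_def by blast
      qed
      then show ?thesis
        using v by (simp add: Z_def tuples_def)
    qed
    moreover have "u ?v = u v"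
      unfolding u_def take_map[symmetric] drop_map[symmetric] fst
      using sym_tensorsD(2)[OF z refl snd] by simp
    ultimately have "?v \<in> Z"
      using v by (simp add: Z_def)
    then show False
      using max[of ?v] square_weight_swap[OF ab lt] eq by simp
  qed
  have perm: "mset (map fst (take ?N v)) = mset [0..<?N]" if "v \<in> Z" for v
  proof -
    have "alt [0..<?N] (map fst (take ?N v)) \<noteq> (0::'a)"
      using that unfolding Z_def u_def by auto
    then show ?thesis
      using alt_eq_0 by blast
  qed
  have bound: "fst (v ! k) < ?N" if "v \<in> Z" "k < ?L" for v k
  proof -
    have "v ! k \<in> ?I"
      using that nth_mem[of k v] unfolding Z_def tuples_def by auto
    then show ?thesis
      by auto
  qed
  have unique: "v = w" if v: "v \<in> Z" and sums: "pair_sums v = pair_sums w" for v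
  proof (rule comonotone_unique[of _ ?L _ ?N])
    show "comonotone ?N v" "comonotone ?N w"
      using com v w square_weight_pair_sums[OF sums] by auto
    show "mset (map fst (take ?N v)) = mset [0..<?N]" "mset (map fst (take ?N w)) = mset [0..<?N]"
      using v w perm by blast+
    show "fst (v ! k) < ?N" "fst (w ! k) < ?N" if "k < ?L" for k
      using that v w bound by blast+
  qed (use v w sums in \<open>auto simp: Z_def tuples_def\<close>)
  let ?f = "\<lambda>xs ys. if pair_sums xs = pair_sums (take ?N w) \<and> pair_sums ys = pair_sums (drop ?N w)
      then alt [0..<?N] (map fst xs) * z (map fst ys, map snd (xs @ ys)) else 0"
  have wI: "w \<in> tuples ?L ?I"
    using w by (simp add: Z_def)
  have halves: "take ?N w \<in> tuples ?N ?I" "drop ?N w \<in> tuples M ?I"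
    using wI set_take_subset[of ?N w] set_drop_subset[of ?N w] by (auto simp: tuples_def)
  have "?f xs ys = (if ys = drop ?N w then if xs = take ?N w then u w else 0 else 0)"
    if xs: "xs \<in> tuples ?N ?I" and ys: "ys \<in> tuples M ?I" for xs ys
  proof (cases "?f xs ys = 0")
    case True
    have "u w \<noteq> 0"
      using w unfolding Z_def by blast
    then have "?f (take ?N w) (drop ?N w) \<noteq> 0"
      by (simp add: u_def del: upt_Suc)
    then show ?thesis
      using True by fastforce
  next
    case False
    then have sums: "pair_sums xs = pair_sums (take ?N w)" "pair_sums ys = pair_sums (drop ?N w)"
      by meson+
    have "pair_sums (xs @ ys) = pair_sums (take ?N w @ drop ?N w)"
      by (simp only: map_append sums)
    moreover have "xs @ ys \<in> Z"
      using False xs ys sums by (simp add: Z_def u_def tuples_def del: upt_Suc)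
    ultimately have "xs @ ys = w"
      using unique[of "xs @ ys"] by (simp only: append_take_drop_id)
    then have "xs = take ?N w" "ys = drop ?N w"
      using length_tuples[OF xs] by auto
    then show ?thesis
      using False by (simp add: u_def del: upt_Suc)
  qed
  then have "hook_map M n e z (pair_sums (take ?N w), pair_sums (drop ?N w)) =
      (\<Sum>xs\<in>tuples ?N ?I. \<Sum>ys\<in>tuples M ?I. if ys = drop ?N w then if xs = take ?N w then u w
          else 0 else 0)"
    unfolding hook_map_def prod.case by (intro sum.cong refl) blast
  also have "\<dots> = u w"
    using halves by (simp del: upt_Suc)
  finally show False
    using zero w by (simp add: Z_def del: upt_Suc)
qed

section \<open>Linearity of the multiplication map, and injectivity from its trivial kernel\<close>

lemma hook_map_add: "hook_map M n e (z + z') = hook_map M n e z + hook_map M n e z'"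
  by (auto simp: hook_map_def fun_eq_iff distrib_left sum.distrib[symmetric]
      simp del: upt_Suc intro!: sum.cong)

lemma hook_map_fscale: "hook_map M n e (fscale c z) = fscale c (hook_map M n e z)"
  by (auto simp: hook_map_def fscale_def fun_eq_iff sum_distrib_left
      simp del: upt_Suc intro!: sum.cong)

lemma hook_map_sum: "hook_map M n e (\<Sum>s\<in>S. fscale (c s) (f s)) =
    (\<Sum>s\<in>S. fscale (c s) (hook_map M n e (f s)))"
proof (induction S rule: infinite_finite_induct)
  have "hook_map M n e 0 = 0"
    by (simp add: hook_map_def fun_eq_iff cong: if_cong)
  then show "hook_map M n e (\<Sum>s\<in>{}. fscale (c s) (f s)) =
      (\<Sum>s\<in>{}. fscale (c s) (hook_map M n e (f s)))"
    "infinite A \<Longrightarrow> hook_map M n e (\<Sum>s\<in>A. fscale (c s) (f s)) =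
        (\<Sum>s\<in>A. fscale (c s) (hook_map M n e (f s)))" for A
    by simp_all
qed (simp only: sum.insert not_False_eq_True hook_map_add hook_map_fscale)

lemma subspace_sym_tensors:
  "fvs.subspace (sym_tensors M n e :: (nat list \<times> nat list \<Rightarrow> 'a::field) set)"
  unfolding fvs.subspace_def
proof (intro conjI ballI allI)
  show "0 \<in> (sym_tensors M n e :: (nat list \<times> nat list \<Rightarrow> 'a) set)"
    by (simp add: sym_tensors_def)
  fix x y :: "nat list \<times> nat list \<Rightarrow> 'a" and c
  assume x: "x \<in> sym_tensors M n e"
  note zx = sym_tensorsD(1)[OF x] and eqx = sym_tensorsD(2)[OF x]
  show "fscale c x \<in> sym_tensors M n e"
    unfolding sym_tensors_def fscale_def mem_Collect_eq
  proof (intro conjI allI impI)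
    show "c * x (ls, ms) = 0" if "\<not> (ls \<in> tuples M {0..n} \<and> ms \<in> tuples (M + Suc n) {0..e})"
        for ls ms
      using that zx by fastforce
    show "c * x (ls, ms) = c * x (ls', ms')" if "mset ls = mset ls' \<and> mset ms = mset ms'"
        for ls ls' ms ms'
      using that eqx[of ls ls' ms ms'] by simp
  qed
  assume y: "y \<in> sym_tensors M n e"
  note zy = sym_tensorsD(1)[OF y] and eqy = sym_tensorsD(2)[OF y]
  show "x + y \<in> sym_tensors M n e"
    unfolding sym_tensors_def plus_fun_apply mem_Collect_eq
  proof (intro conjI allI impI)
    show "x (ls, ms) + y (ls, ms) = 0" if "\<not> (ls \<in> tuples M {0..n} \<and> ms \<in> tuples (M + Suc n)
        {0..e})" for ls ms
    proof -
      have "x (ls, ms) = 0" "y (ls, ms) = 0"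
        using that zx zy by blast+
      then show ?thesis by simp
    qed
    show "x (ls, ms) + y (ls, ms) = x (ls', ms') + y (ls', ms')" if "mset ls = mset ls' \<and>
        mset ms = mset ms'" for ls ls' ms ms'
      using that eqx[of ls ls' ms ms'] eqy[of ls ls' ms ms'] by simp
  qed
qed

lemma inj_on_hook_map: "inj_on (hook_map M n e) (sym_tensors M n e)"
proof (rule inj_onI)
  fix z z' :: "nat list \<times> nat list \<Rightarrow> 'a"
  assume z: "z \<in> sym_tensors M n e" "z' \<in> sym_tensors M n e" and eq: "hook_map M n e z
      = hook_map M n e z'"
  have "hook_map M n e z = hook_map M n e (z - z') + hook_map M n e z'"
    by (metis hook_map_add diff_add_cancel)
  then have "hook_map M n e (z - z') = 0"
    by (simp only: eq add_cancel_right_left)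
  moreover have "z - z' \<in> sym_tensors M n e"
    by (rule fvs.subspace_diff[OF subspace_sym_tensors z])
  ultimately have "z - z' = 0"
    using hook_map_eq_0 by blast
  then show "z = z'"
    by (simp only: right_minus_eq)
qed

section \<open>Surjectivity\<close>

text \<open>A comonotone multiset of pairs matches its two coordinate multisets in sorted order.
  Indeed the pair of the two minima belongs to it: a pair with least first component and a pair with
  least second component are comonotone only if one of them attains both. Remove that pair and
  induct.\<close>

lemma comonotone_mset_unique:
  fixes A B :: "(nat \<times> nat) multiset"
  assumes "\<And>x y. x \<in># A \<Longrightarrow> y \<in># A \<Longrightarrow> fst x < fst y \<Longrightarrow> snd x \<le> snd y"
    and "\<And>x y. x \<in># B \<Longrightarrow> y \<in># B \<Longrightarrow> fst x < fst y \<Longrightarrow> snd x \<le> snd y"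
    and "image_mset fst A = image_mset fst B" "image_mset snd A = image_mset snd B"
  shows "A = B"
  using assms
proof (induction "size A" arbitrary: A B)
  case 0
  then show ?case
    by (metis image_mset_is_empty_iff size_eq_0_iff_empty)
next
  case (Suc k)
  have least: "(Min (fst ` set_mset C), Min (snd ` set_mset C)) \<in># C"
    if "C \<noteq> {#}" and com: "\<And>x y. x \<in># C \<Longrightarrow> y \<in># C \<Longrightarrow> fst x < fst y \<Longrightarrow> snd x \<le> snd y"
    for C :: "(nat \<times> nat) multiset"
  proof -
    let ?p = "Min (fst ` set_mset C)" and ?q = "Min (snd ` set_mset C)"
    have "?p \<in> fst ` set_mset C" "?q \<in> snd ` set_mset C"
      using that(1) by (auto intro!: Min_in)
    then obtain q p where pq: "(?p, q) \<in># C" "(p, ?q) \<in># C"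
      by auto
    have "p \<in> fst ` set_mset C" "q \<in> snd ` set_mset C"
      using pq by force+
    then have le: "?p \<le> p" "?q \<le> q"
      by simp_all
    show ?thesis
    proof (cases "?p = p")
      case False
      then have "q \<le> ?q"
        using com[OF pq] le by simp
      then show ?thesis
        using pq le by simp
    qed (use pq in simp)
  qed
  have ne: "A \<noteq> {#}" "B \<noteq> {#}"
    using Suc.hyps(2) Suc.prems(3) by auto
  have sets: "fst ` set_mset A = fst ` set_mset B" "snd ` set_mset A = snd ` set_mset B"
    using Suc.prems(3,4) by (metis set_image_mset)+
  let ?x = "(Min (fst ` set_mset A), Min (snd ` set_mset A))"
  have x: "?x \<in># A" "?x \<in># B"
    using least[OF ne(1) Suc.prems(1)] least[OF ne(2) Suc.prems(2)] by (simp_all add: sets)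
  have "A - {#?x#} = B - {#?x#}"
  proof (rule Suc.hyps(1))
    show "k = size (A - {#?x#})"
      using x Suc.hyps(2) by (simp add: size_Diff_singleton)
    show "image_mset fst (A - {#?x#}) = image_mset fst (B - {#?x#})"
      "image_mset snd (A - {#?x#}) = image_mset snd (B - {#?x#})"
      using x Suc.prems(3,4) by (simp_all add: image_mset_Diff)
  qed (use Suc.prems(1,2) in_diffD in metis)+
  then show ?case
    using x by (metis insert_DiffM)
qed

text \<open>
  Column ranks invert the passage from the exponents of a maximal term of \<open>f(y) g(x, y)\<close> to its
  contribution to the product: a row entry \<open>j\<close> splits as \<open>r + (j - r)\<close> with \<open>r\<close> its column rank
  and the \<open>i\<close>-th column entry \<open>c\<close> as \<open>i + (c - i)\<close>.
\<close>

definition column_rank :: "nat list \<Rightarrow> nat \<Rightarrow> nat" where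
  "column_rank is j = Max {b. b < length is \<and> is ! b \<le> j}"

definition weighted_offsets :: "nat list \<Rightarrow> nat list \<Rightarrow> (nat \<times> nat) multiset" where
  "weighted_offsets is js = image_mset (\<lambda>i. (2 * i, is ! i - i)) (mset [0..<length is]) +
     image_mset (\<lambda>j. (2 * column_rank is j + 1, j - column_rank is j)) (mset js)"

context
  fixes "is" :: "nat list" and n e :: nat
  assumes len: "length is = Suc n" and strict: "sorted_wrt (<) is" and bounded:
      "set is \<subseteq> {0..n + e}"
begin

text \<open>Entries that grow by at least 1 per step have weakly increasing offsets
  \<open>is ! i - i\<close>. The conjunct \<open>a \<le> is ! a\<close> records that the subtraction
  of naturals is not truncated.\<close>

lemma offset_mono:
  assumes "a \<le> b" "b \<le> n"
  shows "a \<le> is ! a \<and> is ! a - a \<le> is ! b - b"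
  using assms
proof (induction b arbitrary: a)
  case (Suc b)
  have step: "is ! b < is ! Suc b"
    using sorted_wrt_nth_less[OF strict, of b "Suc b"] len Suc.prems by simp
  show ?case
  proof (cases "a = Suc b")
    case True
    then show ?thesis
      using Suc.IH[of b] Suc.prems step by simp
  next
    case False
    then have "a \<le> is ! a \<and> is ! a - a \<le> is ! b - b"
      using Suc.IH[of a] Suc.prems by simp
    then show ?thesis
      using step Suc.IH[of b] Suc.prems(2) by auto
  qed
qed simp

lemma offset_le: "a \<le> n \<Longrightarrow> is ! a - a \<le> e"
  using offset_mono[of a n] nth_mem[of n "is"] len bounded by fastforce

text \<open>With r the column rank, \<open>j\<close> lies between the column entries at r
  (inclusive) and r + 1 (exclusive, if present), so the offset j - r lies between the offsets of
  these two columns. The assumption makes the set under \<open>Max\<close> nonempty.\<close>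

lemma column_rank:
  assumes "is ! 0 \<le> j"
  shows "column_rank is j \<le> n" "is ! column_rank is j \<le> j"
    "a \<le> column_rank is j \<Longrightarrow> is ! a - a \<le> j - column_rank is j"
    "column_rank is j < a \<Longrightarrow> a \<le> n \<Longrightarrow> j - column_rank is j \<le> is ! a - a"
    "column_rank is j \<le> j"
proof -
  let ?S = "{b. b < length is \<and> is ! b \<le> j}"
  let ?\<nu> = "column_rank is j"
  have \<nu>: "?\<nu> \<in> ?S"
    unfolding column_rank_def using assms len by (intro Max_in) auto
  then show n: "?\<nu> \<le> n" and le: "is ! ?\<nu> \<le> j"
    by (auto simp: len)
  show "is ! a - a \<le> j - ?\<nu>" if "a \<le> ?\<nu>"
    using offset_mono[OF that n] le by linarith
  show "?\<nu> \<le> j"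
    using offset_mono[OF order_refl n] le by linarith
  show "j - ?\<nu> \<le> is ! a - a" if "?\<nu> < a" "a \<le> n"
  proof -
    have "Suc ?\<nu> \<notin> ?S"
    proof
      assume "Suc ?\<nu> \<in> ?S"
      then have "Suc ?\<nu> \<le> ?\<nu>"
        unfolding column_rank_def by (intro Max_ge) auto
      then show False by simp
    qed
    then have "j < is ! Suc ?\<nu>"
      using that by (simp add: len)
    then show ?thesis
      using offset_mono[of "Suc ?\<nu>" a] that by auto
  qed
qed

lemma column_offset_le: "is ! 0 \<le> j \<Longrightarrow> j \<le> n + e \<Longrightarrow> j - column_rank is j \<le> e"
  using column_rank(1)[of j] column_rank(4)[of j n] offset_le[of n] by (cases "column_rank is j
      = n") auto

lemma weighted_offsets_comonotone:
  assumes js: "\<And>j. j \<in> set js \<Longrightarrow> is ! 0 \<le> j"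
    and x: "x \<in># weighted_offsets is js" and y: "y \<in># weighted_offsets is js" and lt:
        "fst x < fst y"
  shows "snd x \<le> snd y"
proof -
  have cases: "(\<exists>i\<le>n. x = (2 * i, is ! i - i)) \<or>
      (\<exists>j. is ! 0 \<le> j \<and> x = (2 * column_rank is j + 1, j - column_rank is j))"
    if "x \<in># weighted_offsets is js" for x
    using that js by (auto simp: weighted_offsets_def len simp del: upt_Suc)
  from cases[OF x] show ?thesis
  proof (elim disjE exE conjE)
    fix i assume i: "i \<le> n" "x = (2 * i, is ! i - i)"
    from cases[OF y] show ?thesis
    proof (elim disjE exE conjE)
      fix i' assume "i' \<le> n" "y = (2 * i', is ! i' - i')"
      then show ?thesis
        using i lt offset_mono[of i i'] by simp
    next
      fix j assume "is ! 0 \<le> j" "y = (2 * column_rank is j + 1, j - column_rank is j)"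
      then show ?thesis
        using i lt column_rank(3)[of j i] by simp
    qed
  next
    fix j assume j: "is ! 0 \<le> j" "x = (2 * column_rank is j + 1, j - column_rank is j)"
    from cases[OF y] show ?thesis
    proof (elim disjE exE conjE)
      fix i' assume "i' \<le> n" "y = (2 * i', is ! i' - i')"
      then show ?thesis
        using j lt column_rank(4)[of j i'] by simp
    next
      fix j' assume j': "is ! 0 \<le> j'" "y = (2 * column_rank is j' + 1, j' - column_rank is j')"
      \<comment> \<open>The offset of the column entry at \<open>?a\<close> separates the offsets of
        the two row entries.\<close>
      let ?a = "column_rank is j'"
      have "column_rank is j < ?a"
        using j j' lt by simp
      then show ?thesis
        using j j' column_rank(1)[of j'] column_rank(4)[of j ?a] column_rank(3)[of j' ?a] by simp
    qed
  qed
qed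

end

text \<open>The exponents of f in the comonotone term whose product exponents are the entries of the
  tableau; \<open>offset_code\<close> lists the exponents of g in the same term.\<close>

definition row_code :: "nat list \<Rightarrow> nat list \<Rightarrow> nat list" where
  "row_code is js = map (column_rank is) js"

definition offset_code :: "nat list \<Rightarrow> nat list \<Rightarrow> nat list" where
  "offset_code is js = map (\<lambda>i. is ! i - i) [0..<length is] @ map (\<lambda>j. j - column_rank is j) js"

lemma codes_in_tuples:
  assumes "length is = Suc n" "sorted_wrt (<) is" "set is \<subseteq> {0..n + e}"
    and "length js = M" "set js \<subseteq> {0..n + e}" "\<And>j. j \<in> set js \<Longrightarrow> is ! 0 \<le> j"
  shows "row_code is js \<in> tuples M {0..n}" "offset_code is js \<in> tuples (M + Suc n) {0..e}"
  using assms column_rank(1)[OF assms(1-3)] offset_le[OF assms(1-3)] column_offset_le[OF assms(1-3)]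
  by (fastforce simp: row_code_def offset_code_def tuples_def simp del: upt_Suc)+

text \<open>The two codes determine the coordinate multisets of \<open>weighted_offsets\<close>,
  hence that multiset by comonotonicity. In it each even first coordinate 2 i occurs once and yields
  the column entry \<open>is ! i\<close>, while an odd one 2 r + 1 with offset q yields the row
  entry r + q.\<close>

lemma codes_inj:
  assumes "is": "length is = Suc n" "sorted_wrt (<) is" "set is \<subseteq> {0..n + e}"
    and is': "length is' = Suc n" "sorted_wrt (<) is'" "set is' \<subseteq> {0..n + e}"
    and js: "sorted js" "\<And>j. j \<in> set js \<Longrightarrow> is ! 0 \<le> j"
    and js': "sorted js'" "\<And>j. j \<in> set js' \<Longrightarrow> is' ! 0 \<le> j"
    and row: "mset (row_code is js) = mset (row_code is' js')"
    and offset: "mset (offset_code is js) = mset (offset_code is' js')"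
  shows "is = is' \<and> js = js'"
proof -
  let ?A = "weighted_offsets is js" and ?B = "weighted_offsets is' js'"
  have eq: "?A = ?B"
  proof (rule comonotone_mset_unique)
    have "image_mset fst (weighted_offsets is js) =
       image_mset (\<lambda>i. 2 * i) (mset [0..<length is]) + image_mset (\<lambda>r. 2
           * r + 1) (mset (row_code is js))" for "is" js
      by (simp add: weighted_offsets_def row_code_def multiset.map_comp o_def del: upt_Suc)
    then show "image_mset fst ?A = image_mset fst ?B"
      by (simp only: row assms(1) is'(1))
    have "image_mset snd (weighted_offsets is js) = mset (offset_code is js)" for "is" js
      by (simp add: weighted_offsets_def offset_code_def multiset.map_comp o_def del: upt_Suc)
    then show "image_mset snd ?A = image_mset snd ?B"
      by (simp only: offset)
  qed (use weighted_offsets_comonotone[OF assms(1-3) js(2)] weighted_offsets_comonotone[OF is'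
      js'(2)] in blast)+
  have "is ! i = is' ! i" if i: "i < Suc n" for i
  proof -
    have "(2 * i, is ! i - i) \<in># ?A"
      using i assms(1) by (auto simp: weighted_offsets_def simp del: upt_Suc)
    then have "(2 * i, is ! i - i) \<in># ?B"
      by (simp only: eq)
    then have "(\<exists>i'. 2 * i = 2 * i' \<and> is ! i - i = is' ! i' - i') \<or> (\<exists>j. 2 * i = 2
        * column_rank is' j + 1)"
      unfolding weighted_offsets_def by force
    then have "is ! i - i = is' ! i - i"
      by (elim disjE exE conjE) (simp, presburger)
    then show ?thesis
      using offset_mono[OF assms(1-3), of i i] offset_mono[OF is', of i i] i by simp
  qed
  then have is_eq: "is = is'"
    using assms(1) is'(1) by (intro nth_equalityI) auto
  have "mset js = image_mset (\<lambda>(r, q). r div 2 + q) (filter_mset (\<lambda>x. odd (fst x))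
      (weighted_offsets is js))"
    if "\<And>j. j \<in> set js \<Longrightarrow> is ! 0 \<le> j" for js
  proof -
    have "image_mset (\<lambda>(r, q). r div 2 + q) (filter_mset (\<lambda>x. odd (fst x)) (weighted_offsets is
        js)) =
        image_mset (\<lambda>j. column_rank is j + (j - column_rank is j)) (mset js)"
      by (simp add: weighted_offsets_def filter_mset_image_mset multiset.map_comp o_def del:
          upt_Suc)
    also have "\<dots> = image_mset (\<lambda>j. j) (mset js)"
      using that column_rank(5)[OF assms(1-3)] by (intro image_mset_cong) auto
    finally show ?thesis
      by simp
  qed
  then have "mset js = mset js'"
    using js(2) js'(2) eq is_eq by metis
  then show ?thesis
    using is_eq js(1) js'(1) by (metis properties_for_sort)
qed

lemma semistandard_hooks_position:
  assumes "(as, bs) \<in> semistandard_hooks M (Suc n) {0..d}"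
  shows "length (hd as # bs) = Suc n" "sorted_wrt (<) (hd as # bs)" "set (hd as # bs) \<subseteq> {0..d}"
    "length (tl as) = M" "set (tl as) \<subseteq> {0..d}" "sorted (tl as)"
        "\<And>j. j \<in> set (tl as) \<Longrightarrow> (hd as # bs) ! 0 \<le> j"
    "as = hd as # tl as"
  using assms by (cases as; auto simp: semistandard_hooks_def)+

text \<open>The sum of the distinct rearrangements of one basis tensor. A sum over the whole
  symmetric group would multiply it by the order of a stabiliser, which may be 0 in the
  field.\<close>

definition orbit_sum :: "'i list \<Rightarrow> 'i list \<Rightarrow> 'a::field" where
  "orbit_sum xs = (\<lambda>ys. if mset ys = mset xs then 1 else 0)"

definition orbit_tensor :: "nat list \<times> nat list \<Rightarrow> (nat list \<times> nat list \<Rightarrow> 'a::field)" where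
  "orbit_tensor = (\<lambda>(as, bs). tensor (orbit_sum (row_code (hd as # bs) (tl as))) (orbit_sum
      (offset_code (hd as # bs) (tl as))))"

text \<open>The codes of distinct tableaux are distinct orbits, so evaluation at codes separates the
  orbit tensors. By injectivity their images are independent, and a further independent vector in
  the target would exceed the number of spanning elements \<open>F_Delta t\<close>.\<close>

lemma hook_map_image:
  fixes D :: "(nat list \<times> nat list \<Rightarrow> 'a::field) set"
  assumes D: "D \<subseteq> sym_tensors M n e" "fvs.subspace D"
    and orbit: "\<And>s. s \<in> semistandard_hooks M (Suc n) {0..n + e} \<Longrightarrow> orbit_tensor s \<in> D"
  shows "hook_map M n e ` D = hook_tensors M (Suc n) {0..n + e}"
proof
  let ?S = "semistandard_hooks M (Suc n) {0..n + e}"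
  let ?\<phi> = "hook_map M n e :: _ \<Rightarrow> (nat list \<times> nat list \<Rightarrow> 'a)"
  let ?H = "hook_tensors M (Suc n) {0..n + e} :: (nat list \<times> nat list \<Rightarrow> 'a) set"
  let ?G = "\<lambda>s. ?\<phi> (orbit_tensor s)"
  let ?c = "\<lambda>(as, bs). (row_code (hd as # bs) (tl as), offset_code (hd as # bs) (tl as))"
  show "?\<phi> ` D \<subseteq> ?H"
    using D(1) hook_map_hook_tensors by blast
  have dual: "orbit_tensor s (?c t) = (if s = t then 1 else (0::'a))" if "s \<in> ?S" "t \<in> ?S" for s t
  proof -
    obtain as bs cs ds where [simp]: "s = (as, bs)" "t = (cs, ds)"
      by (cases s, cases t) auto
    note s = semistandard_hooks_position[OF that(1)[simplified]] and t
        = semistandard_hooks_position[OF that(2)[simplified]]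
    show ?thesis
    proof (cases "s = t")
      case False
      have "\<not> (mset (row_code (hd as # bs) (tl as)) = mset (row_code (hd cs # ds) (tl cs)) \<and>
          mset (offset_code (hd as # bs) (tl as)) = mset (offset_code (hd cs # ds) (tl cs)))"
        using codes_inj[OF s(1-3) t(1-3) s(6,7) t(6,7)] False s(8) t(8) by auto
      then show ?thesis
        using False by (auto simp: orbit_tensor_def orbit_sum_def tensor_def)
    qed (simp add: orbit_tensor_def orbit_sum_def tensor_def)
  qed
  have indep: "c t = 0" if zero: "(\<Sum>s\<in>?S. fscale (c s) (?G s)) = 0" and t: "t \<in> ?S" for c t
  proof -
    let ?z = "\<Sum>s\<in>?S. fscale (c s) (orbit_tensor s) :: nat list \<times> nat list \<Rightarrow> 'a"
    have "?z \<in> D"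
      using orbit by (intro fvs.subspace_sum fvs.subspace_scale D(2))
    moreover have "?\<phi> ?z = 0"
      by (simp only: hook_map_sum zero)
    ultimately have "?z = 0"
      using D(1) hook_map_eq_0 by blast
    then have "?z (?c t) = 0"
      by simp
    moreover have "?z (?c t) = (\<Sum>s\<in>?S. if s = t then c s else 0)"
      unfolding sum_fun_apply fscale_def using t by (intro sum.cong refl) (simp add: dual)
    ultimately show ?thesis
      using t by simp
  qed
  have inj: "inj_on ?G ?S"
  proof (rule inj_onI)
    fix s t assume st: "s \<in> ?S" "t \<in> ?S" "?G s = ?G t"
    have "orbit_tensor s = (orbit_tensor t :: _ \<Rightarrow> 'a)"
      using inj_on_hook_map st(3) subsetD[OF D(1) orbit[OF st(1)]] subsetD[OF D(1) orbit[OF st(2)]]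
      by (rule inj_onD)
    then have "orbit_tensor s (?c t) = (orbit_tensor t (?c t) :: 'a)"
      by simp
    then show "s = t"
      using st by (simp add: dual split: if_splits)
  qed
  have fin: "finite ?S"
    by simp
  have indep_G: "fvs.independent (?G ` ?S)"
    unfolding fvs.dependent_finite[OF finite_imageI[OF fin]]
  proof (intro notI, elim exE conjE bexE)
    fix u v assume zero: "(\<Sum>v\<in>?G ` ?S. fscale (u v) v) = 0" and "v \<in> ?G ` ?S" "u v \<noteq> 0"
    have "(\<Sum>s\<in>?S. fscale (u (?G s)) (?G s)) = 0"
      using zero by (simp add: sum.reindex[OF inj] o_def)
    then show False
      using indep[of "\<lambda>s. u (?G s)"] \<open>v \<in> ?G ` ?S\<close> \<open>u v \<noteq> 0\<close> by auto
  qed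
  have GH: "?G ` ?S \<subseteq> ?H"
    using orbit D(1) hook_map_hook_tensors by blast
  have span: "?H = fvs.span (F_Delta ` ?S)"
    by (rule hook_tensors_eq_span) auto
  have bound: "card B \<le> card (F_Delta ` ?S :: (_ \<Rightarrow> 'a) set)" if "fvs.independent B" "B \<subseteq> ?H" for B
    using fvs.independent_span_bound[of "F_Delta ` ?S" B] that fin unfolding span by simp
  have "?H \<subseteq> fvs.span (?G ` ?S)"
  proof (rule subsetI, rule ccontr)
    fix P assume P: "P \<in> ?H" "P \<notin> fvs.span (?G ` ?S)"
    then have "card (insert P (?G ` ?S)) \<le> card (F_Delta ` ?S :: (_ \<Rightarrow> 'a) set)"
      using indep_G GH by (intro bound fvs.independent_insertI) auto
    also have "\<dots> \<le> card (?G ` ?S)"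
      using card_image_le[OF fin, of F_Delta] by (simp only: card_image[OF inj])
    also have "\<dots> < card (insert P (?G ` ?S))"
      using P(2) fvs.span_base[of P "?G ` ?S"] fin by (subst card_insert_disjoint) auto
    finally show False
      by simp
  qed
  also have "\<dots> \<subseteq> ?\<phi> ` D"
  proof (rule fvs.span_minimal)
    show "?G ` ?S \<subseteq> ?\<phi> ` D"
      using orbit by blast
    show "fvs.subspace (?\<phi> ` D)"
      unfolding fvs.subspace_def
    proof (intro conjI ballI allI; (elim imageE)?)
      have "?\<phi> 0 = 0"
        using hook_map_fscale[of M n e 0 "0 :: _ \<Rightarrow> 'a"] by simp
      then show "0 \<in> ?\<phi> ` D"
        using fvs.subspace_0[OF D(2)] by force
      show "x + y \<in> ?\<phi> ` D" if "x = ?\<phi> z" "z \<in> D" "y = ?\<phi> z'" "z' \<in> D" for x y z z'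
        using that fvs.subspace_add[OF D(2), of z z'] by (metis hook_map_add imageI)
      show "fscale c x \<in> ?\<phi> ` D" if "x = ?\<phi> z" "z \<in> D" for c x z
        using that fvs.subspace_scale[OF D(2), of z c] by (metis hook_map_fscale imageI)
    qed
  qed
  finally show "?H \<subseteq> ?\<phi> ` D" .
qed

section \<open>Representations given by matrices\<close>

text \<open>\<open>a g i k\<close> is the matrix entry in row \<open>i\<close> and column
  \<open>k\<close> on the whole coordinate space. The condition does not mention
  \<open>rep_space\<close>, so subrepresentations share the matrix of the ambient space; this
  matters because the action on a tensor product is defined through \<open>unit_vec\<close>, which
  need not lie in a subspace of symmetric tensors.\<close>

definition is_mat_rep :: "('i, 'a::field) rep \<Rightarrow> ('a ^ 2 ^ 2 \<Rightarrow> 'i \<Rightarrow> 'i \<Rightarrow> 'a) \<Rightarrow> bool" where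
  "is_mat_rep A a \<longleftrightarrow> finite (rep_index A) \<and>
     (\<forall>g z i. rep_act A g z i = (\<Sum>k\<in>rep_index A. z k * a g i k)) \<and>
     (\<forall>g\<in>SL2. \<forall>h\<in>SL2. \<forall>i. \<forall>k\<in>rep_index A. a (g ** h) i k = (\<Sum>l\<in>rep_index A. a g i l * a h l k)) \<and>
     (\<forall>i. \<forall>k\<in>rep_index A. a (mat 1) i k = (if i = k then 1 else 0)) \<and>
     (\<forall>g i. \<forall>k\<in>rep_index A. i \<notin> rep_index A \<longrightarrow> a g i k = 0)"

lemma is_mat_repD:
  assumes "is_mat_rep A a"
  shows "finite (rep_index A)"
    and "rep_act A g z = (\<lambda>i. \<Sum>k\<in>rep_index A. z k * a g i k)"
    and "g \<in> SL2 \<Longrightarrow> h \<in> SL2 \<Longrightarrow> k \<in> rep_index A \<Longrightarrow> a (g ** h) i k = (\<Sum>l\<in>rep_index A. a g i l * a h l k)"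
    and "k \<in> rep_index A \<Longrightarrow> a (mat 1) i k = (if i = k then 1 else 0)"
    and "k \<in> rep_index A \<Longrightarrow> i \<notin> rep_index A \<Longrightarrow> a g i k = 0"
  using assms unfolding is_mat_rep_def by (auto simp: fun_eq_iff)

lemma is_mat_rep_rep_space [simp]: "is_mat_rep (A\<lparr>rep_space := S\<rparr>) a = is_mat_rep A a"
  by (simp add: is_mat_rep_def)

lemma mat_rep_act_unit_vec:
  assumes "is_mat_rep A a" "k \<in> rep_index A"
  shows "rep_act A g (unit_vec k) i = a g i k"
proof -
  have "rep_act A g (unit_vec k) i = (\<Sum>j\<in>rep_index A. if j = k then a g i k else 0)"
    unfolding is_mat_repD(2)[OF assms(1)] by (intro sum.cong) (auto simp: unit_vec_def)
  then show ?thesis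
    using assms is_mat_repD(1)[OF assms(1)] by simp
qed

lemma mat_rep_act_linear:
  assumes "is_mat_rep A a"
  shows "rep_act A g (u + v) = rep_act A g u + rep_act A g v"
    and "rep_act A g (fscale c u) = fscale c (rep_act A g u)"
    and "rep_act A g 0 = 0"
  unfolding is_mat_repD(2)[OF assms]
  by (auto simp: fun_eq_iff fscale_def algebra_simps sum.distrib sum_distrib_left)

lemma is_rep_mat_rep:
  assumes a: "is_mat_rep A a" and subspace: "fvs.subspace (rep_space A)"
    and supp: "\<And>u i. u \<in> rep_space A \<Longrightarrow> i \<notin> rep_index A \<Longrightarrow> u i = 0"
    and stable: "\<And>g u. g \<in> SL2 \<Longrightarrow> u \<in> rep_space A \<Longrightarrow> rep_act A g u \<in> rep_space A"
  shows "is_rep A"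
proof -
  note D = is_mat_repD[OF a]
  have "rep_act A (mat 1) u = u" if "u \<in> rep_space A" for u
  proof
    fix i
    have "rep_act A (mat 1) u i = (\<Sum>k\<in>rep_index A. if i = k then u i else 0)"
      unfolding D(2) by (intro sum.cong) (auto simp: D(4))
    then show "rep_act A (mat 1) u i = u i"
      using D(1) supp[OF that, of i] by auto
  qed
  moreover have "rep_act A (g ** h) u = rep_act A g (rep_act A h u)" if "g \<in> SL2" "h \<in> SL2"
      for g h u
  proof
    fix i
    have "rep_act A (g ** h) u i = (\<Sum>k\<in>rep_index A. \<Sum>l\<in>rep_index A. u k * (a g i l * a h l k))"
      unfolding D(2) by (intro sum.cong refl) (simp add: D(3)[OF that] sum_distrib_left)
    also have "\<dots> = (\<Sum>l\<in>rep_index A. \<Sum>k\<in>rep_index A. u k * (a g i l * a h l k))"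
      by (rule sum.swap)
    also have "\<dots> = rep_act A g (rep_act A h u) i"
      unfolding D(2) by (intro sum.cong refl) (simp add: sum_distrib_left sum_distrib_right
          algebra_simps)
    finally show "rep_act A (g ** h) u i = rep_act A g (rep_act A h u) i" .
  qed
  ultimately show ?thesis
    unfolding is_rep_def using subspace stable by (simp add: mat_rep_act_linear[OF a])
qed

definition tensor_mat :: "('a::field ^ 2 ^ 2 \<Rightarrow> 'i \<Rightarrow> 'i \<Rightarrow> 'a) \<Rightarrow> ('a ^ 2 ^ 2 \<Rightarrow> 'j \<Rightarrow> 'j \<Rightarrow> 'a) \<Rightarrow>
    'a ^ 2 ^ 2 \<Rightarrow> 'i \<times> 'j \<Rightarrow> 'i \<times> 'j \<Rightarrow> 'a" where
  "tensor_mat a b g x y = a g (fst x) (fst y) * b g (snd x) (snd y)"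

definition power_mat :: "('a::field ^ 2 ^ 2 \<Rightarrow> 'i \<Rightarrow> 'i \<Rightarrow> 'a) \<Rightarrow> 'a ^ 2 ^ 2 \<Rightarrow> 'i list \<Rightarrow> 'i list \<Rightarrow>
    'a" where
  "power_mat a g xs ys = (if length xs = length ys then \<Prod>k<length ys. a g (xs ! k) (ys ! k) else 0)"

lemma is_mat_rep_tensor:
  assumes a: "is_mat_rep A a" and b: "is_mat_rep B b"
  shows "is_mat_rep (A \<otimes>\<^sub>r B) (tensor_mat a b)"
proof -
  note DA = is_mat_repD[OF a] and DB = is_mat_repD[OF b]
  have ix: "rep_index (A \<otimes>\<^sub>r B) = rep_index A \<times> rep_index B"
    by (simp add: tensor_rep_def)
  have "rep_act (A \<otimes>\<^sub>r B) g z x = (\<Sum>y\<in>rep_index A \<times> rep_index B. z y * tensor_mat a b g x y)"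
      for g z x
    unfolding tensor_rep_def
    by (simp, unfold sum_fun_apply, intro sum.cong refl)
       (auto simp: sum_fun_apply fscale_def tensor_def tensor_mat_def mat_rep_act_unit_vec[OF a]
           mat_rep_act_unit_vec[OF b] split: prod.splits)
  moreover have "tensor_mat a b (g ** h) x y = (\<Sum>l\<in>rep_index A \<times> rep_index B. tensor_mat a b g x
      l * tensor_mat a b h l y)"
    if "g \<in> SL2" "h \<in> SL2" "y \<in> rep_index A \<times> rep_index B" for g h x y
  proof -
    have "tensor_mat a b (g ** h) x y =
        (\<Sum>l\<in>rep_index A. a g (fst x) l * a h l (fst y)) * (\<Sum>l\<in>rep_index B. b g (snd x) l
            * b h l (snd y))"
      using that by (auto simp: tensor_mat_def DA(3) DB(3))
    also have "\<dots> = (\<Sum>l\<in>rep_index A \<times> rep_index B. tensor_mat a b g x l * tensor_mat a b h l y)"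
      by (simp add: sum_product sum.cartesian_product tensor_mat_def case_prod_beta algebra_simps)
    finally show ?thesis .
  qed
  ultimately show ?thesis
    unfolding is_mat_rep_def ix
    using DA(1) DB(1) by (auto simp: tensor_mat_def DA(4,5) DB(4,5) prod_eq_iff)
qed

lemma rep_index_tensor_power: "rep_index (tensor_power R A) = tuples R (rep_index A)"
  by (simp add: tensor_power_def tuples_def)

lemma is_mat_rep_power:
  assumes a: "is_mat_rep A a"
  shows "is_mat_rep (tensor_power R A) (power_mat a)"
proof -
  note D = is_mat_repD[OF a]
  let ?T = "tuples R (rep_index A)"
  have nth: "ys ! k \<in> rep_index A" if "ys \<in> ?T" "k < R" for ys k
    using that nth_mem[of k ys] by (auto simp: tuples_def)
  have "rep_act (tensor_power R A) g z xs = (\<Sum>ys\<in>?T. z ys * power_mat a g xs ys)" for g z xs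
  proof -
    have "rep_act (tensor_power R A) g z xs =
        (\<Sum>ys\<in>?T. z ys * pure_tensor (map (\<lambda>i. rep_act A g (unit_vec i)) ys) xs)"
      by (simp add: tensor_power_def tuples_def sum_fun_apply fscale_def)
    also have "\<dots> = (\<Sum>ys\<in>?T. z ys * power_mat a g xs ys)"
      by (intro sum.cong refl)
         (auto simp: pure_tensor_def power_mat_def length_tuples nth mat_rep_act_unit_vec[OF a]
             intro!: prod.cong)
    finally show ?thesis .
  qed
  moreover have "power_mat a (g ** h) xs ys = (\<Sum>l\<in>?T. power_mat a g xs l * power_mat a h l ys)"
    if "g \<in> SL2" "h \<in> SL2" "ys \<in> ?T" for g h xs ys
  proof (cases "length xs = R")
    case True
    have "power_mat a (g ** h) xs ys = (\<Prod>k<R. \<Sum>l\<in>rep_index A. a g (xs ! k) l * a h l (ys ! k))"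
      using that True by (auto simp: power_mat_def length_tuples nth D(3) intro!: prod.cong)
    also have "\<dots> = (\<Sum>l\<in>?T. \<Prod>k<R. a g (xs ! k) (l ! k) * a h (l ! k) (ys ! k))"
      by (rule prod_sum_tuples)
    also have "\<dots> = (\<Sum>l\<in>?T. power_mat a g xs l * power_mat a h l ys)"
      using that True by (intro sum.cong refl) (simp add: power_mat_def length_tuples prod.distrib)
    finally show ?thesis .
  next
    case False
    then show ?thesis
      using that(3) by (simp add: power_mat_def length_tuples)
  qed
  moreover have "power_mat a (mat 1) xs ys = (if xs = ys then 1 else 0)" if ys: "ys \<in> ?T" for xs ys
  proof (cases "length xs = length ys \<and> xs \<noteq> ys")
    case True
    then obtain k where k: "k < length ys" "xs ! k \<noteq> ys ! k"
      by (metis nth_equalityI)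
    then have "a (mat 1) (xs ! k) (ys ! k) = 0"
      using nth[OF ys] ys by (simp add: D(4) length_tuples)
    then show ?thesis
      using True k by (auto simp: power_mat_def)
  next
    case False
    have "(\<Prod>k<length ys. a (mat 1) (ys ! k) (ys ! k)) = 1"
      using ys by (intro prod.neutral ballI) (simp add: D(4) nth length_tuples)
    then show ?thesis
      using False by (auto simp: power_mat_def)
  qed
  moreover have "power_mat a g xs ys = 0" if ys: "ys \<in> ?T" and xs: "xs \<notin> ?T" for g xs ys
  proof (cases "length xs = R")
    case True
    then obtain k where k: "k < R" "xs ! k \<notin> rep_index A"
      using xs unfolding tuples_def mem_Collect_eq by (metis in_set_conv_nth subsetI)
    then have "a g (xs ! k) (ys ! k) = 0"
      using nth[OF ys] by (simp add: D(5))
    then show ?thesis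
      using k ys by (auto simp: power_mat_def length_tuples)
  qed (use ys in \<open>simp add: power_mat_def length_tuples\<close>)
  ultimately show ?thesis
    unfolding is_mat_rep_def rep_index_tensor_power
    using finite_tuples[OF D(1)] by blast
qed

section \<open>Matrices of the symmetric powers of the natural representation\<close>

definition sym_column :: "nat \<Rightarrow> 'a::field ^ 2 ^ 2 \<Rightarrow> nat \<Rightarrow> 'a poly poly" where
  "sym_column d g k = (bconst (g $ 1 $ 1) * X_poly + bconst (g $ 2 $ 1) * Y_poly) ^ (d - k)
     * (bconst (g $ 1 $ 2) * X_poly + bconst (g $ 2 $ 2) * Y_poly) ^ k"

definition sym_mat :: "nat \<Rightarrow> 'a::field ^ 2 ^ 2 \<Rightarrow> nat \<Rightarrow> nat \<Rightarrow> 'a" where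
  "sym_mat d g i k = sym_coords d (sym_column d g k) i"

lemma sym_column_homogeneous: "k \<le> d \<Longrightarrow> sym_column d g k \<in> homogeneous_polys d"
  using homogeneous_mult[OF homogeneous_power[OF homogeneous_linear] homogeneous_power[OF
      homogeneous_linear],
      of _ _ "d - k" _ _ k]
  by (simp add: sym_column_def)

lemma bcoeff_bconst_mult: "bcoeff (bconst c * P) i j = c * bcoeff P i j"
  by (simp add: bcoeff_def bconst_def)

lemma is_mat_rep_upper_sym: "is_mat_rep (upper_sym d) (sym_mat d)"
proof -
  have ix: "rep_index (upper_sym d) = {0..d}"
    by (simp add: upper_sym_def)
  have act: "rep_act (upper_sym d) g z i = (\<Sum>k\<in>{0..d}. z k * sym_mat d g i k)" for g ::
      "'a ^ 2 ^ 2" and z i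
    by (simp add: upper_sym_def poly_act_sym_poly sym_coords_def sym_mat_def sym_column_def
        bcoeff_sum
        mult.assoc bcoeff_bconst_mult atMost_atLeast0)
  have unit: "rep_act (upper_sym d) g (unit_vec k) i = sym_mat d g i k" if "k \<le> d" for g ::
      "'a ^ 2 ^ 2" and k i
  proof -
    have "rep_act (upper_sym d) g (unit_vec k) i = (\<Sum>j\<in>{0..d}. if j = k then sym_mat d g i k
        else 0)"
      unfolding act by (intro sum.cong) (auto simp: unit_vec_def)
    then show ?thesis
      using that by simp
  qed
  have space: "unit_vec k \<in> rep_space (upper_sym d)" if "k \<le> d" for k
    using that by (auto simp: upper_sym_def unit_vec_def)
  note rep = is_rep_upper_sym[of d, unfolded is_rep_def]
  have "sym_mat d (g ** h) i k = (\<Sum>l\<in>{0..d}. sym_mat d g i l * sym_mat d h l k)"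
    if "g \<in> SL2" "h \<in> SL2" "k \<le> d" for g h :: "'a ^ 2 ^ 2" and i k
  proof -
    have "sym_mat d (g ** h) i k = rep_act (upper_sym d) g (rep_act (upper_sym d) h (unit_vec k)) i"
      using rep that space[OF that(3)] by (metis unit)
    also have "\<dots> = (\<Sum>l\<in>{0..d}. sym_mat d g i l * sym_mat d h l k)"
      unfolding act[of g] by (simp add: unit[OF that(3)] mult.commute)
    finally show ?thesis .
  qed
  moreover have "sym_mat d (mat 1) i k = (if i = k then 1 else (0::'a))" if "k \<le> d" for i k
  proof -
    have "rep_act (upper_sym d) (mat 1) (unit_vec k) = (unit_vec k :: nat \<Rightarrow> 'a)"
      using rep space[OF that] by blast
    then have "sym_mat d (mat 1) i k = (unit_vec k i :: 'a)"
      using unit[OF that, of "mat 1" i] by simp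
    then show ?thesis
      by (simp add: unit_vec_def)
  qed
  moreover have "sym_mat d g i k = 0" if "i \<notin> {0..d}" for g :: "'a ^ 2 ^ 2" and i k
    using that by (simp add: sym_mat_def sym_coords_def)
  ultimately show ?thesis
    unfolding is_mat_rep_def ix act by auto
qed

text \<open>A matrix acts on polynomials by substitution, hence multiplicatively, so the column of a
  product of monomials is the product of their columns. Comparing coefficients gives the
  equivariance of multiplication in matrix form.\<close>

lemma sym_mat_mult:
  assumes "k \<le> n" "l \<le> e"
  shows "sym_mat (n + e) g i (k + l) =
    (\<Sum>(p, q)\<in>{0..n} \<times> {0..e}. if p + q = i then sym_mat n g p k * sym_mat e g q l else 0)"
proof -
  have col: "sym_column (n + e) g (k + l) = sym_column n g k * sym_column e g l"
  proof -
    have "n + e - (k + l) = (n - k) + (e - l)"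
      using assms by simp
    then show ?thesis
      by (simp add: sym_column_def power_add algebra_simps)
  qed
  have "sym_column n g k = sym_poly n (\<lambda>p. sym_mat n g p k)" "sym_column e g l
      = sym_poly e (\<lambda>q. sym_mat e g q l)"
    using assms by (simp_all add: sym_mat_def sym_poly_sym_coords sym_column_homogeneous)
  then have "sym_column (n + e) g (k + l) =
      (\<Sum>p\<le>n. bconst (sym_mat n g p k) * X_poly ^ (n - p) * Y_poly ^ p) *
      (\<Sum>q\<le>e. bconst (sym_mat e g q l) * X_poly ^ (e - q) * Y_poly ^ q)"
    by (simp only: col sym_poly_def)
  also have "\<dots> = (\<Sum>(p, q)\<in>{0..n} \<times> {0..e}. bconst (sym_mat n g p k * sym_mat e g q l) *
      X_poly ^ (n - p + (e - q)) * Y_poly ^ (p + q))"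
    unfolding sum_product sum.cartesian_product atMost_atLeast0
    by (intro sum.cong refl) (auto simp: bconst_mult power_add algebra_simps)
  finally have *: "bcoeff (sym_column (n + e) g (k + l)) (n + e - i) i =
      (\<Sum>x\<in>{0..n} \<times> {0..e}. if n + e - i = n - fst x + (e - snd x) \<and> i = fst x + snd x
        then sym_mat n g (fst x) k * sym_mat e g (snd x) l else 0)"
    by (simp add: bcoeff_sum bcoeff_monomial case_prod_beta)
  show ?thesis
  proof (cases "i \<le> n + e")
    case True
    then show ?thesis
      unfolding sym_mat_def[of "n + e"] sym_coords_def[of "n + e"] by (simp add:
          *) (intro sum.cong refl, auto)
  next
    case False
    then have "(\<Sum>(p, q)\<in>{0..n} \<times> {0..e}. if p + q = i then sym_mat n g p k * sym_mat e g q l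
        else 0) = 0"
      by (intro sum.neutral) auto
    then show ?thesis
      using False by (simp add: sym_mat_def[of "n + e"] sym_coords_def)
  qed
qed

section \<open>Equivariance\<close>

lemma alt_upt_permute:
  assumes "\<sigma> permutes {..<N}"
  shows "alt [0..<N] (permute_list \<sigma> [0..<N]) = of_int (sign \<sigma>)"
  using assms by (subst alt_permute) (simp_all add: alt_self)

lemma tuples_eq_permute_upt:
  assumes "is \<in> tuples N I" "mset is = mset [0..<N]"
  obtains \<sigma> where "\<sigma> permutes {..<N}" "is = permute_list \<sigma> [0..<N]"
  using mset_eq_permutation[OF assms(2)] by auto

lemma power_mat_permute:
  assumes "length xs = R" "length ys = R" "\<sigma> permutes {..<R}"
  shows "power_mat a g (permute_list \<sigma> xs) (permute_list \<sigma> ys) = power_mat a g xs ys"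
proof -
  have "(\<Prod>k<R. a g (xs ! \<sigma> k) (ys ! \<sigma> k)) = (\<Prod>k<R. a g (xs ! k) (ys ! k))"
    using prod.permute[OF assms(3), of "\<lambda>k. a g (xs ! k) (ys ! k)"] by (simp add: o_def)
  then show ?thesis
    using assms by (simp add: power_mat_def permute_list_nth)
qed

text \<open>Both sides are alternating in \<open>is\<close>, so only \<open>is = [0..<Suc n]\<close>
  matters, where the left side is the determinant of \<open>a g\<close>. A permutation other than
  \<open>id\<close> moves some point up and some point down, so it meets a zero of a triangular
  matrix, and the diagonal contributes 1.\<close>

lemma alt_power_mat_triangular:
  fixes a :: "'a::field ^ 2 ^ 2 \<Rightarrow> nat \<Rightarrow> nat \<Rightarrow> 'a"
  assumes diag: "\<And>i. i \<le> n \<Longrightarrow> a g i i = 1"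
    and tri: "(\<forall>i\<le>n. \<forall>k\<le>n. k < i \<longrightarrow> a g i k = 0) \<or> (\<forall>i\<le>n. \<forall>k\<le>n. i < k \<longrightarrow> a g i k = 0)"
    and "is": "is \<in> tuples (Suc n) {0..n}"
  shows "(\<Sum>ks\<in>tuples (Suc n) {0..n}. alt [0..<Suc n] ks * power_mat a g is ks) = alt [0..<Suc n] is"
proof -
  let ?T = "tuples (Suc n) {0..n}"
  let ?E = "\<lambda>is. \<Sum>ks\<in>?T. alt [0..<Suc n] ks * power_mat a g is ks"
  have summand: "alt [0..<Suc n] (permute_list \<sigma> ks) * power_mat a g (permute_list \<sigma> is)
      (permute_list \<sigma> ks) =
      of_int (sign \<sigma>) * (alt [0..<Suc n] ks * power_mat a g is ks)"
    if "length is = Suc n" "ks \<in> ?T" "\<sigma> permutes {..<Suc n}" for "is" ks \<sigma>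
    using that power_mat_permute[of "is" "Suc n" ks \<sigma> a g] by
        (simp add: alt_permute length_tuples del: upt_Suc)
  have E_permute: "?E (permute_list \<sigma> is) = of_int (sign \<sigma>) * ?E is"
    if "length is = Suc n" "\<sigma> permutes {..<Suc n}" for "is" \<sigma>
  proof -
    have "?E (permute_list \<sigma> is) = (\<Sum>ks\<in>?T. alt [0..<Suc n] (permute_list \<sigma> ks) *
        power_mat a g (permute_list \<sigma> is) (permute_list \<sigma> ks))"
      by (rule sum_tuples_permute[OF that(2), symmetric])
    also have "\<dots> = (\<Sum>ks\<in>?T. of_int (sign \<sigma>) * (alt [0..<Suc n] ks * power_mat a g is ks))"
      using that by (intro sum.cong refl summand) auto
    finally show ?thesis
      by (simp only: sum_distrib_left)
  qed
  have E_one: "?E [0..<Suc n] = 1"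
  proof -
    have "alt [0..<Suc n] ks * power_mat a g [0..<Suc n] ks = (if ks = [0..<Suc n] then 1 else 0)"
      if ks: "ks \<in> ?T" for ks
    proof (cases "ks = [0..<Suc n]")
      case True
      have "power_mat a g [0..<Suc n] [0..<Suc n] = (\<Prod>k<Suc n. a g ([0..<Suc n] ! k) ([0..<Suc
          n] ! k))"
        by (simp only: power_mat_def length_upt diff_zero if_True simp_thms)
      also have "\<dots> = 1"
        by (intro prod.neutral) (simp add: diag less_Suc_eq_le del: upt_Suc)
      finally show ?thesis
        by (simp only: True alt_self distinct_upt mult_1 if_True simp_thms)
    next
      case False
      have "alt [0..<Suc n] ks = (0::'a) \<or> power_mat a g [0..<Suc n] ks = 0"
      proof (cases "mset ks = mset [0..<Suc n]")
        case True
        then obtain \<sigma> where \<sigma>: "\<sigma> permutes {..<Suc n}" and ks': "ks = permute_list \<sigma> [0..<Suc n]"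
          using tuples_eq_permute_upt[OF ks] by blast
        have in_range: "\<sigma> k \<in> {..<Suc n}" if "k < Suc n" for k
          using that permutes_in_image[OF \<sigma>, of k] by simp
        have nth: "ks ! k = \<sigma> k" if "k < Suc n" for k
          using that in_range[OF that] \<sigma> unfolding ks' by (subst permute_list_nth)
              (simp_all del: upt_Suc)
        have "\<sigma> \<noteq> id"
          using False ks' by auto
        then have "\<exists>k<Suc n. a g k (\<sigma> k) = 0"
          using tri permutes_natset_ge[OF \<sigma>] permutes_natset_le[OF \<sigma>] in_range
          by (metis less_Suc_eq_le lessThan_iff not_le)
        then obtain k where k: "k < Suc n" "a g k (\<sigma> k) = 0"
          by blast
        have "(\<Prod>k<Suc n. a g ([0..<Suc n] ! k) (ks ! k)) = 0"
          using k by (intro prod_zero bexI[of _ k]) (simp_all add: nth del: upt_Suc)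
        then show ?thesis
          using ks by (simp add: power_mat_def length_tuples del: upt_Suc prod.lessThan_Suc)
      qed (simp add: alt_eq_0 del: upt_Suc)
      then show ?thesis
        using False by auto
    qed
    then have "?E [0..<Suc n] = (\<Sum>ks\<in>?T. if ks = [0..<Suc n] then 1 else 0)"
      by (intro sum.cong refl) blast
    also have "\<dots> = 1"
      by (subst sum.delta) (simp, auto simp: tuples_def)
    finally show ?thesis .
  qed
  show ?thesis
  proof (cases "distinct is")
    case True
    have "set is = {0..n}"
    proof (rule card_subset_eq)
      show "card (set is) = card {0..n}"
        using True "is" by (simp add: distinct_card tuples_def)
    qed (use "is" in \<open>auto simp: tuples_def\<close>)
    then have "mset is = mset [0..<Suc n]"
      using True set_eq_iff_mset_eq_distinct[of "is" "[0..<Suc n]"]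
      by (simp add: atLeastLessThanSuc_atLeastAtMost del: upt_Suc)
    then obtain \<sigma> where \<sigma>: "\<sigma> permutes {..<Suc n}" "is = permute_list \<sigma> [0..<Suc n]"
      using tuples_eq_permute_upt[OF assms(3)] by blast
    have "?E is = of_int (sign \<sigma>) * ?E [0..<Suc n]"
      unfolding \<sigma>(2) by (rule E_permute) (use \<sigma>(1) in simp_all)
    then show ?thesis
      by (simp only: E_one mult_1_right \<sigma>(2) alt_upt_permute[OF \<sigma>(1)])
  next
    case False
    obtain b c where bc: "b < length is" "c < length is" "b \<noteq> c"
      and fixed: "permute_list (Transposition.transpose b c) is = is"
      using exists_transpose_if_not_distinct[OF False] .
    let ?\<tau> = "Transposition.transpose b c"
    have len: "length is = Suc n"
      using "is" by (simp add: tuples_def)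
    have \<tau>: "?\<tau> permutes {..<Suc n}"
      using bc len by (auto simp: permutes_swap_id)
    have "?E is = 0"
    proof (rule sum_involution_eq_0[where \<iota> = "permute_list ?\<tau>"])
      fix ks assume ks: "ks \<in> ?T"
      show "permute_list ?\<tau> ks \<in> ?T"
        using ks \<tau> by simp
      show "permute_list ?\<tau> (permute_list ?\<tau> ks) = ks"
        using ks \<tau> by (simp add: length_tuples flip: permute_list_compose)
      show "alt [0..<Suc n] (permute_list ?\<tau> ks) * power_mat a g is (permute_list ?\<tau> ks) =
          - (alt [0..<Suc n] ks * power_mat a g is ks)"
        using summand[OF len ks \<tau>] bc by (simp add: fixed sign_swap_id del: upt_Suc)
      show "alt [0..<Suc n] ks * power_mat a g is ks = 0" if eq: "permute_list ?\<tau> ks = ks"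
      proof -
        have "ks ! b = ks ! c"
          using eq \<tau> ks bc(1) len by (metis length_tuples permute_list_nth transpose_apply_first)
        then have "\<not> distinct ks"
          using bc ks len nth_eq_iff_index_eq[of ks b c] by (auto simp: length_tuples)
        then have "alt [0..<Suc n] ks = (0::'a)"
          by (rule alt_not_distinct_right) simp
        then show ?thesis
          by (simp del: upt_Suc)
      qed
    qed simp
    moreover have "alt [0..<Suc n] is = (0::'a)"
      using False by (rule alt_not_distinct_right) simp
    ultimately show ?thesis
      by (simp only:)
  qed
qed

section \<open>Shears and the invariance of the Vandermonde determinant\<close>

lemma X_power: "X_poly ^ a = [:monom (1::'a::field) a:]"
  using monomial_eq[of 1 a 0] by (simp add: bconst_1 monom_0)

lemma Y_power: "Y_poly ^ a = monom (1::'a::field poly) a"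
  by (simp add: Y_poly_def monom_altdef)

text \<open>Here X is fixed and Y goes to Y + t X, so column \<open>k\<close> is X^(n-k) (Y + t
  X)^k, which has degree \<open>k\<close> in Y and leading coefficient X^(n-k).\<close>

lemma sym_mat_upper:
  assumes g: "g $ 1 $ 1 = 1" "g $ 2 $ 1 = 0" "g $ 2 $ 2 = 1" and "i \<le> n" "k \<le> n"
  shows "k < i \<Longrightarrow> sym_mat n g i k = 0" "sym_mat n g i i = 1"
proof -
  let ?p = "[:[:0, g $ 1 $ 2:], 1:]"
  have col: "sym_column n g k = smult (monom 1 (n - k)) (?p ^ k)" for k
    by (simp add: sym_column_def g bconst_0 bconst_1 X_power)
        (simp add: bconst_def X_poly_def Y_poly_def)
  have deg: "degree (?p ^ k) = k" for k
    by (simp add: degree_power_eq)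
  have "coeff (?p ^ i) i = 1"
    using lead_coeff_power[of ?p i] deg[of i] by simp
  then show "sym_mat n g i i = 1"
    using assms by (simp add: sym_mat_def sym_coords_def bcoeff_def col)
  show "sym_mat n g i k = 0" if "k < i"
    using that assms deg[of k] by (simp add: sym_mat_def sym_coords_def bcoeff_def col coeff_eq_0)
qed

text \<open>Here Y is fixed and X goes to X + t Y, so column \<open>k\<close> is divisible by Y^k,
  with cofactor (X + t Y)^(n-k).\<close>

lemma sym_mat_lower:
  assumes g: "g $ 1 $ 1 = 1" "g $ 1 $ 2 = 0" "g $ 2 $ 2 = 1" and "i \<le> n" "k \<le> n"
  shows "i < k \<Longrightarrow> sym_mat n g i k = 0" "sym_mat n g i i = 1"
proof -
  let ?p = "[:[:0, 1:], [:g $ 2 $ 1:]:]"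
  have col: "sym_column n g k = monom 1 k * ?p ^ (n - k)" for k
    by (simp add: sym_column_def g bconst_0 bconst_1 Y_power mult.commute)
        (simp add: bconst_def X_poly_def Y_poly_def)
  have "coeff (?p ^ (n - i)) 0 = [:0, 1:] ^ (n - i)"
    by (simp add: coeff_0_power)
  also have "\<dots> = monom 1 (n - i)"
    by (simp add: monom_altdef)
  finally show "sym_mat n g i i = 1"
    using assms by (simp add: sym_mat_def sym_coords_def bcoeff_def col coeff_monom_mult)
  show "sym_mat n g i k = 0" if "i < k"
    using that by (simp add: sym_mat_def sym_coords_def bcoeff_def col coeff_monom_mult)
qed

definition upper_shear :: "'a::field \<Rightarrow> 'a ^ 2 ^ 2" where
  "upper_shear t = vector [vector [1, t], vector [0, 1]]"

definition lower_shear :: "'a::field \<Rightarrow> 'a ^ 2 ^ 2" where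
  "lower_shear t = vector [vector [1, 0], vector [t, 1]]"

lemma shear_nth [simp]:
  "upper_shear t $ 1 $ 1 = 1" "upper_shear t $ 1 $ 2 = t" "upper_shear t $ 2 $ 1 = 0"
      "upper_shear t $ 2 $ 2 = 1"
  "lower_shear t $ 1 $ 1 = 1" "lower_shear t $ 1 $ 2 = 0" "lower_shear t $ 2 $ 1 = t"
      "lower_shear t $ 2 $ 2 = 1"
  by (simp_all add: upper_shear_def lower_shear_def)

lemma shear_SL2 [simp]: "upper_shear t \<in> SL2" "lower_shear t \<in> SL2"
  by (simp_all add: SL2_def det_2)

lemma SL2_mult: "g \<in> SL2 \<Longrightarrow> h \<in> SL2 \<Longrightarrow> g ** h \<in> SL2"
  by (simp add: SL2_def det_mul)

lemma mat_mult_2_nth: "((g :: 'a::field ^ 2 ^ 2) ** h) $ i $ j = g $ i $ 1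
    * h $ 1 $ j + g $ i $ 2 * h $ 2 $ j"
  by (simp add: matrix_matrix_mult_def sum_2)

lemma SL2_induct [consumes 1, case_names upper lower mult]:
  assumes g: "g \<in> SL2"
    and upper: "\<And>t. P (upper_shear t)" and lower: "\<And>t. P (lower_shear t)"
    and mult: "\<And>g h. g \<in> SL2 \<Longrightarrow> h \<in> SL2 \<Longrightarrow> P g \<Longrightarrow> P h \<Longrightarrow> P (g ** h)"
  shows "P g"
proof -
  have det: "g $ 1 $ 1 * g $ 2 $ 2 - g $ 1 $ 2 * g $ 2 $ 1 = 1" if "g \<in> SL2" for g :: "'a ^ 2 ^ 2"
    using that by (simp add: SL2_def det_2)
  have nz: "P g" if g: "g \<in> SL2" and c: "g $ 2 $ 1 \<noteq> 0" for g
  proof -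
    \<comment> \<open>The outer parameters are chosen to produce the two diagonal entries of
      \<open>g\<close>; the upper right entry is then forced by the determinant.\<close>
    have "g = (upper_shear ((g $ 1 $ 1 - 1) / g $ 2 $ 1) ** lower_shear (g $ 2 $ 1)) **
        upper_shear ((g $ 2 $ 2 - 1) / g $ 2 $ 1)"
      using c det[OF g] by (simp add: vec_eq_iff forall_2 mat_mult_2_nth field_simps)
    then show ?thesis
      using upper lower mult by (metis SL2_mult shear_SL2)
  qed
  show ?thesis
  proof (cases "g $ 2 $ 1 = 0")
    case True
    \<comment> \<open>The new lower left entry is \<open>g $ 1 $ 1\<close>, which is invertible
      since \<open>g\<close> is upper triangular of determinant 1.\<close>
    then have "(lower_shear 1 ** g) $ 2 $ 1 \<noteq> 0"
      using det[OF g] by (auto simp: mat_mult_2_nth)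
    then have "P (lower_shear 1 ** g)"
      using g by (intro nz SL2_mult) auto
    moreover have "g = lower_shear (- 1) ** (lower_shear 1 ** g)"
      by (simp add: vec_eq_iff forall_2 mat_mult_2_nth)
    ultimately show ?thesis
      using lower mult g by (metis SL2_mult shear_SL2(2))
  qed (use nz g in blast)
qed

text \<open>The invariance of V(x). Shears generate the group and act on symmetric powers by
  unitriangular matrices, so no determinant has to be computed for a general
  \<open>g\<close>.\<close>

lemma alt_SL2_invariant:
  assumes "g \<in> SL2" "xs \<in> tuples (Suc n) {0..n}"
  shows "(\<Sum>ks\<in>tuples (Suc n) {0..n}. alt [0..<Suc n] ks * power_mat (sym_mat n) g xs ks)
      = alt [0..<Suc n] xs"
proof -
  let ?T = "tuples (Suc n) {0..n}" and ?p = "power_mat (sym_mat n :: 'a ^ 2 ^ 2 \<Rightarrow> _)"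
  have rep: "is_mat_rep (tensor_power (Suc n) (upper_sym n)) ?p"
    by (intro is_mat_rep_power is_mat_rep_upper_sym)
  have ix: "rep_index (tensor_power (Suc n) (upper_sym n)) = ?T"
    by (simp add: rep_index_tensor_power upper_sym_def)
  have "\<forall>xs\<in>?T. (\<Sum>ks\<in>?T. alt [0..<Suc n] ks * ?p g xs ks) = alt [0..<Suc n] xs"
    using assms(1)
  proof (induction rule: SL2_induct)
    case (upper t)
    then show ?case
      by (intro ballI alt_power_mat_triangular) (auto simp: sym_mat_upper)
  next
    case (lower t)
    then show ?case
      by (intro ballI alt_power_mat_triangular) (auto simp: sym_mat_lower)
  next
    case (mult g h)
    show ?case
    proof
      fix xs assume xs: "xs \<in> ?T"
      have "(\<Sum>ks\<in>?T. alt [0..<Suc n] ks * ?p (g ** h) xs ks) =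
          (\<Sum>ks\<in>?T. \<Sum>ls\<in>?T. ?p g xs ls * (alt [0..<Suc n] ks * ?p h ls ks))"
        using is_mat_repD(3)[OF rep mult(1,2)] unfolding ix
        by (intro sum.cong refl) (simp add: sum_distrib_left mult.left_commute del: upt_Suc)
      also have "\<dots> = (\<Sum>ls\<in>?T. \<Sum>ks\<in>?T. ?p g xs ls * (alt [0..<Suc n] ks * ?p h ls ks))"
        by (rule sum.swap)
      also have "\<dots> = (\<Sum>ls\<in>?T. alt [0..<Suc n] ls * ?p g xs ls)"
        using mult(4) by (intro sum.cong refl) (simp add: mult.commute del: upt_Suc flip:
            sum_distrib_left)
      also have "\<dots> = alt [0..<Suc n] xs"
        using mult(3) xs by blast
      finally show "(\<Sum>ks\<in>?T. alt [0..<Suc n] ks * ?p (g ** h) xs ks) = alt [0..<Suc n] xs" .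
    qed
  qed
  then show ?thesis
    using assms(2) by blast
qed

section \<open>Compatibility of the multiplication map with the group action\<close>

lemma sum_tuples_append:
  "(\<Sum>xs\<in>tuples (R + S) I. f xs) = (\<Sum>ys\<in>tuples R I. \<Sum>zs\<in>tuples S I. f (ys @ zs))"
  by (induction R arbitrary: f) (simp_all add: sum_tuples_Suc)

lemma sum_tuples_Times:
  "(\<Sum>xs\<in>tuples R (I \<times> J). f (map fst xs) (map snd xs)) = (\<Sum>ys\<in>tuples R I. \<Sum>zs\<in>tuples R J. f ys zs)"
proof (induction R arbitrary: f)
  case (Suc R)
  have "(\<Sum>xs\<in>tuples (Suc R) (I \<times> J). f (map fst xs) (map snd xs)) =
      (\<Sum>x\<in>I. \<Sum>y\<in>J. \<Sum>xs\<in>tuples R (I \<times> J). f (x # map fst xs) (y # map snd xs))"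
    by (simp add: sum_tuples_Suc sum.cartesian_product')
  also have "\<dots> = (\<Sum>x\<in>I. \<Sum>y\<in>J. \<Sum>xs\<in>tuples R I. \<Sum>ys\<in>tuples R J. f (x # xs) (y # ys))"
    by (intro sum.cong refl) (rule Suc.IH[of "\<lambda>xs ys. f (_ # xs) (_ # ys)"])
  also have "\<dots> = (\<Sum>x\<in>I. \<Sum>xs\<in>tuples R I. \<Sum>y\<in>J. \<Sum>ys\<in>tuples R J. f (x # xs) (y # ys))"
    by (intro sum.cong refl) (rule sum.swap)
  finally show ?case
    by (simp add: sum_tuples_Suc)
qed simp

lemma power_mat_append:
  assumes "length xs = length xs'" "length ys = length ys'"
  shows "power_mat a g (xs @ ys) (xs' @ ys') = power_mat a g xs xs' * power_mat a g ys ys'"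
  using assms
proof (induction xs xs' rule: list_induct2)
  case (Cons x xs x' xs')
  have "power_mat a g (v # vs) (v' # vs') = a g v v' * power_mat a g vs vs'" for v v' vs vs'
    by (simp add: power_mat_def prod.lessThan_Suc_shift del: prod.lessThan_Suc)
  then show ?case
    using Cons by (simp add: mult.assoc)
qed (simp add: power_mat_def)

text \<open>The tensor power of \<open>sym_mat_mult\<close>: the condition on the sums holds
  position by position, so the sum over \<open>xs\<close> factors into one sum per position.\<close>

lemma power_mat_pair_sums:
  assumes xs': "xs' \<in> tuples R ({0..n} \<times> {0..e})"
  shows "(\<Sum>xs\<in>tuples R ({0..n} \<times> {0..e}). if pair_sums xs = is
      then power_mat (sym_mat n) g (map fst xs) (map fst xs')
          * power_mat (sym_mat e) g (map snd xs) (map snd xs')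
      else 0) = power_mat (sym_mat (n + e)) g is (pair_sums xs')"
proof (cases "length is = R")
  case True
  let ?I = "{0..n} \<times> {0..e}"
  let ?f = "\<lambda>k x. if fst x + snd x = is ! k
    then sym_mat n g (fst x) (fst (xs' ! k)) * sym_mat e g (snd x) (snd (xs' ! k)) else 0"
  have len: "length xs' = R"
    using xs' by (simp add: tuples_def)
  have "(if pair_sums xs = is
      then power_mat (sym_mat n) g (map fst xs) (map fst xs')
          * power_mat (sym_mat e) g (map snd xs) (map snd xs')
      else 0) = (\<Prod>k<R. ?f k (xs ! k))" if xs: "xs \<in> tuples R ?I" for xs
  proof (cases "pair_sums xs = is")
    case True
    have "fst (xs ! k) + snd (xs ! k) = is ! k" if "k < R" for k
      using True xs that by (auto simp: tuples_def case_prod_beta)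
    then have "(\<Prod>k<R. ?f k (xs ! k)) = (\<Prod>k<R. sym_mat n g (fst (xs ! k)) (fst (xs' ! k)) *
        sym_mat e g (snd (xs ! k)) (snd (xs' ! k)))"
      by (intro prod.cong) auto
    then show ?thesis
      using True xs len by (simp add: power_mat_def prod.distrib length_tuples)
  next
    case False
    then obtain k where "k < R" "fst (xs ! k) + snd (xs ! k) \<noteq> is ! k"
      using xs \<open>length is = R\<close> by (auto simp: tuples_def list_eq_iff_nth_eq case_prod_beta)
    then have "(\<Prod>k<R. ?f k (xs ! k)) = 0"
      by (intro prod_zero bexI[of _ k]) auto
    then show ?thesis
      using False by simp
  qed
  then have "(\<Sum>xs\<in>tuples R ?I. if pair_sums xs = is
      then power_mat (sym_mat n) g (map fst xs) (map fst xs')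
          * power_mat (sym_mat e) g (map snd xs) (map snd xs')
      else 0) = (\<Sum>xs\<in>tuples R ?I. \<Prod>k<R. ?f k (xs ! k))"
    by (intro sum.cong refl)
  also have "\<dots> = (\<Prod>k<R. \<Sum>x\<in>?I. ?f k x)"
    by (rule prod_sum_tuples[symmetric])
  also have "\<dots> = (\<Prod>k<R. sym_mat (n + e) g (is ! k) (fst (xs' ! k) + snd (xs' ! k)))"
  proof (intro prod.cong refl)
    fix k assume "k \<in> {..<R}"
    then have "xs' ! k \<in> ?I"
      using xs' nth_mem[of k xs'] by (auto simp: tuples_def)
    then have "fst (xs' ! k) \<le> n" "snd (xs' ! k) \<le> e"
      by auto
    then show "(\<Sum>x\<in>?I. ?f k x) = sym_mat (n + e) g (is ! k) (fst (xs' ! k) + snd (xs' ! k))"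
      by (simp add: sym_mat_mult case_prod_beta)
  qed
  also have "\<dots> = power_mat (sym_mat (n + e)) g is (pair_sums xs')"
    using True len by (simp add: power_mat_def case_prod_beta)
  finally show ?thesis .
next
  case False
  then have "pair_sums xs \<noteq> is" if "xs \<in> tuples R ({0..n} \<times> {0..e})" for xs
    using that by (auto simp: tuples_def)
  then show ?thesis
    using False xs' by (simp add: power_mat_def tuples_def)
qed

lemma sum_bilinear_exchange:
  fixes u :: "'i \<Rightarrow> 'j \<Rightarrow> 'a::comm_ring_1"
  shows "(\<Sum>x\<in>X. \<Sum>y\<in>Y. \<Sum>x'\<in>X'. \<Sum>y'\<in>Y'. u x' y' * (a x x' * b y y')) =
    (\<Sum>x'\<in>X'. \<Sum>y'\<in>Y'. u x' y' * ((\<Sum>x\<in>X. a x x') * (\<Sum>y\<in>Y. b y y')))"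
proof -
  have "(\<Sum>v\<in>X \<times> Y. \<Sum>w\<in>X' \<times> Y'. u (fst w) (snd w) * (a (fst v) (fst w) * b (snd v) (snd w))) =
      (\<Sum>w\<in>X' \<times> Y'. \<Sum>v\<in>X \<times> Y. u (fst w) (snd w) * (a (fst v) (fst w) * b (snd v) (snd w)))"
    by (rule sum.swap)
  then have "(\<Sum>x\<in>X. \<Sum>y\<in>Y. \<Sum>x'\<in>X'. \<Sum>y'\<in>Y'. u x' y' * (a x x' * b y y')) =
      (\<Sum>x'\<in>X'. \<Sum>y'\<in>Y'. \<Sum>x\<in>X. \<Sum>y\<in>Y. u x' y' * (a x x' * b y y'))"
    by (simp add: sum.cartesian_product')
  then show ?thesis
    unfolding sum_product by (simp only: sum_distrib_left)
qed

text \<open>Both sides reduce to the same sum over original exponents, split into pairs, in which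
  \<open>r\<close> transforms the sums of the pairs. On the left this requires V(x), f and g all to
  be transformed, and \<open>kernel\<close> then merges their matrices.\<close>

lemma hook_map_equivariant:
  fixes z :: "nat list \<times> nat list \<Rightarrow> 'a::field"
  assumes g: "g \<in> SL2"
    and A: "is_mat_rep A (tensor_mat (power_mat (sym_mat n)) (power_mat (sym_mat e)))"
      "rep_index A = tuples M {0..n} \<times> tuples (M + Suc n) {0..e}"
    and B: "is_mat_rep B (tensor_mat (power_mat (sym_mat (n + e))) (power_mat (sym_mat (n + e))))"
      "rep_index B = tuples (Suc n) {0..n + e} \<times> tuples M {0..n + e}"
  shows "hook_map M n e (rep_act A g z) = rep_act B g (hook_map M n e z)"
proof -
  let ?I = "{0..n}" and ?J = "{0..e}"
  let ?X = "tuples (Suc n) (?I \<times> ?J)" and ?Y = "tuples M (?I \<times> ?J)"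
  define p where "p = power_mat (sym_mat n) g"
  define q where "q = power_mat (sym_mat e) g"
  define r where "r = power_mat (sym_mat (n + e)) g"
  define u where "u = (\<lambda>xs ys. alt [0..<Suc n] (map fst xs) * z (map fst ys, map snd (xs @ ys)))"
  define c where "c = (\<lambda>xs xs'. p (map fst xs) (map fst xs') * q (map snd xs) (map snd xs'))"
  have hm: "hook_map M n e v (is, js) = (\<Sum>xs\<in>?X. \<Sum>ys\<in>?Y. if pair_sums xs = is \<and> pair_sums ys = js
      then alt [0..<Suc n] (map fst xs) * v (map fst ys, map snd (xs @ ys)) else 0)"
    for v :: "nat list \<times> nat list \<Rightarrow> 'a" and "is" js
    by (simp add: hook_map_def)
  have act: "alt [0..<Suc n] (map fst xs) * rep_act A g z (map fst ys, map snd (xs @ ys)) =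
      (\<Sum>xs'\<in>?X. \<Sum>ys'\<in>?Y. u xs' ys' * (c xs xs' * c ys ys'))"
    if xs: "xs \<in> ?X" and ys: "ys \<in> ?Y" for xs ys
  proof -
    have "rep_act A g z (map fst ys, map snd (xs @ ys)) =
        (\<Sum>ls\<in>tuples M ?I. \<Sum>ks\<in>tuples (M + Suc n) ?J. z (ls, ks) * (p (map fst ys) ls
            * q (map snd (xs @ ys)) ks))"
      unfolding is_mat_repD(2)[OF A(1)] A(2) by (simp add: sum.cartesian_product' tensor_mat_def
          p_def q_def)
    also have "\<dots> = (\<Sum>ls\<in>tuples M ?I. \<Sum>qs\<in>tuples (Suc n) ?J. \<Sum>ms\<in>tuples M ?J.
        z (ls, qs @ ms) * (p (map fst ys) ls * (q (map snd xs) qs * q (map snd ys) ms)))"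
      unfolding add.commute[of M] sum_tuples_append
      using xs ys by (intro sum.cong refl) (simp add: q_def power_mat_append length_tuples)
    also have "\<dots> = (\<Sum>qs\<in>tuples (Suc n) ?J. \<Sum>ls\<in>tuples M ?I. \<Sum>ms\<in>tuples M ?J.
        z (ls, qs @ ms) * (p (map fst ys) ls * (q (map snd xs) qs * q (map snd ys) ms)))"
      by (rule sum.swap)
    finally have z: "rep_act A g z (map fst ys, map snd (xs @ ys)) = \<dots>" .
    have c_xs: "c xs xs' = p (map fst xs) (map fst xs') * q (map snd xs) (map snd xs')" for xs'
      by (simp add: c_def)
    \<comment> \<open>The factor V(x) is untouched by the action on \<open>z\<close>; invariance
      rewrites it as its own transform. The assumption \<open>g \<in> SL2\<close> enters
      here.\<close>
    have a: "alt [0..<Suc n] (map fst xs) = (\<Sum>ps\<in>tuples (Suc n) ?I. alt [0..<Suc n] ps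
        * p (map fst xs) ps)"
      unfolding p_def using alt_SL2_invariant[OF g fst_tuples[OF xs]] by simp
    have "alt [0..<Suc n] (map fst xs) * rep_act A g z (map fst ys, map snd (xs @ ys)) =
      (\<Sum>ps\<in>tuples (Suc n) ?I. \<Sum>qs\<in>tuples (Suc n) ?J. \<Sum>ls\<in>tuples M ?I. \<Sum>ms\<in>tuples M ?J.
        alt [0..<Suc n] ps * z (ls, qs @ ms) *
        (p (map fst xs) ps * q (map snd xs) qs * (p (map fst ys) ls * q (map snd ys) ms)))"
      unfolding a z sum_product
      by (intro sum.cong refl) (simp add: sum_distrib_left mult_ac del: upt_Suc)
    also have "\<dots> = (\<Sum>ps\<in>tuples (Suc n) ?I. \<Sum>qs\<in>tuples (Suc n) ?J. \<Sum>ys'\<in>?Y.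
        alt [0..<Suc n] ps * z (map fst ys', qs @ map snd ys') *
        (p (map fst xs) ps * q (map snd xs) qs * c ys ys'))"
      unfolding c_def
    proof (intro sum.cong refl)
      fix ps qs
      show "(\<Sum>ls\<in>tuples M ?I. \<Sum>ms\<in>tuples M ?J. alt [0..<Suc n] ps * z (ls, qs @ ms) *
          (p (map fst xs) ps * q (map snd xs) qs * (p (map fst ys) ls * q (map snd ys) ms))) =
        (\<Sum>ys'\<in>?Y. alt [0..<Suc n] ps * z (map fst ys', qs @ map snd ys') *
          (p (map fst xs) ps * q (map snd xs) qs *
            (p (map fst ys) (map fst ys') * q (map snd ys) (map snd ys'))))"
        by (rule sum_tuples_Times[symmetric])
    qed
    also have "\<dots> = (\<Sum>xs'\<in>?X. \<Sum>ys'\<in>?Y. u xs' ys' * (c xs xs' * c ys ys'))"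
      unfolding u_def map_append c_xs
      by (rule sum_tuples_Times[symmetric, where f = "\<lambda>ps qs. \<Sum>ys'\<in>?Y. alt [0..<Suc n] ps *
         z (map fst ys', qs @ map snd ys') * (p (map fst xs) ps * q (map snd xs) qs * c ys ys')"])
    finally show ?thesis .
  qed
  have kernel: "(\<Sum>xs\<in>tuples R (?I \<times> ?J). if pair_sums xs = is then c xs xs' else 0)
      = r is (pair_sums xs')"
    if "xs' \<in> tuples R (?I \<times> ?J)" for R "is" xs'
    unfolding c_def p_def q_def r_def by (rule power_mat_pair_sums[OF that])
  have "hook_map M n e (rep_act A g z) (is, js) = rep_act B g (hook_map M n e z) (is, js)" for
      "is" js
  proof -
    have "hook_map M n e (rep_act A g z) (is, js) =
        (\<Sum>xs\<in>?X. \<Sum>ys\<in>?Y. \<Sum>xs'\<in>?X. \<Sum>ys'\<in>?Y. u xs' ys' *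
          ((if pair_sums xs = is then c xs xs' else 0) * (if pair_sums ys = js then c ys ys'
              else 0)))"
      unfolding hm
    proof (intro sum.cong refl, goal_cases)
      case (1 xs ys)
      then show ?case
        by (cases "pair_sums xs = is"; cases "pair_sums ys = js")
            (simp_all add: act del: map_append upt_Suc)
    qed
    also have "\<dots> = (\<Sum>xs'\<in>?X. \<Sum>ys'\<in>?Y. u xs' ys' * (r is (pair_sums xs') * r js (pair_sums ys')))"
      unfolding sum_bilinear_exchange by (intro sum.cong refl) (simp add: kernel)
    \<comment> \<open>The exponents of the product are introduced as new summation variables, so
      that the terms can be regrouped into values of \<open>hook_map M n e z\<close>.\<close>
    also have "\<dots> = (\<Sum>xs'\<in>?X. \<Sum>ys'\<in>?Y. u xs' ys' *
        ((\<Sum>is'\<in>tuples (Suc n) {0..n + e}. if pair_sums xs' = is' then r is is' else 0) *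
         (\<Sum>js'\<in>tuples M {0..n + e}. if pair_sums ys' = js' then r js js' else 0)))"
      by (intro sum.cong refl) (simp add: pair_sums_tuples)
    also have "\<dots> = (\<Sum>is'\<in>tuples (Suc n) {0..n + e}. \<Sum>js'\<in>tuples M {0..n + e}. \<Sum>xs'\<in>?X. \<Sum>ys'\<in>?Y.
        u xs' ys' * ((if pair_sums xs' = is' then r is is' else 0) * (if pair_sums ys' = js'
            then r js js' else 0)))"
      by (rule sum_bilinear_exchange[symmetric])
    also have "\<dots> = (\<Sum>is'\<in>tuples (Suc n) {0..n + e}. \<Sum>js'\<in>tuples M {0..n + e}.
        hook_map M n e z (is', js') * (r is is' * r js js'))"
      unfolding hm sum_distrib_right u_def
      by (intro sum.cong refl) (simp del: upt_Suc)
    also have "\<dots> = rep_act B g (hook_map M n e z) (is, js)"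
      unfolding is_mat_repD(2)[OF B(1)] B(2) by (simp add: sum.cartesian_product' tensor_mat_def
          r_def)
    finally show ?thesis .
  qed
  then show ?thesis
    by (auto simp: fun_eq_iff)
qed

text \<open>The pure tensors span every function supported on tuples, because each such function is
  a combination of basis tensors. Invariance under place permutations then means dependence on the
  multiset only; lists of a wrong length are harmless, as the function is 0 there.\<close>

lemma rep_space_lower_sym:
  "rep_space (lower_sym R (upper_sym n)) = {w :: nat list \<Rightarrow> 'a::field.
     (\<forall>is. is \<notin> tuples R {0..n} \<longrightarrow> w is = 0) \<and> (\<forall>xs ys. mset xs = mset ys \<longrightarrow> w xs = w ys)}"
    (is "_ = ?S")
proof (intro set_eqI iffI)
  let ?P = "{pure_tensor vs :: nat list \<Rightarrow> 'a | vs. length vs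
      = R \<and> set vs \<subseteq> rep_space (upper_sym n)}"
  have ls: "rep_space (lower_sym R (upper_sym n)) =
      {w :: nat list \<Rightarrow> 'a. w \<in> fvs.span ?P \<and> (\<forall>\<sigma>. \<sigma> permutes {..<R} \<longrightarrow> perm_tensor \<sigma> w = w)}"
    by (simp add: lower_sym_def tensor_power_def)
  have "fvs.span ?P \<subseteq> {w. \<forall>is. is \<notin> tuples R {0..n} \<longrightarrow> w is = 0}"
  proof (rule fvs.span_minimal)
    show "fvs.subspace {w :: nat list \<Rightarrow> 'a. \<forall>is. is \<notin> tuples R {0..n} \<longrightarrow> w is = 0}"
      by (auto simp: fvs.subspace_def fscale_def)
    have "pure_tensor vs is = 0"
      if vs: "length vs = R" "set vs \<subseteq> rep_space (upper_sym n)" and nin: "is \<notin> tuples R {0..n}"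
      for "is" and vs :: "(nat \<Rightarrow> 'a) list"
    proof (cases "length is = R")
      case True
      then obtain k where k: "k < R" "is ! k \<notin> {0..n}"
        using nin unfolding tuples_def mem_Collect_eq by (metis in_set_conv_nth subsetI)
      then have "vs ! k \<in> rep_space (upper_sym n)"
        using vs nth_mem[of k vs] by blast
      then have "(vs ! k) (is ! k) = 0"
        using k by (simp add: upper_sym_def)
      then show ?thesis
        using k vs by (auto simp: pure_tensor_def)
    qed (use vs in \<open>simp add: pure_tensor_def\<close>)
    then show "?P \<subseteq> {w. \<forall>is. is \<notin> tuples R {0..n} \<longrightarrow> w is = 0}"
      by auto
  qed
  then have supp: "w is = 0" if "w \<in> fvs.span ?P" "is \<notin> tuples R {0..n}" for w "is"
    using that by blast
  show "w \<in> ?S" if "w \<in> rep_space (lower_sym R (upper_sym n))" for w :: "nat list \<Rightarrow> 'a"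
  proof -
    have w: "w \<in> fvs.span ?P" "\<And>\<sigma>. \<sigma> permutes {..<R} \<Longrightarrow> perm_tensor \<sigma> w = w"
      using that unfolding ls by auto
    have "w xs = w ys" if eq: "mset xs = mset ys" for xs ys
    proof (cases "length ys = R")
      case True
      obtain \<sigma> where "\<sigma> permutes {..<length ys}" "permute_list \<sigma> ys = xs"
        using mset_eq_permutation[OF eq] .
      then show ?thesis
        using w(2)[of \<sigma>] True by (metis perm_tensor_def)
    next
      case False
      then have "xs \<notin> tuples R {0..n}" "ys \<notin> tuples R {0..n}"
        using mset_eq_length[OF eq] by (auto simp: tuples_def)
      then show ?thesis
        using supp[OF w(1)] by simp
    qed
    then show ?thesis
      using supp[OF w(1)] by blast
  qed
  show "w \<in> rep_space (lower_sym R (upper_sym n))" if w: "w \<in> ?S" for w :: "nat list \<Rightarrow> 'a"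
  proof -
    have w0: "w is = 0" if "is \<notin> tuples R {0..n}" for "is"
      using w that by blast
    have w_eq: "w xs = w ys" if "mset xs = mset ys" for xs ys
      using w that by blast
    have "w = (\<Sum>is\<in>tuples R {0..n}. fscale (w is) (pure_tensor (map unit_vec is)))"
    proof
      fix xs
      have "(\<Sum>is\<in>tuples R {0..n}. fscale (w is) (pure_tensor (map unit_vec is))) xs =
          (\<Sum>is\<in>tuples R {0..n}. if is = xs then w xs else 0)"
        unfolding sum_fun_apply by (intro sum.cong refl) (auto
            simp: fscale_def pure_tensor_unit_vec)
      then show "w xs = (\<Sum>is\<in>tuples R {0..n}. fscale (w is) (pure_tensor (map unit_vec is))) xs"
        by (simp add: w0)
    qed
    also have "\<dots> \<in> fvs.span ?P"
    proof (intro fvs.span_sum fvs.span_scale fvs.span_base)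
      fix "is" assume "is \<in> tuples R {0..n}"
      then have "length (map unit_vec is :: (nat \<Rightarrow> 'a) list) = R"
        "set (map unit_vec is) \<subseteq> (rep_space (upper_sym n) :: (nat \<Rightarrow> 'a) set)"
        by (auto simp: tuples_def upper_sym_def unit_vec_def)
      then show "(pure_tensor (map unit_vec is) :: nat list \<Rightarrow> 'a) \<in> ?P"
        by blast
    qed
    finally have "w \<in> fvs.span ?P" .
    moreover have "perm_tensor \<sigma> w = w" if "\<sigma> permutes {..<R}" for \<sigma>
    proof
      fix xs
      show "perm_tensor \<sigma> w xs = w xs"
      proof (cases "length xs = R")
        case True
        then have "mset (permute_list \<sigma> xs) = mset xs"
          using that by simp
        then show ?thesis
          unfolding perm_tensor_def by (rule w_eq)
      next
        case False
        then have "xs \<notin> tuples R {0..n}" "permute_list \<sigma> xs \<notin> tuples R {0..n}"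
          by (simp_all add: tuples_def)
        then show ?thesis
          by (simp add: perm_tensor_def w0)
      qed
    qed
    ultimately show ?thesis
      unfolding ls by blast
  qed
qed

section \<open>The isomorphism\<close>

lemma is_mat_rep_lower_sym:
  "is_mat_rep (lower_sym R (upper_sym n)) (power_mat (sym_mat n))"
  "rep_index (lower_sym R (upper_sym n)) = tuples R {0..n}"
  by (simp_all add: lower_sym_def is_mat_rep_power is_mat_rep_upper_sym rep_index_tensor_power)
     (simp add: upper_sym_def)

lemma is_mat_rep_weyl_hook:
  "is_mat_rep (weyl_hook M N (upper_sym d)) (tensor_mat (power_mat (sym_mat d)) (power_mat
      (sym_mat d)))"
  "rep_index (weyl_hook M N (upper_sym d)) = tuples N {0..d} \<times> tuples M {0..d}"
proof -
  show "is_mat_rep (weyl_hook M N (upper_sym d)) (tensor_mat (power_mat (sym_mat d)) (power_mat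
      (sym_mat d)))"
    unfolding weyl_hook_def ext_power_def is_mat_rep_rep_space
    by (intro is_mat_rep_tensor is_mat_rep_rep_space[THEN
        iffD2] is_mat_rep_power is_mat_rep_upper_sym)
  show "rep_index (weyl_hook M N (upper_sym d)) = tuples N {0..d} \<times> tuples M {0..d}"
    by (simp add: weyl_hook_def tensor_rep_def ext_power_def rep_index_tensor_power)
       (simp add: upper_sym_def)
qed

lemma lower_sym_stable:
  assumes "u \<in> rep_space (lower_sym R (upper_sym n))"
  shows "rep_act (lower_sym R (upper_sym n)) g u \<in> rep_space (lower_sym R (upper_sym n) :: (nat
      list, 'a::field) rep)"
proof -
  note D = is_mat_repD[OF is_mat_rep_lower_sym(1)[of R n], unfolded is_mat_rep_lower_sym(2)]
  let ?v = "rep_act (lower_sym R (upper_sym n)) g u"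
  have u: "u xs = u ys" if "mset xs = mset ys" for xs ys
    using assms that unfolding rep_space_lower_sym by blast
  have supp: "?v is = 0" if "is \<notin> tuples R {0..n}" for "is"
    unfolding D(2) using that by (intro sum.neutral) (simp add: D(5))
  have "?v xs = ?v ys" if eq: "mset xs = mset ys" for xs ys
  proof (cases "length ys = R")
    case True
    obtain \<sigma> where \<sigma>: "\<sigma> permutes {..<R}" "permute_list \<sigma> ys = xs"
      using mset_eq_permutation[OF eq] True by auto
    have "?v xs = (\<Sum>ks\<in>tuples R {0..n}. u (permute_list \<sigma> ks) *
        power_mat (sym_mat n) g (permute_list \<sigma> ys) (permute_list \<sigma> ks))"
      unfolding D(2) \<sigma>(2)[symmetric] by (rule sum_tuples_permute[OF \<sigma>(1), symmetric])
    also have "\<dots> = ?v ys"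
      unfolding D(2)
    proof (intro sum.cong refl arg_cong2[of _ _ _ _ "(*)"])
      fix ks assume "ks \<in> tuples R {0..n}"
      then have ks: "length ks = R"
        by (rule length_tuples)
      show "u (permute_list \<sigma> ks) = u ks"
        using \<sigma>(1) ks by (intro u mset_permute_list) simp
      show "power_mat (sym_mat n) g (permute_list \<sigma> ys) (permute_list \<sigma> ks)
          = power_mat (sym_mat n) g ys ks"
        using True ks \<sigma>(1) by (rule power_mat_permute)
    qed
    finally show ?thesis .
  next
    case False
    then have "xs \<notin> tuples R {0..n}" "ys \<notin> tuples R {0..n}"
      using mset_eq_length[OF eq] by (auto simp: tuples_def)
    then show ?thesis
      using supp by simp
  qed
  then show ?thesis
    using supp unfolding rep_space_lower_sym by blast
qed

lemma rep_act_tensor: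
  assumes a: "is_mat_rep A a" and b: "is_mat_rep B b"
  shows "rep_act (A \<otimes>\<^sub>r B) g (tensor u w) = tensor (rep_act A g u) (rep_act B g w)"
proof
  fix x
  have "rep_index (A \<otimes>\<^sub>r B) = rep_index A \<times> rep_index B"
    by (simp add: tensor_rep_def)
  then have "rep_act (A \<otimes>\<^sub>r B) g (tensor u w) x =
      (\<Sum>i\<in>rep_index A. \<Sum>j\<in>rep_index B. (u i * a g (fst x) i) * (w j * b g (snd x) j))"
    unfolding is_mat_repD(2)[OF is_mat_rep_tensor[OF a b]]
    by (simp add: sum.cartesian_product' tensor_def tensor_mat_def mult_ac)
  also have "\<dots> = tensor (rep_act A g u) (rep_act B g w) x"
    unfolding is_mat_repD(2)[OF a] is_mat_repD(2)[OF b] tensor_def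
    by (cases x) (simp add: sum_product)
  finally show "rep_act (A \<otimes>\<^sub>r B) g (tensor u w) x = tensor (rep_act A g u) (rep_act B g w) x" .
qed

lemma tensor_rep_stable:
  assumes a: "is_mat_rep A a" and b: "is_mat_rep B b"
    and A: "\<And>u. u \<in> rep_space A \<Longrightarrow> rep_act A g u \<in> rep_space A"
    and B: "\<And>u. u \<in> rep_space B \<Longrightarrow> rep_act B g u \<in> rep_space B"
    and z: "z \<in> rep_space (A \<otimes>\<^sub>r B)"
  shows "rep_act (A \<otimes>\<^sub>r B) g z \<in> rep_space (A \<otimes>\<^sub>r B)"
proof -
  let ?P = "{tensor u w | u w. u \<in> rep_space A \<and> w \<in> rep_space B}"
  note lin = mat_rep_act_linear[OF is_mat_rep_tensor[OF a b]]
  have space: "rep_space (A \<otimes>\<^sub>r B) = fvs.span ?P"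
    by (simp add: tensor_rep_def)
  have "fvs.span ?P \<subseteq> {z. rep_act (A \<otimes>\<^sub>r B) g z \<in> fvs.span ?P}"
  proof (rule fvs.span_minimal)
    show "?P \<subseteq> {z. rep_act (A \<otimes>\<^sub>r B) g z \<in> fvs.span ?P}"
    proof clarify
      fix u w assume "u \<in> rep_space A" "w \<in> rep_space B"
      then show "rep_act (A \<otimes>\<^sub>r B) g (tensor u w) \<in> fvs.span ?P"
        unfolding rep_act_tensor[OF a b] using A B by (intro fvs.span_base) blast
    qed
    show "fvs.subspace {z. rep_act (A \<otimes>\<^sub>r B) g z \<in> fvs.span ?P}"
      by (auto simp: fvs.subspace_def lin fvs.span_add fvs.span_scale fvs.span_zero)
  qed
  then show ?thesis
    using z unfolding space by blast
qed

theorem theorem1p1: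
  fixes M N d :: nat
  assumes "N \<ge> 1" and "N \<le> d + 1"
  shows "lower_sym M (upper_sym (N - 1)) \<otimes>\<^sub>r lower_sym (M + N) (upper_sym (d + 1 - N))
           \<cong>\<^sub>r weyl_hook M N (upper_sym d :: (nat, 'a::field) rep)"
proof -
  define n e where "n = N - 1" and "e = d + 1 - N"
  have N: "N = Suc n" and d: "d = n + e"
    using assms by (auto simp: n_def e_def)
  let ?S1 = "lower_sym M (upper_sym n) :: (nat list, 'a) rep"
  let ?S2 = "lower_sym (M + Suc n) (upper_sym e) :: (nat list, 'a) rep"
  let ?A = "?S1 \<otimes>\<^sub>r ?S2" and ?B = "weyl_hook M (Suc n) (upper_sym (n + e) :: (nat, 'a) rep)"
  let ?\<phi> = "hook_map M n e :: _ \<Rightarrow> (_ \<Rightarrow> 'a)"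
  have A: "is_mat_rep ?A (tensor_mat (power_mat (sym_mat n)) (power_mat (sym_mat e)))"
    "rep_index ?A = tuples M {0..n} \<times> tuples (M + Suc n) {0..e}"
    by (intro is_mat_rep_tensor is_mat_rep_lower_sym) (simp add: tensor_rep_def
        is_mat_rep_lower_sym(2))
  note B = is_mat_rep_weyl_hook[of M "Suc n" "n + e"]
  have spaceA: "rep_space ?A = fvs.span {tensor u w | u w. u \<in> rep_space ?S1 \<and> w \<in> rep_space ?S2}"
    by (simp add: tensor_rep_def)
  have spaceB: "rep_space ?B = hook_tensors M (Suc n) {0..n + e}"
    by (simp add: weyl_hook_def upper_sym_def hook_tensors_eq_span)
  have subspaceA: "fvs.subspace (rep_space ?A)"
    unfolding spaceA by simp
  have sym: "rep_space ?A \<subseteq> sym_tensors M n e"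
    unfolding spaceA
  proof (rule fvs.span_minimal[OF _ subspace_sym_tensors])
    have "tensor u w \<in> sym_tensors M n e" if u: "u \<in> rep_space ?S1" and w: "w \<in> rep_space ?S2"
        for u w
    proof -
      have "u ls = 0 \<or> w ms = 0" if "\<not> (ls \<in> tuples M {0..n} \<and> ms \<in> tuples (M + Suc n) {0..e})"
          for ls ms
        using u w that unfolding rep_space_lower_sym by blast
      moreover have "u ls = u ls' \<and> w ms = w ms'" if "mset ls = mset ls' \<and> mset ms = mset ms'"
          for ls ls' ms ms'
        using u w that unfolding rep_space_lower_sym by blast
      ultimately show ?thesis
        unfolding sym_tensors_def tensor_def mem_Collect_eq prod.case
            by (metis mult_zero_left mult_zero_right)
    qed
    then show "{tensor u w | u w. u \<in> rep_space ?S1 \<and> w \<in> rep_space ?S2} \<subseteq> sym_tensors M n e"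
      by blast
  qed
  have orbit: "orbit_tensor s \<in> rep_space ?A" if s: "s \<in> semistandard_hooks M (Suc n) {0..n +
      e}" for s
  proof -
    obtain as bs where s_eq: "s = (as, bs)"
      by (cases s)
    note pos = semistandard_hooks_position[OF s[unfolded s_eq]]
    have os: "(orbit_sum xs :: _ \<Rightarrow> 'a) \<in> rep_space (lower_sym R (upper_sym m))" if xs:
        "xs \<in> tuples R {0..m}" for xs R m
    proof -
      have "ys \<in> tuples R {0..m}" if "mset ys = mset xs" for ys
        using xs mset_eq_length[OF that] mset_eq_setD[OF that] by (simp add: tuples_def)
      then show ?thesis
        unfolding rep_space_lower_sym orbit_sum_def by auto
    qed
    show ?thesis
      unfolding spaceA s_eq orbit_tensor_def prod.case
      using os[OF codes_in_tuples(1)[OF pos(1-5,7)]] os[OF codes_in_tuples(2)[OF pos(1-5,7)]]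
      by (intro fvs.span_base) blast
  qed
  have image: "?\<phi> ` rep_space ?A = rep_space ?B"
    unfolding spaceB by (rule hook_map_image[OF sym subspaceA orbit])
  have equivariant: "?\<phi> (rep_act ?A g z) = rep_act ?B g (?\<phi> z)" if "g \<in> SL2" for g z
    by (rule hook_map_equivariant[OF that A B])
  have stable: "rep_act ?A g z \<in> rep_space ?A" if "z \<in> rep_space ?A" for g z
    by (rule tensor_rep_stable[OF is_mat_rep_lower_sym(1) is_mat_rep_lower_sym(1)
        lower_sym_stable lower_sym_stable that])
  have "is_rep ?A"
  proof (rule is_rep_mat_rep[OF A(1) subspaceA _ stable])
    fix z i assume z: "z \<in> rep_space ?A" and i: "i \<notin> rep_index ?A"
    obtain ls ms where "i = (ls, ms)"
      by (cases i)
    then show "z i = 0"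
      using i sym_tensorsD(1)[OF subsetD[OF sym z], of ls ms] unfolding A(2) by blast
  qed
  moreover have "is_rep ?B"
  proof (rule is_rep_mat_rep[OF B(1)])
    show "fvs.subspace (rep_space ?B)"
      unfolding spaceB by (rule subspace_hook_tensors)
    show "z i = 0" if z: "z \<in> rep_space ?B" and i: "i \<notin> rep_index ?B" for z i
    proof -
      obtain xs ys where "i = (xs, ys)"
        by (cases i)
      then show ?thesis
        using i hook_tensorsD(1)[OF z[unfolded spaceB], of xs ys] unfolding B(2) by blast
    qed
    show "rep_act ?B g z \<in> rep_space ?B" if g: "g \<in> SL2" and z: "z \<in> rep_space ?B" for g z
    proof -
      \<comment> \<open>Stability of the span of the \<open>F_Delta t\<close> comes from the map
        itself: every element is an image, and equivariance moves the action back to the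
        domain.\<close>
      obtain z' where z': "z' \<in> rep_space ?A" "z = ?\<phi> z'"
        using z image by blast
      have "rep_act ?B g z = ?\<phi> (rep_act ?A g z')"
        by (simp only: z'(2) equivariant[OF g])
      then show ?thesis
        using stable[OF z'(1), of g] image by blast
    qed
  qed
  moreover have "bij_betw ?\<phi> (rep_space ?A) (rep_space ?B)"
    using inj_on_subset[OF inj_on_hook_map sym] image by (simp add: bij_betw_def)
  ultimately have "?A \<cong>\<^sub>r ?B"
    unfolding rep_iso_def using hook_map_add hook_map_fscale equivariant by blast
  then show ?thesis
    by (simp only: N d) simp
qed

end
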